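(* Let $M$ be a closed $n$-dimensional manifold ($n>1$) with a smooth family of Riemannian metrics $g(t)$, $t\in[0,T]$, satisfying $\partial_t g_{ij}=-2h_{ij}$, where $h=h(t)$ is a smooth time-dependent symmetric $(0,2)$-tensor. Let $\lambda(t)$ be the first nonzero eigenvalue of the Laplacian $\Delta_{g(t)}$ and let $\varphi(t,x)$ be a corresponding eigenfunction, $-\Delta_{g(t)}\varphi(t,\cdot)=\lambda(t)\varphi(t,\cdot)$, where $\lambda$ depends smoothly on $t$ and $\varphi$ depends smoothly on $(t,x)$. Then $\lambda(t)$ evolves by $$\frac{d}{dt}\lambda(t)\int_M\varphi^2\,d\mu=\lambda(t)\int_M\mathcal{H}\varphi^2\,d\mu-\int_M\mathcal{H}|\nabla\varphi|^2\,d\mu+2\int_M\langle h,d\varphi\otimes d\varphi\rangle\,d\mu .$$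
   Context: Closed means compact without boundary. $\Delta_{g}=\operatorname{div}\operatorname{grad}$ is the Laplace–Beltrami operator, $\mathcal{H}=g^{ij}h_{ij}$ is the metric trace of $h$, and $d\mu=d\mu_{g(t)}$ is the Riemannian volume measure. Norms, gradients and the pairing $\langle h,d\varphi\otimes d\varphi\rangle=h^{ij}\nabla_i\varphi\nabla_j\varphi$ are taken with respect to $g(t)$. *)

theory Defs
  imports "HOL-Analysis.Analysis"
begin

subsection \<open>Smooth maps on subsets of Euclidean spaces\<close>

primrec Ck_on :: "nat \<Rightarrow> 'a::euclidean_space set \<Rightarrow> ('a \<Rightarrow> 'b::real_normed_vector) \<Rightarrow> bool" where
  "Ck_on 0 S f \<longleftrightarrow> continuous_on S f"
| "Ck_on (Suc k) S f \<longleftrightarrow>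
     (\<forall>x\<in>S. f differentiable (at x)) \<and>
     (\<forall>b\<in>Basis. Ck_on k S (\<lambda>x. frechet_derivative f (at x) b))"

text \<open>
  Smoothness on an arbitrary set is local extendability to a smooth map on an open set. On an
  open set this is ordinary smoothness; on \<open>{0..T} \<times> V\<close> with \<open>V\<close> open it is smoothness up to the
  endpoints of the time interval.
\<close>

definition smooth_on :: "'a::euclidean_space set \<Rightarrow> ('a \<Rightarrow> 'b::real_normed_vector) \<Rightarrow> bool" where
  "smooth_on S f \<longleftrightarrow>
     (\<forall>x\<in>S. \<exists>U F. open U \<and> x \<in> U \<and> (\<forall>k. Ck_on k U F) \<and> (\<forall>y\<in>U \<inter> S. F y = f y))"

subsection \<open>Closed manifolds\<close>

type_synonym ('m, 'n) chart = "'m set \<times> ('m \<Rightarrow> real ^ 'n)"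

abbreviation cdom :: "('m, 'n) chart \<Rightarrow> 'm set" where
  "cdom c \<equiv> fst c"

abbreviation cmap :: "('m, 'n) chart \<Rightarrow> 'm \<Rightarrow> real ^ 'n" where
  "cmap c \<equiv> snd c"

definition cimg :: "('m, 'n) chart \<Rightarrow> (real ^ 'n) set" where
  "cimg c = cmap c ` cdom c"

definition cinv :: "('m, 'n) chart \<Rightarrow> real ^ 'n \<Rightarrow> 'm" where
  "cinv c = inv_into (cdom c) (cmap c)"

definition chart_on :: "'m::t2_space set \<Rightarrow> ('m, 'n::finite) chart \<Rightarrow> bool" where
  "chart_on M c \<longleftrightarrow>
     openin (top_of_set M) (cdom c) \<and> open (cimg c) \<and>
     homeomorphism (cdom c) (cimg c) (cmap c) (cinv c)"

definition smooth_atlas :: "'m::t2_space set \<Rightarrow> ('m, 'n::finite) chart set \<Rightarrow> bool" where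
  "smooth_atlas M A \<longleftrightarrow>
     (\<forall>c\<in>A. chart_on M c) \<and> (\<Union>c\<in>A. cdom c) = M \<and>
     (\<forall>c\<in>A. \<forall>d\<in>A. smooth_on (cmap c ` (cdom c \<inter> cdom d)) (cmap d \<circ> cinv c))"

text \<open>
  Charts take values in open subsets of \<open>real ^ 'n\<close>, so there is no boundary. Second countability
  follows from compactness.
\<close>

definition closed_manifold :: "'m::t2_space set \<Rightarrow> ('m, 'n::finite) chart set \<Rightarrow> bool" where
  "closed_manifold M A \<longleftrightarrow> compact M \<and> smooth_atlas M A"

definition smooth_fun :: "('m, 'n::finite) chart set \<Rightarrow> ('m \<Rightarrow> real) \<Rightarrow> bool" where
  "smooth_fun A u \<longleftrightarrow> (\<forall>c\<in>A. smooth_on (cimg c) (u \<circ> cinv c))"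

definition smooth_fun_family ::
    "('m, 'n::finite) chart set \<Rightarrow> real set \<Rightarrow> (real \<Rightarrow> 'm \<Rightarrow> real) \<Rightarrow> bool" where
  "smooth_fun_family A I u \<longleftrightarrow>
     (\<forall>c\<in>A. smooth_on (I \<times> cimg c) (\<lambda>(t, x). u t (cinv c x)))"

definition partial :: "('m, 'n::finite) chart \<Rightarrow> 'n \<Rightarrow> ('m \<Rightarrow> real) \<Rightarrow> 'm \<Rightarrow> real" where
  "partial c i u p = frechet_derivative (u \<circ> cinv c) (at (cmap c p)) (axis i 1)"

subsection \<open>Tensor fields\<close>

text \<open>
  Tensor fields are given classically, by their components in every chart of the atlas, subject to
  the transformation law. Scalars built from components are evaluated at \<open>p\<close> in the chart
  \<open>chart_at A p\<close>; by the transformation law the choice of chart is immaterial.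
\<close>

type_synonym ('m, 'n) tensor02 = "('m, 'n) chart \<Rightarrow> 'm \<Rightarrow> real ^ 'n ^ 'n"

type_synonym ('m, 'n) vfield = "('m, 'n) chart \<Rightarrow> 'm \<Rightarrow> real ^ 'n"

definition chart_at :: "('m, 'n) chart set \<Rightarrow> 'm \<Rightarrow> ('m, 'n) chart" where
  "chart_at A p = (SOME c. c \<in> A \<and> p \<in> cdom c)"

definition transition_jacobian ::
    "('m, 'n::finite) chart \<Rightarrow> ('m, 'n) chart \<Rightarrow> 'm \<Rightarrow> real ^ 'n ^ 'n" where
  "transition_jacobian c d p = matrix (frechet_derivative (cmap c \<circ> cinv d) (at (cmap d p)))"

definition symmetric_tensor02 ::
    "('m, 'n::finite) chart set \<Rightarrow> ('m, 'n) tensor02 \<Rightarrow> bool" where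
  "symmetric_tensor02 A h \<longleftrightarrow>
     (\<forall>c\<in>A. \<forall>p\<in>cdom c. transpose (h c p) = h c p) \<and>
     (\<forall>c\<in>A. \<forall>d\<in>A. \<forall>p\<in>cdom c \<inter> cdom d.
        h d p = transpose (transition_jacobian c d p) ** h c p ** transition_jacobian c d p)"

definition smooth_tensor02 :: "('m, 'n::finite) chart set \<Rightarrow> ('m, 'n) tensor02 \<Rightarrow> bool" where
  "smooth_tensor02 A h \<longleftrightarrow> (\<forall>c\<in>A. smooth_on (cimg c) (\<lambda>x. h c (cinv c x)))"

definition smooth_tensor02_family ::
    "('m, 'n::finite) chart set \<Rightarrow> real set \<Rightarrow> (real \<Rightarrow> ('m, 'n) tensor02) \<Rightarrow> bool" where
  "smooth_tensor02_family A I h \<longleftrightarrow>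
     (\<forall>c\<in>A. smooth_on (I \<times> cimg c) (\<lambda>(t, x). h t c (cinv c x)))"

subsection \<open>Riemannian metrics\<close>

definition riemannian_metric ::
    "('m, 'n::finite) chart set \<Rightarrow> ('m, 'n) tensor02 \<Rightarrow> bool" where
  "riemannian_metric A g \<longleftrightarrow>
     symmetric_tensor02 A g \<and> smooth_tensor02 A g \<and>
     (\<forall>c\<in>A. \<forall>p\<in>cdom c. \<forall>v. v \<noteq> 0 \<longrightarrow> 0 < v \<bullet> (g c p *v v))"

definition vol_density :: "('m, 'n::finite) tensor02 \<Rightarrow> ('m, 'n) chart \<Rightarrow> 'm \<Rightarrow> real" where
  "vol_density g c p = sqrt (det (g c p))"

text \<open>
  The Riemannian volume measure is the unique Borel measure on \<open>M\<close> which in every chart has density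
  \<open>sqrt (det g\<^sub>i\<^sub>j)\<close> with respect to Lebesgue measure.
\<close>

definition riemannian_volume ::
    "'m::t2_space set \<Rightarrow> ('m, 'n::finite) chart set \<Rightarrow> ('m, 'n) tensor02 \<Rightarrow> 'm measure" where
  "riemannian_volume M A g =
     (THE \<mu>. sets \<mu> = sets (restrict_space borel M) \<and>
        (\<forall>c\<in>A. \<forall>E\<in>sets \<mu>. E \<subseteq> cdom c \<longrightarrow>
           emeasure \<mu> E = (\<integral>\<^sup>+ x \<in> cmap c ` E. ennreal (vol_density g c (cinv c x)) \<partial>lborel)))"

definition grad :: "('m, 'n::finite) tensor02 \<Rightarrow> ('m \<Rightarrow> real) \<Rightarrow> ('m, 'n) vfield" where
  "grad g u c p = matrix_inv (g c p) *v (\<chi> i. partial c i u p)"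

definition divergence ::
    "('m, 'n::finite) chart set \<Rightarrow> ('m, 'n) tensor02 \<Rightarrow> ('m, 'n) vfield \<Rightarrow> 'm \<Rightarrow> real" where
  "divergence A g X p =
     (let c = chart_at A p in
        (\<Sum>i\<in>UNIV. partial c i (\<lambda>q. vol_density g c q * X c q $ i) p) / vol_density g c p)"

definition laplacian ::
    "('m, 'n::finite) chart set \<Rightarrow> ('m, 'n) tensor02 \<Rightarrow> ('m \<Rightarrow> real) \<Rightarrow> 'm \<Rightarrow> real" where
  "laplacian A g u = divergence A g (grad g u)"

definition grad_norm ::
    "('m, 'n::finite) chart set \<Rightarrow> ('m, 'n) tensor02 \<Rightarrow> ('m \<Rightarrow> real) \<Rightarrow> 'm \<Rightarrow> real" where
  "grad_norm A g u p =
     (let c = chart_at A p in sqrt (grad g u c p \<bullet> (g c p *v grad g u c p)))"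

definition metric_trace ::
    "('m, 'n::finite) chart set \<Rightarrow> ('m, 'n) tensor02 \<Rightarrow> ('m, 'n) tensor02 \<Rightarrow> 'm \<Rightarrow> real" where
  "metric_trace A g h p =
     (let c = chart_at A p in
        \<Sum>i\<in>UNIV. \<Sum>j\<in>UNIV. matrix_inv (g c p) $ i $ j * h c p $ i $ j)"

definition raise_indices ::
    "('m, 'n::finite) tensor02 \<Rightarrow> ('m, 'n) tensor02 \<Rightarrow> ('m, 'n) chart \<Rightarrow> 'm \<Rightarrow> real ^ 'n ^ 'n" where
  "raise_indices g h c p =
     (\<chi> i j. \<Sum>k\<in>UNIV. \<Sum>l\<in>UNIV.
        matrix_inv (g c p) $ i $ k * matrix_inv (g c p) $ j $ l * h c p $ k $ l)"

definition tensor_pairing ::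
    "('m, 'n::finite) chart set \<Rightarrow> ('m, 'n) tensor02 \<Rightarrow> ('m, 'n) tensor02 \<Rightarrow> ('m \<Rightarrow> real) \<Rightarrow>
     'm \<Rightarrow> real" where
  "tensor_pairing A g h u p =
     (let c = chart_at A p in
        \<Sum>i\<in>UNIV. \<Sum>j\<in>UNIV. raise_indices g h c p $ i $ j * partial c i u p * partial c j u p)"

subsection \<open>Eigenvalues of the Laplacian\<close>

definition laplace_eigenfunction ::
    "'m set \<Rightarrow> ('m, 'n::finite) chart set \<Rightarrow> ('m, 'n) tensor02 \<Rightarrow> real \<Rightarrow> ('m \<Rightarrow> real) \<Rightarrow> bool" where
  "laplace_eigenfunction M A g \<nu> u \<longleftrightarrow>
     smooth_fun A u \<and> (\<exists>p\<in>M. u p \<noteq> 0) \<and> (\<forall>p\<in>M. - laplacian A g u p = \<nu> * u p)"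

definition laplace_eigenvalue ::
    "'m set \<Rightarrow> ('m, 'n::finite) chart set \<Rightarrow> ('m, 'n) tensor02 \<Rightarrow> real \<Rightarrow> bool" where
  "laplace_eigenvalue M A g \<nu> \<longleftrightarrow> (\<exists>u. laplace_eigenfunction M A g \<nu> u)"

definition first_nonzero_eigenvalue ::
    "'m set \<Rightarrow> ('m, 'n::finite) chart set \<Rightarrow> ('m, 'n) tensor02 \<Rightarrow> real \<Rightarrow> bool" where
  "first_nonzero_eigenvalue M A g \<nu> \<longleftrightarrow>
     laplace_eigenvalue M A g \<nu> \<and> \<nu> \<noteq> 0 \<and>
     (\<forall>\<nu>'. laplace_eigenvalue M A g \<nu>' \<and> \<nu>' \<noteq> 0 \<longrightarrow> \<nu> \<le> \<nu>')"

end

theory Submission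
  imports Defs
begin

text \<open>
  Fix \<open>t\<close> and put \<open>u = \<phi> t\<close>. By Green's formula the eigenvalue equation at time \<open>s\<close>, tested against
  \<open>u\<close>, and the one at time \<open>t\<close>, tested against \<open>\<phi> s\<close>, read
  \<open>a\<^sub>s (\<phi> s, u) = lam s * m\<^sub>s (\<phi> s, u)\<close> and \<open>a\<^sub>t (\<phi> s, u) = lam t * m\<^sub>t (\<phi> s, u)\<close>, where \<open>a\<^sub>s\<close> is the
  Dirichlet form and \<open>m\<^sub>s\<close> the inner product of \<open>L\<^sup>2\<close> for \<open>g s\<close>. Subtracting, dividing by \<open>s - t\<close> and
  letting \<open>s\<close> tend to \<open>t\<close> only differentiates the coefficients of the two forms, for
  which \<open>\<partial>\<^sub>t sqrt (det g) = - H sqrt (det g)\<close> and \<open>\<partial>\<^sub>t g\<^sup>i\<^sup>j = 2 h\<^sup>i\<^sup>j\<close>; no time derivative of \<open>\<phi>\<close> occurs.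
\<close>

subsection \<open>Determinants and inverse matrices\<close>

text \<open>Three obstacles shape the development. The measures \<open>vols s\<close> vary with
  \<open>s\<close>, so integrals at two times are compared only after a partition of unity, chosen
  once and independent of the metric, has turned them into Lebesgue integrals over fixed chart
  images; there time enters through the integrand alone and dominated convergence applies. The
  volume is a definite description, so its existence and uniqueness have to be earned from change of
  variables between charts. Scalars such as the Laplacian are evaluated in a chart chosen
  arbitrarily at each point, so their regularity is invisible until chart independence is known. For
  the Laplacian a direct computation would differentiate Jacobians of transition maps; the weak
  formulation avoids this. As it takes only one derivative of a test function, explicit C1 bumps are
  good enough for the partition of unity. Limits in time run along sequences inside
  \<open>{0..T}\<close>, which treats the endpoints like interior times.\<close>

lemma matrix_inv_mult:
  fixes A :: "real^'n^'n"
  assumes "det A \<noteq> 0"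
  shows "A ** matrix_inv A = mat 1" "matrix_inv A ** A = mat 1"
proof -
  have "\<exists>A'. A ** A' = mat 1 \<and> A' ** A = mat 1"
    using assms invertible_det_nz[of A] by (simp add: invertible_def)
  from someI_ex[OF this] show "A ** matrix_inv A = mat 1" "matrix_inv A ** A = mat 1"
    by (auto simp: matrix_inv_def)
qed

lemma matrix_inv_unique:
  fixes A :: "real^'n^'n"
  assumes "A ** B = mat 1"
  shows "matrix_inv A = B"
proof -
  have "det A * det B = 1"
    using assms by (metis det_I det_mul)
  then have "det A \<noteq> 0" by auto
  then have "matrix_inv A ** (A ** B) = B"
    by (simp add: matrix_mul_assoc matrix_inv_mult)
  then show ?thesis
    by (simp add: assms)
qed

lemma matrix_inv_symmetric:
  fixes A :: "real^'n^'n"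
  assumes "det A \<noteq> 0" "transpose A = A"
  shows "transpose (matrix_inv A) = matrix_inv A"
proof -
  have "A ** transpose (matrix_inv A) = transpose (matrix_inv A ** A)"
    using assms by (simp add: matrix_transpose_mul)
  also have "\<dots> = mat 1"
    using assms by (simp add: matrix_inv_mult)
  finally show ?thesis
    by (rule matrix_inv_unique[symmetric])
qed

text \<open>Cramer's rule, applied to the linear system that column \<open>j\<close> of the inverse
  solves. Entries of the inverse become quotients of determinants, so their limits, continuity and
  C1 regularity reduce to those of polynomials in the entries of \<open>A\<close>.\<close>

lemma matrix_inv_component:
  fixes A :: "real^'n^'n"
  assumes "det A \<noteq> 0"
  shows "matrix_inv A $ i $ j = det (\<chi> k l. if l = i then mat 1 $ k $ j else A $ k $ l) / det A"
proof -
  have "A *v column j (matrix_inv A) = column j (A ** matrix_inv A)"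
    by (simp add: vec_eq_iff matrix_vector_mult_def matrix_matrix_mult_def column_def)
  also have "\<dots> = column j (mat 1)"
    using assms by (simp add: matrix_inv_mult)
  finally have "column j (matrix_inv A) $ i =
      det (\<chi> k l. if l = i then column j (mat 1) $ k else A $ k $ l) / det A"
    by (subst (asm) cramer[OF assms]) simp
  then show ?thesis
    by (simp add: column_def cong: if_cong)
qed

lemma tendsto_det:
  fixes f :: "'a \<Rightarrow> real^'n^'n"
  assumes "\<And>i j. ((\<lambda>x. f x $ i $ j) \<longlongrightarrow> L $ i $ j) F"
  shows "((\<lambda>x. det (f x)) \<longlongrightarrow> det L) F"
  unfolding det_def by (intro tendsto_intros assms)

lemma tendsto_matrix_inv:
  fixes f :: "'a \<Rightarrow> real^'n^'n"
  assumes "\<And>i j. ((\<lambda>x. f x $ i $ j) \<longlongrightarrow> L $ i $ j) F" and "det L \<noteq> 0"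
    and "\<forall>\<^sub>F x in F. det (f x) \<noteq> 0"
  shows "((\<lambda>x. matrix_inv (f x) $ i $ j) \<longlongrightarrow> matrix_inv L $ i $ j) F"
proof (rule Lim_transform_eventually)
  show "((\<lambda>x. det (\<chi> k l. if l = i then mat 1 $ k $ j else f x $ k $ l) / det (f x))
      \<longlongrightarrow> matrix_inv L $ i $ j) F"
    unfolding matrix_inv_component[OF assms(2)]
    by (intro tendsto_divide tendsto_det assms(1,2)) (auto intro: assms(1))
  show "\<forall>\<^sub>F x in F. det (\<chi> k l. if l = i then mat 1 $ k $ j else f x $ k $ l) / det (f x)
      = matrix_inv (f x) $ i $ j"
    using assms(3) by eventually_elim (simp add: matrix_inv_component)
qed

lemma continuous_on_det:
  fixes f :: "'a::topological_space \<Rightarrow> real^'n^'n"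
  assumes "continuous_on S f"
  shows "continuous_on S (\<lambda>x. det (f x))"
  using assms unfolding continuous_on_def
  by (intro ballI tendsto_det tendsto_vec_nth) blast

lemma continuous_on_matrix_inv_component:
  fixes f :: "'a::topological_space \<Rightarrow> real^'n^'n"
  assumes "continuous_on S f" "\<And>x. x \<in> S \<Longrightarrow> det (f x) \<noteq> 0"
  shows "continuous_on S (\<lambda>x. matrix_inv (f x) $ i $ j)"
  unfolding continuous_on_def
proof
  fix x assume "x \<in> S"
  show "((\<lambda>x. matrix_inv (f x) $ i $ j) \<longlongrightarrow> matrix_inv (f x) $ i $ j) (at x within S)"
    using assms \<open>x \<in> S\<close> unfolding continuous_on_def
    by (intro tendsto_matrix_inv tendsto_vec_nth) (auto simp: eventually_at_filter)
qed

text \<open>Along the segment from the identity to \<open>A\<close> the determinant never vanishes.\<close>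

lemma det_pos_if_positive_definite:
  fixes A :: "real^'n^'n"
  assumes "\<And>v. v \<noteq> 0 \<Longrightarrow> 0 < v \<bullet> (A *v v)"
  shows "det A > 0"
proof (rule ccontr)
  assume "\<not> det A > 0"
  define B where "B s = (1 - s) *\<^sub>R mat 1 + s *\<^sub>R A" for s :: real
  have nz: "det (B s) \<noteq> 0" if s: "s \<in> {0..1}" for s
  proof -
    have pos: "0 < v \<bullet> (B s *v v)" if "v \<noteq> 0" for v
    proof -
      have eq: "v \<bullet> (B s *v v) = (1 - s) * (v \<bullet> v) + s * (v \<bullet> (A *v v))"
        by (simp add: B_def matrix_vector_mult_add_rdistrib scaleR_matrix_vector_assoc[symmetric]
            inner_add_right)
      show ?thesis
      proof (cases "s = 0")
        case False
        then have "s * (v \<bullet> (A *v v)) > 0" using s assms that by auto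
        moreover have "(1 - s) * (v \<bullet> v) \<ge> 0" using s by auto
        ultimately show ?thesis using eq by linarith
      qed (use eq that in auto)
    qed
    have "\<exists>C. C ** B s = mat 1"
      unfolding matrix_left_invertible_ker using pos inner_zero_right less_irrefl by metis
    then show ?thesis
      unfolding invertible_left_inverse[symmetric] invertible_det_nz .
  qed
  have cont: "continuous_on {0..1} (\<lambda>s. det (B s))"
    unfolding B_def by (intro continuous_on_det continuous_intros)
  have "det (B 0) = 1" "det (B 1) \<le> 0"
    using \<open>\<not> det A > 0\<close> by (auto simp: B_def)
  then have "\<exists>s\<ge>0. s \<le> 1 \<and> det (B s) = 0"
    using IVT2'[of "\<lambda>s. det (B s)" 1 0 0] cont by auto
  then show False
    using nz by auto
qed

text \<open>In the Leibniz expansion a permutation other than the identity moves at least two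
  indices: if \<open>p j\<close> differs from \<open>j\<close>, then \<open>p j\<close> is moved as
  well. After one factor has been differentiated, an off-diagonal entry of the identity matrix is
  still in the product and kills it. Only the diagonal term survives, and it gives the
  trace.\<close>

lemma has_derivative_det_at_identity:
  fixes A :: "real \<Rightarrow> real^'n^'n"
  assumes "\<And>i j. ((\<lambda>s. A s $ i $ j) has_real_derivative A' $ i $ j) (at t within S)"
    and At: "A t = mat 1"
  shows "((\<lambda>s. det (A s)) has_real_derivative trace A') (at t within S)"
proof -
  have d: "((\<lambda>s. A s $ i $ j) has_derivative (\<lambda>y. y * A' $ i $ j)) (at t within S)" for i j
    using has_derivative_eq_rhs[OF assms(1)[of i j, unfolded has_field_derivative_def]]
    by (simp add: fun_eq_iff)
  have *: "(\<Sum>i\<in>UNIV. y * A' $ i $ p i * (\<Prod>j\<in>UNIV - {i}. A t $ j $ p j)) =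
      (if p = id then y * trace A' else 0)" if p: "p permutes UNIV" for p :: "'n \<Rightarrow> 'n" and y
  proof (cases "p = id")
    case True
    then show ?thesis
      by (simp add: At mat_def trace_def sum_distrib_left)
  next
    case False
    have "(\<Prod>j\<in>UNIV - {i}. A t $ j $ p j) = 0" for i
    proof -
      obtain j where j: "p j \<noteq> j" using False by (metis eq_id_iff)
      have "\<exists>k. k \<noteq> i \<and> p k \<noteq> k"
      proof (cases "j = i")
        case True
        have "p (p i) \<noteq> p i"
          using j True permutes_inj[OF p] by (auto simp: inj_def)
        then show ?thesis using j True by blast
      qed (use j in auto)
      then obtain k where k: "k \<noteq> i" "p k \<noteq> k" by blast
      then show ?thesis
        by (intro prod_zero) (auto simp: At mat_def intro!: bexI[of _ k])
    qed
    then show ?thesis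
      using False by (simp only: if_False mult_zero_right sum.neutral_const)
  qed
  have "((\<lambda>s. det (A s)) has_derivative
      (\<lambda>y. \<Sum>p\<in>{p. p permutes (UNIV::'n set)}. of_int (sign p) *
        (\<Sum>i\<in>UNIV. y * A' $ i $ p i * (\<Prod>j\<in>UNIV - {i}. A t $ j $ p j)))) (at t within S)"
    unfolding det_def by (intro has_derivative_sum has_derivative_mult_right has_derivative_prod d)
  also have "(\<lambda>y. \<Sum>p\<in>{p. p permutes (UNIV::'n set)}. of_int (sign p) *
        (\<Sum>i\<in>UNIV. y * A' $ i $ p i * (\<Prod>j\<in>UNIV - {i}. A t $ j $ p j))) =
      (\<lambda>y. \<Sum>p\<in>{p. p permutes (UNIV::'n set)}. if p = id then y * trace A' else 0)"
    by (intro ext sum.cong refl) (simp add: * sign_id)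
  also have "\<dots> = (\<lambda>y. trace A' * y)"
    by (simp add: sum.delta permutes_id finite_permutations mult.commute)
  finally show ?thesis
    by (simp add: has_field_derivative_def)
qed

text \<open>Jacobi's formula. Multiplication by the constant matrix \<open>matrix_inv (A t)\<close>
  moves the base point to the identity, and multiplicativity of the determinant brings the factor
  \<open>det (A t)\<close> back.\<close>

lemma has_derivative_det:
  fixes A :: "real \<Rightarrow> real^'n^'n"
  assumes "\<And>i j. ((\<lambda>s. A s $ i $ j) has_real_derivative A' $ i $ j) (at t within S)"
    and nz: "det (A t) \<noteq> 0"
  shows "((\<lambda>s. det (A s)) has_real_derivative det (A t) * trace (matrix_inv (A t) ** A'))
    (at t within S)"
proof -
  define B where "B = matrix_inv (A t)"
  have "((\<lambda>s. det (B ** A s)) has_real_derivative trace (B ** A')) (at t within S)"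
  proof (rule has_derivative_det_at_identity)
    show "B ** A t = mat 1" using nz by (simp add: B_def matrix_inv_mult)
    show "((\<lambda>s. (B ** A s) $ i $ j) has_real_derivative (B ** A') $ i $ j) (at t within S)" for i j
      by (auto simp: matrix_matrix_mult_def mult.commute intro!: derivative_eq_intros assms)
  qed
  from DERIV_cmult[OF this, of "det (A t)"]
  have "((\<lambda>s. det (A t) * det (B ** A s)) has_real_derivative det (A t) * trace (B ** A'))
      (at t within S)" .
  moreover have "det (A t) * det (B ** C) = det C" for C
    using nz by (metis B_def det_I det_mul matrix_inv_mult(1) mult.assoc mult_1)
  ultimately show ?thesis by (simp add: B_def)
qed

text \<open>The identity \<open>A(s)^-1 - A(t)^-1 = - A(s)^-1 (A(s) - A(t)) A(t)^-1\<close>, divided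
  by \<open>s - t\<close>, exhibits the limit: besides the derivative of \<open>A\<close> it takes
  only the continuity of the inverse.\<close>

lemma has_derivative_matrix_inv:
  fixes A :: "real \<Rightarrow> real^'n^'n"
  assumes der: "\<And>i j. ((\<lambda>s. A s $ i $ j) has_real_derivative A' $ i $ j) (at t within S)"
    and nz: "\<And>s. s \<in> S \<Longrightarrow> det (A s) \<noteq> 0" and "t \<in> S"
  shows "((\<lambda>s. matrix_inv (A s) $ i $ j) has_real_derivative
      - (matrix_inv (A t) ** A' ** matrix_inv (A t)) $ i $ j) (at t within S)"
  unfolding has_field_derivative_iff
proof (rule Lim_transform_eventually)
  let ?B = "matrix_inv (A t)"
  have A: "((\<lambda>s. A s $ i $ j) \<longlongrightarrow> A t $ i $ j) (at t within S)" for i j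
    using der[of i j] DERIV_continuous continuous_within by blast
  show "((\<lambda>s. - (\<Sum>l\<in>UNIV. (\<Sum>k\<in>UNIV. matrix_inv (A s) $ i $ k *
      ((A s $ k $ l - A t $ k $ l) / (s - t))) * ?B $ l $ j)) \<longlongrightarrow>
      - (matrix_inv (A t) ** A' ** matrix_inv (A t)) $ i $ j) (at t within S)"
    unfolding matrix_matrix_mult_def
    using der nz \<open>t \<in> S\<close>
    by (auto simp: has_field_derivative_iff eventually_at_filter simp del: times_divide_eq_right
        intro!: tendsto_minus tendsto_sum tendsto_mult tendsto_const tendsto_matrix_inv A)
  have "- (\<Sum>l\<in>UNIV. (\<Sum>k\<in>UNIV. matrix_inv (A s) $ i $ k *
      ((A s $ k $ l - A t $ k $ l) / (s - t))) * ?B $ l $ j) =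
      (matrix_inv (A s) $ i $ j - ?B $ i $ j) / (s - t)" if s: "s \<in> S" for s
  proof -
    have left: "C ** (D - E) = C ** D - C ** E" and right: "(D - E) ** C = D ** C - E ** C"
      for C D E :: "real^'n^'n"
      by (simp_all add: vec_eq_iff matrix_matrix_mult_def algebra_simps sum_subtractf)
    have "matrix_inv (A s) ** (A s - A t) ** ?B = ?B - matrix_inv (A s)"
      using nz[OF s] nz[OF \<open>t \<in> S\<close>]
      by (simp add: left right matrix_inv_mult flip: matrix_mul_assoc)
    then have "(\<Sum>l\<in>UNIV. (\<Sum>k\<in>UNIV. matrix_inv (A s) $ i $ k *
      (A s $ k $ l - A t $ k $ l)) * ?B $ l $ j) = ?B $ i $ j - matrix_inv (A s) $ i $ j"
      by (simp add: vec_eq_iff matrix_matrix_mult_def)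
    then have "(\<Sum>l\<in>UNIV. (\<Sum>k\<in>UNIV. matrix_inv (A s) $ i $ k *
      (A s $ k $ l - A t $ k $ l)) * ?B $ l $ j) / (s - t) = 
       (?B $ i $ j - matrix_inv (A s) $ i $ j) / (s - t)" by simp
    then show ?thesis
      by (simp add: sum_divide_distrib sum_distrib_right minus_divide_left)
  qed
  then show "\<forall>\<^sub>F s in at t within S. - (\<Sum>l\<in>UNIV. (\<Sum>k\<in>UNIV. matrix_inv (A s) $ i $ k *
      ((A s $ k $ l - A t $ k $ l) / (s - t))) * ?B $ l $ j) =
      (matrix_inv (A s) $ i $ j - ?B $ i $ j) / (s - t)"
    by (simp add: eventually_at_filter)
qed

subsection \<open>Change of variables\<close>

text \<open>
  The change of variables theorem of the library needs a wellordered index type, so coordinates are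
  relabelled by the numbers below \<open>CARD('n)\<close>.
\<close>

typedef (overloaded) ('n::finite) idx = "{..<CARD('n)}"
  morphisms idx_nat nat_idx
  by (auto intro: exI[of _ 0])

instantiation idx :: (finite) wellorder
begin

definition less_eq_idx :: "'a idx \<Rightarrow> 'a idx \<Rightarrow> bool" where
  "less_eq_idx i j \<longleftrightarrow> idx_nat i \<le> idx_nat j"

definition less_idx :: "'a idx \<Rightarrow> 'a idx \<Rightarrow> bool" where
  "less_idx i j \<longleftrightarrow> idx_nat i < idx_nat j"

instance
proof
  fix P :: "'a idx \<Rightarrow> bool" and a :: "'a idx"
  assume step: "\<And>x. (\<And>y. y < x \<Longrightarrow> P y) \<Longrightarrow> P x"
  show "P a"
  proof (induction "idx_nat a" arbitrary: a rule: less_induct)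
    case less
    show ?case
      by (rule step, rule less) (simp add: less_idx_def)
  qed
qed (auto simp: less_eq_idx_def less_idx_def idx_nat_inject)

end

instance idx :: (finite) finite
proof
  have "(UNIV :: 'a idx set) = nat_idx ` {..<CARD('a)}"
    using type_definition.Abs_image[OF type_definition_idx] by metis
  then show "finite (UNIV :: 'a idx set)"
    by (metis finite_imageI finite_lessThan)
qed

lemma ex_bij_idx: "\<exists>e :: 'n::finite idx \<Rightarrow> 'n. bij e"
proof -
  have "bij_betw idx_nat (UNIV :: 'n idx set) {..<CARD('n)}"
    using type_definition.Rep_range[OF type_definition_idx]
    by (auto simp: bij_betw_def inj_def idx_nat_inject)
  then have "CARD('n idx) = CARD('n)"
    using bij_betw_same_card by fastforce
  then show ?thesis
    by (intro finite_same_card_bij) auto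
qed

text \<open>Conjugation by \<open>e\<close> turns the transposition of \<open>a\<close> and
  \<open>b\<close> into that of \<open>e a\<close> and \<open>e b\<close>, so a factorisation into
  transpositions keeps its length and the permutation its parity.\<close>

lemma sign_conjugate:
  fixes e :: "'a \<Rightarrow> 'b"
  assumes "bij e" "permutation p"
  shows "sign (e \<circ> p \<circ> inv e) = sign p"
proof -
  have *: "swapidseq n (e \<circ> p \<circ> inv e)" if "swapidseq n p" for n and p :: "'a \<Rightarrow> 'a"
    using that
  proof induction
    case id
    then show ?case
      using assms by (simp add: bij_is_surj surj_f_inv_f fun_eq_iff swapidseq.id)
  next
    case (comp_Suc n p a b)
    have "e \<circ> (Transposition.transpose a b \<circ> p) \<circ> inv e = Transposition.transpose (e a) (e b) \<circ> (e \<circ> p \<circ> inv e)"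
      using bij_is_inj[OF assms(1)] by (auto simp: fun_eq_iff Transposition.transpose_def inj_def)
    moreover have "e a \<noteq> e b"
      using comp_Suc bij_is_inj[OF assms(1)] by (auto simp: inj_def)
    ultimately show ?case
      using swapidseq.comp_Suc[OF comp_Suc.IH] by metis
  qed
  obtain n where n: "swapidseq n p"
    using assms(2) by (auto simp: permutation_def)
  have "evenperm p \<longleftrightarrow> even n" "evenperm (e \<circ> p \<circ> inv e) \<longleftrightarrow> even n"
    by (rule evenperm_unique[OF n refl], rule evenperm_unique[OF *[OF n] refl])
  then show ?thesis
    by (simp add: sign_def)
qed

text \<open>Conjugation by \<open>e\<close> is a sign-preserving bijection between the two symmetric
  groups, so the Leibniz sums agree term by term.\<close>

lemma det_reindex:
  fixes A :: "real^'n^'n" and e :: "'m::finite \<Rightarrow> 'n"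
  assumes e: "bij e"
  shows "det (\<chi> i j. A $ e i $ e j) = det A"
proof -
  have ie: "inv e (e i) = i" "e (inv e k) = k" for i k
    using e by (auto simp: bij_is_inj bij_is_surj surj_f_inv_f)
  have perm: "p permutes UNIV \<longleftrightarrow> bij p" for p :: "'c \<Rightarrow> 'c"
    by (auto simp: permutes_bij intro!: bij_imp_permutes)
  have "bij_betw (\<lambda>p. e \<circ> p \<circ> inv e) {p. p permutes (UNIV::'m set)} {p. p permutes (UNIV::'n set)}"
    unfolding perm
    by (rule bij_betwI[where g = "\<lambda>q. inv e \<circ> q \<circ> e"])
       (auto simp: fun_eq_iff ie intro!: bij_comp e bij_imp_bij_inv)
  then have "det A = (\<Sum>p | p permutes (UNIV::'m set). of_int (sign (e \<circ> p \<circ> inv e)) *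
      (\<Prod>i\<in>UNIV. A $ i $ (e \<circ> p \<circ> inv e) i))"
    unfolding det_def by (rule sum.reindex_bij_betw[symmetric])
  also have "\<dots> = (\<Sum>p | p permutes (UNIV::'m set). of_int (sign p) * (\<Prod>i\<in>UNIV. A $ e i $ e (p i)))"
  proof (rule sum.cong[OF refl])
    fix p :: "'m \<Rightarrow> 'm" assume "p \<in> {p. p permutes UNIV}"
    then have "sign (e \<circ> p \<circ> inv e) = sign p"
      using e by (intro sign_conjugate) (auto simp: permutation_permutes)
    moreover have "(\<Prod>i\<in>UNIV. A $ i $ (e \<circ> p \<circ> inv e) i) = (\<Prod>i\<in>UNIV. A $ e i $ e (p i))"
      using prod.reindex_bij_betw[OF e, of "\<lambda>i. A $ i $ (e \<circ> p \<circ> inv e) i"] by (simp add: ie)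
    ultimately show "of_int (sign (e \<circ> p \<circ> inv e)) * (\<Prod>i\<in>UNIV. A $ i $ (e \<circ> p \<circ> inv e) i) =
        of_int (sign p) * (\<Prod>i\<in>UNIV. A $ e i $ e (p i))" by simp
  qed
  finally show ?thesis
    by (simp add: det_def)
qed

lemma emeasure_lborel_box_cart:
  fixes l u :: "real^'n"
  assumes "\<And>i. l $ i \<le> u $ i"
  shows "emeasure lborel (box l u) = (\<Prod>i\<in>UNIV. u $ i - l $ i)"
proof -
  have B: "Basis = (\<lambda>i. axis i (1::real)) ` (UNIV :: 'n set)"
    by (auto simp: Basis_vec_def Basis_real_def)
  have inj: "inj (\<lambda>i::'n. axis i (1::real))"
    by (auto simp: inj_def axis_eq_axis)
  have "emeasure lborel (box l u) = (\<Prod>b\<in>Basis. (u - l) \<bullet> b)"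
    using assms by (intro emeasure_lborel_box) (auto simp: B inner_axis)
  also have "(\<Prod>b\<in>Basis. (u - l) \<bullet> b) = (\<Prod>i\<in>UNIV. u $ i - l $ i)"
    unfolding B by (subst prod.reindex[OF inj]) (simp add: inner_axis)
  finally show ?thesis .
qed

text \<open>Preimages of boxes are boxes with the same side lengths in another order, and Lebesgue
  measure is characterised by its values on boxes.\<close>

lemma distr_lborel_reindex:
  fixes e :: "'m::finite \<Rightarrow> 'n::finite"
  assumes e: "bij e"
  shows "distr lborel borel (\<lambda>x::real^'n. \<chi> i. x $ e i) = (lborel :: (real^'m) measure)"
proof (rule lborel_eqI[symmetric])
  have ie: "inv e (e i) = i" "e (inv e k) = k" for i k
    using e by (auto simp: bij_is_inj bij_is_surj surj_f_inv_f)
  have [measurable]: "(\<lambda>x::real^'n. \<chi> i. x $ e i) \<in> borel_measurable borel"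
    by (intro borel_measurable_continuous_onI continuous_intros)
  fix l u :: "real^'m"
  assume "\<And>b. b \<in> Basis \<Longrightarrow> l \<bullet> b \<le> u \<bullet> b"
  then have le: "l $ i \<le> u $ i" for i
    by (metis axis_in_Basis_iff cart_eq_inner_axis Basis_real_def singletonI)
  have eq: "(\<lambda>x::real^'n. \<chi> i. x $ e i) -` box l u = box (\<chi> k. l $ inv e k) (\<chi> k. u $ inv e k)"
    by (auto simp: mem_box_cart ie) (metis ie)+
  have "emeasure (distr lborel borel (\<lambda>x::real^'n. \<chi> i. x $ e i)) (box l u) =
      emeasure lborel (box (\<chi> k. l $ inv e k) (\<chi> k. u $ inv e k))"
    by (subst emeasure_distr) (auto simp: eq)
  also have "\<dots> = (\<Prod>k\<in>UNIV. u $ inv e k - l $ inv e k)"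
    using le by (subst emeasure_lborel_box_cart) auto
  also have "(\<Prod>k\<in>UNIV. u $ inv e k - l $ inv e k) = (\<Prod>i\<in>UNIV. u $ i - l $ i)"
    using prod.reindex_bij_betw[OF bij_imp_bij_inv[OF e], of "\<lambda>i. u $ i - l $ i"] .
  also have "ennreal \<dots> = emeasure lborel (box l u)"
    using le by (subst emeasure_lborel_box_cart) auto
  also have "\<dots> = (\<Prod>b\<in>Basis. (u - l) \<bullet> b)"
    by (rule emeasure_lborel_box) fact
  finally show "emeasure (distr lborel borel (\<lambda>x::real^'n. \<chi> i. x $ e i)) (box l u) =
      (\<Prod>b\<in>Basis. (u - l) \<bullet> b)" .
qed simp

text \<open>A bridge between two notions: change of variables is phrased with absolute integrability
  in the gauge sense, the volume with an extended nonnegative integral. The branch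
  \<open>\<infinity>\<close> is right because a nonnegative measurable function that is not
  integrable has infinite integral.\<close>

lemma set_nn_integral_eq_Henstock:
  fixes u :: "'a::euclidean_space \<Rightarrow> real"
  assumes [measurable]: "(\<lambda>x. indicator S x * u x) \<in> borel_measurable borel"
    and nonneg: "\<And>x. x \<in> S \<Longrightarrow> 0 \<le> u x"
  shows "(\<integral>\<^sup>+x\<in>S. ennreal (u x) \<partial>lborel) =
    (if u absolutely_integrable_on S then ennreal (integral S u) else \<infinity>)"
proof -
  let ?v = "\<lambda>x. indicator S x * u x"
  have eq: "(\<integral>\<^sup>+x\<in>S. ennreal (u x) \<partial>lborel) = (\<integral>\<^sup>+x. ennreal (?v x) \<partial>lborel)"
    by (intro nn_integral_cong) (auto split: split_indicator)
  have nn: "0 \<le> ?v x" for x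
    using nonneg by (auto split: split_indicator)
  have iff: "u absolutely_integrable_on S \<longleftrightarrow> integrable lborel ?v"
    by (simp add: set_integrable_def integrable_completion)
  show ?thesis
  proof (cases "integrable lborel ?v")
    case True
    then have "integral S u = integral\<^sup>L lborel ?v"
      using iff set_lebesgue_integral_eq_integral(2)[of S u]
      by (simp add: set_lebesgue_integral_def integral_completion)
    then show ?thesis
      using True iff nn eq by (simp add: nn_integral_eq_integral)
  next
    case False
    then have "(\<integral>\<^sup>+x. ennreal (?v x) \<partial>lborel) = \<infinity>"
      using nn integrableI_nonneg[of ?v lborel] assms(1) top.not_eq_extremum
      by (metis (no_types, lifting) AE_I2 infinity_ennreal_def measurable_lborel2)
    then show ?thesis
      using False iff eq by simp
  qed
qed

text \<open>Integrability is transferred in both directions, so for a nonnegative integrand the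
  infinite case is covered too: both sides are then \<open>\<infinity>\<close>.\<close>

lemma nn_integral_change_of_variables_wellorder:
  fixes g :: "real^'n::{finite,wellorder} \<Rightarrow> real^'n::_" and f :: "real^'n::_ \<Rightarrow> real"
  assumes S: "S \<in> sets borel"
    and der: "\<And>x. x \<in> S \<Longrightarrow> (g has_derivative g' x) (at x within S)"
    and inj: "inj_on g S"
    and nonneg: "\<And>x. x \<in> g ` S \<Longrightarrow> 0 \<le> f x"
    and m1: "(\<lambda>x. indicator (g ` S) x * f x) \<in> borel_measurable borel"
    and m2: "(\<lambda>x. indicator S x * (\<bar>det (matrix (g' x))\<bar> * f (g x))) \<in> borel_measurable borel"
  shows "(\<integral>\<^sup>+x\<in>g ` S. ennreal (f x) \<partial>lborel) =
    (\<integral>\<^sup>+x\<in>S. ennreal (\<bar>det (matrix (g' x))\<bar> * f (g x)) \<partial>lborel)"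
proof -
  have S': "S \<in> sets lebesgue"
    using S by (simp add: sets_completionI_sets)
  \<comment> \<open>The theorem concerns vector-valued integrands; the scalar \<open>f\<close> is
    wrapped into \<open>real^1\<close> and unwrapped by the two conversion rules.\<close>
  note cov = has_absolute_integral_change_of_variables[OF S' der inj,
      of "\<lambda>x. vec (f x) :: real^1", unfolded absolutely_integrable_on_1_iff integral_on_1_eq]
  have "(\<lambda>x. \<bar>det (matrix (g' x))\<bar> * f (g x)) absolutely_integrable_on S \<and>
      integral S (\<lambda>x. \<bar>det (matrix (g' x))\<bar> * f (g x)) = b \<longleftrightarrow>
      f absolutely_integrable_on (g ` S) \<and> integral (g ` S) f = b" for b
    using cov[of "vec b"] by (simp add: vec_eq_iff)
  \<comment> \<open>Since \<open>b\<close> is arbitrary, taking it to be the integral on one side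
    yields both the transfer of integrability and the equality of the values.\<close>
  then have "((\<lambda>x. \<bar>det (matrix (g' x))\<bar> * f (g x)) absolutely_integrable_on S \<longleftrightarrow>
      f absolutely_integrable_on (g ` S)) \<and> (f absolutely_integrable_on (g ` S) \<longrightarrow>
      integral (g ` S) f = integral S (\<lambda>x. \<bar>det (matrix (g' x))\<bar> * f (g x)))"
    by blast
  moreover have "0 \<le> \<bar>det (matrix (g' x))\<bar> * f (g x)" if "x \<in> S" for x
    using nonneg that by simp
  then have "(\<integral>\<^sup>+x\<in>S. ennreal (\<bar>det (matrix (g' x))\<bar> * f (g x)) \<partial>lborel) =
      (if (\<lambda>x. \<bar>det (matrix (g' x))\<bar> * f (g x)) absolutely_integrable_on S
       then ennreal (integral S (\<lambda>x. \<bar>det (matrix (g' x))\<bar> * f (g x))) else \<infinity>)"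
    by (rule set_nn_integral_eq_Henstock[OF m2])
  moreover have "(\<integral>\<^sup>+x\<in>g ` S. ennreal (f x) \<partial>lborel) =
      (if f absolutely_integrable_on (g ` S) then ennreal (integral (g ` S) f) else \<infinity>)"
    by (rule set_nn_integral_eq_Henstock[OF m1 nonneg])
  ultimately show ?thesis
    by presburger
qed

text \<open>Everything is relabelled by \<open>P\<close> and its inverse \<open>R\<close>, which
  preserve Lebesgue measure. The Jacobian matrix of the conjugate
  \<open>G = P \<circ> g \<circ> R\<close> is that of \<open>g\<close> with rows and columns
  relabelled alike, hence has the same determinant.\<close>

lemma nn_integral_change_of_variables:
  fixes g :: "real^'n::finite \<Rightarrow> real^'n" and f :: "real^'n \<Rightarrow> real"
  assumes S: "S \<in> sets borel"
    and der: "\<And>x. x \<in> S \<Longrightarrow> (g has_derivative g' x) (at x within S)"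
    and inj: "inj_on g S"
    and nonneg: "\<And>x. x \<in> g ` S \<Longrightarrow> 0 \<le> f x"
    and m1: "(\<lambda>x. indicator (g ` S) x * f x) \<in> borel_measurable borel"
    and m2: "(\<lambda>x. indicator S x * (\<bar>det (matrix (g' x))\<bar> * f (g x))) \<in> borel_measurable borel"
  shows "(\<integral>\<^sup>+x\<in>g ` S. ennreal (f x) \<partial>lborel) =
    (\<integral>\<^sup>+x\<in>S. ennreal (\<bar>det (matrix (g' x))\<bar> * f (g x)) \<partial>lborel)"
proof -
  obtain e :: "'n idx \<Rightarrow> 'n" where e: "bij e"
    using ex_bij_idx by blast
  have ie: "inv e (e i) = i" "e (inv e k) = k" for i k
    using e by (auto simp: bij_is_inj bij_is_surj surj_f_inv_f)
  define P where "P x = (\<chi> i. x $ e i)" for x :: "real^'n"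
  define R where "R y = (\<chi> k. y $ inv e k)" for y :: "real^'n idx"
  have PR [simp]: "P (R y) = y" "R (P x) = x" for x y
    by (auto simp: P_def R_def ie vec_eq_iff)
  have linP: "bounded_linear P" and linR: "bounded_linear R"
    by (auto simp: P_def R_def vec_eq_iff linear_iff linear_conv_bounded_linear[symmetric])
  have [measurable]: "P \<in> borel_measurable borel" "R \<in> borel_measurable borel"
    by (auto intro!: borel_measurable_continuous_onI linear_continuous_on linP linR)
  have distrR: "distr lborel borel R = lborel"
    using distr_lborel_reindex[OF bij_imp_bij_inv[OF e]] by (simp add: R_def[abs_def])
  have transfer: "(\<integral>\<^sup>+x. ennreal (v x) \<partial>lborel) = (\<integral>\<^sup>+y. ennreal (v (R y)) \<partial>lborel)"
    if [measurable]: "v \<in> borel_measurable borel" for v :: "real^'n \<Rightarrow> real"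
    by (subst distrR[symmetric], subst nn_integral_distr) auto
  define G where "G = P \<circ> g \<circ> R"
  define G' where "G' y = P \<circ> g' (R y) \<circ> R" for y
  have PS: "P ` S = R -` S"
    by (auto simp: image_iff) (metis PR)
  have GS: "G ` P ` S = R -` g ` S"
    by (auto simp: image_iff G_def) (metis PR)
  have det: "det (matrix (G' y)) = det (matrix (g' (R y)))" for y
  proof -
    have RA: "R (axis i 1) = axis (e i) 1" for i
      by (auto simp: R_def vec_eq_iff axis_def ie)
    have "matrix (G' y) = (\<chi> i j. matrix (g' (R y)) $ e i $ e j)"
      by (simp add: matrix_def G'_def RA) (simp add: P_def)
    then show ?thesis
      using det_reindex[OF e] by simp
  qed
  have "(\<integral>\<^sup>+x\<in>g ` S. ennreal (f x) \<partial>lborel) = (\<integral>\<^sup>+x. ennreal (indicator (g ` S) x * f x) \<partial>lborel)"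
    by (intro nn_integral_cong) (auto split: split_indicator)
  also have "\<dots> = (\<integral>\<^sup>+y. ennreal (indicator (g ` S) (R y) * f (R y)) \<partial>lborel)"
    by (rule transfer) fact
  also have "\<dots> = (\<integral>\<^sup>+y\<in>G ` P ` S. ennreal (f (R y)) \<partial>lborel)"
    unfolding GS by (intro nn_integral_cong) (auto split: split_indicator)
  also have "\<dots> = (\<integral>\<^sup>+y\<in>P ` S. ennreal (\<bar>det (matrix (G' y))\<bar> * f (R (G y))) \<partial>lborel)"
  proof (rule nn_integral_change_of_variables_wellorder)
    show "P ` S \<in> sets borel"
      unfolding PS using S by (intro measurable_sets_borel[of R borel]) auto
    show "(G has_derivative G' y) (at y within P ` S)" if y: "y \<in> P ` S" for y
    proof -
      have RS: "R ` P ` S = S" by (auto simp: image_iff)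
      have "R y \<in> S" using y by auto
      have "(g \<circ> R has_derivative g' (R y) \<circ> R) (at y within P ` S)"
        using der[OF \<open>R y \<in> S\<close>]
        by (intro diff_chain_within) (auto simp: RS bounded_linear_imp_has_derivative linR)
      then show ?thesis
        unfolding G_def G'_def comp_assoc
        by (rule diff_chain_within[OF _ bounded_linear_imp_has_derivative[OF linP]])
    qed
    show "inj_on G (P ` S)"
      using inj by (auto simp: inj_on_def G_def) (metis PR(2))
    show "0 \<le> f (R y)" if "y \<in> G ` P ` S" for y
      using that nonneg by (auto simp: GS)
    have "(\<lambda>y. indicator (g ` S) (R y) * f (R y)) \<in> borel_measurable borel"
      by (intro measurable_compose[OF _ m1]) measurable
    then show "(\<lambda>y. indicator (G ` P ` S) y * f (R y)) \<in> borel_measurable borel"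
      unfolding GS by (simp add: indicator_def)
    have "(\<lambda>y. indicator S (R y) * (\<bar>det (matrix (g' (R y)))\<bar> * f (g (R y)))) \<in> borel_measurable borel"
      by (intro measurable_compose[OF _ m2]) measurable
    then show "(\<lambda>y. indicator (P ` S) y * (\<bar>det (matrix (G' y))\<bar> * f (R (G y)))) \<in> borel_measurable borel"
      unfolding PS det by (simp add: indicator_def G_def)
  qed
  also have "\<dots> = (\<integral>\<^sup>+y. ennreal (indicator S (R y) * (\<bar>det (matrix (g' (R y)))\<bar> * f (g (R y)))) \<partial>lborel)"
    unfolding PS det by (intro nn_integral_cong) (auto simp: G_def split: split_indicator)
  also have "\<dots> = (\<integral>\<^sup>+x. ennreal (indicator S x * (\<bar>det (matrix (g' x))\<bar> * f (g x))) \<partial>lborel)"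
    by (rule transfer[symmetric]) fact
  also have "\<dots> = (\<integral>\<^sup>+x\<in>S. ennreal (\<bar>det (matrix (g' x))\<bar> * f (g x)) \<partial>lborel)"
    by (intro nn_integral_cong) (auto split: split_indicator)
  finally show ?thesis .
qed

subsection \<open>Integration by parts\<close>

text \<open>Translation invariance makes the integrals of all difference quotients of \<open>w\<close> vanish.\<close>

lemma integral_directional_derivative_eq_0:
  fixes w :: "'a::euclidean_space \<Rightarrow> real"
  assumes der: "\<And>x. (w has_derivative w' x) (at x)"
    and cont: "continuous_on UNIV (\<lambda>x. w' x b)"
    and K: "compact K" "\<And>x. x \<notin> K \<Longrightarrow> w x = 0"
  shows "integral\<^sup>L lborel (\<lambda>x. w' x b) = 0"
proof -
  \<comment> \<open>Step sizes stay in \<open>(0, 1]\<close>, so all difference quotients in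
    direction \<open>b\<close> are supported in the ball of radius \<open>r + norm b\<close>, which
    carries the dominating function.\<close>
  define h :: "nat \<Rightarrow> real" where "h n = inverse (real (Suc n))" for n
  have h0: "h \<longlonglongrightarrow> 0"
    unfolding h_def by (rule LIMSEQ_inverse_real_of_nat)
  have hpos: "0 < h n" "h n \<le> 1" for n
    by (auto simp: h_def field_simps)
  obtain r where r: "\<And>x. x \<in> K \<Longrightarrow> norm x \<le> r"
    using K(1) compact_imp_bounded bounded_iff by metis
  have contw: "continuous_on UNIV w"
    using der has_derivative_continuous_on[of UNIV w w'] by auto
  have w'0: "w' x b = 0" if "x \<notin> K" for x
  proof -
    have "((\<lambda>x. 0) has_derivative w' x) (at x)"
      using that K compact_imp_closed
      by (intro has_derivative_transform_within_open[OF der, of "- K"]) auto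
    then have "w' x = (\<lambda>x. 0)"
      by (intro has_derivative_unique[of "\<lambda>x. 0"]) auto
    then show ?thesis by simp
  qed
  obtain B where B: "\<And>x. x \<in> K \<Longrightarrow> \<bar>w' x b\<bar> \<le> B"
  proof -
    have "compact ((\<lambda>x. w' x b) ` K)"
      using cont K by (intro compact_continuous_image) (auto intro: continuous_on_subset)
    then have "bounded ((\<lambda>x. w' x b) ` K)"
      by (rule compact_imp_bounded)
    then show ?thesis
      using that by (auto simp: bounded_iff)
  qed
  have B': "\<bar>w' x b\<bar> \<le> \<bar>B\<bar>" for x
    using B[of x] w'0[of x] by (cases "x \<in> K") auto
  have int0: "integral\<^sup>L lborel (\<lambda>x. (w (x + h n *\<^sub>R b) - w x) / h n) = 0" for n
  proof -
    have iw: "integrable lborel w"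
    proof -
      have "integrable lborel (\<lambda>x. indicator K x *\<^sub>R w x)"
        using borel_integrable_compact[OF K(1) continuous_on_subset[OF contw]] by simp
      also have "(\<lambda>x. indicator K x *\<^sub>R w x) = w"
        using K(2) by (auto split: split_indicator simp: fun_eq_iff)
      finally show ?thesis .
    qed
    have wm [measurable]: "w \<in> borel_measurable borel"
      using contw by (rule borel_measurable_continuous_onI)
    have d: "distr lborel borel ((+) (h n *\<^sub>R b)) = lborel"
      by (rule lborel_distr_plus)
    have "integrable (distr lborel borel ((+) (h n *\<^sub>R b))) w"
      using iw d by metis
    then have i2: "integrable lborel (\<lambda>x. w (x + h n *\<^sub>R b))"
      by (subst (asm) integrable_distr_eq) (auto simp: add.commute)
    have "integral\<^sup>L lborel w = integral\<^sup>L (distr lborel borel ((+) (h n *\<^sub>R b))) w"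
      using d by metis
    also have "\<dots> = integral\<^sup>L lborel (\<lambda>x. w (x + h n *\<^sub>R b))"
      by (subst integral_distr) (auto simp: add.commute)
    finally show ?thesis
      using iw i2 by simp
  qed
  have "(\<lambda>n. integral\<^sup>L lborel (\<lambda>x. (w (x + h n *\<^sub>R b) - w x) / h n))
      \<longlonglongrightarrow> integral\<^sup>L lborel (\<lambda>x. w' x b)"
  proof (rule integral_dominated_convergence[where w = "\<lambda>x. \<bar>B\<bar> * indicator (cball 0 (r + norm b)) x"])
    show "(\<lambda>x. w' x b) \<in> borel_measurable lborel"
      using cont by (simp add: borel_measurable_continuous_onI)
    show "(\<lambda>x. (w (x + h n *\<^sub>R b) - w x) / h n) \<in> borel_measurable lborel" for n
      using borel_measurable_continuous_onI[OF contw] by simp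
    show "integrable lborel (\<lambda>x. \<bar>B\<bar> * indicator (cball 0 (r + norm b)) x)"
      by (intro integrable_mult_right integrable_real_indicator)
         (use emeasure_bounded_finite[OF bounded_cball] in auto)
    show "AE x in lborel. (\<lambda>n. (w (x + h n *\<^sub>R b) - w x) / h n) \<longlonglongrightarrow> w' x b"
    proof (rule AE_I2)
      fix x
      have "((\<lambda>t. w (x + t *\<^sub>R b)) has_derivative (\<lambda>t. w' x (t *\<^sub>R b))) (at 0)"
        by (rule has_derivative_compose[where g = w]) (auto intro!: derivative_eq_intros der)
      then have "((\<lambda>t. w (x + t *\<^sub>R b)) has_real_derivative w' x b) (at 0)"
        using linear_scale[OF has_derivative_linear[OF der]]
        by (simp add: has_field_derivative_def mult.commute[of _ "w' x b"])
      then have "((\<lambda>t. (w (x + t *\<^sub>R b) - w x) / t) \<longlongrightarrow> w' x b) (at 0)"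
        by (simp add: has_field_derivative_iff)
      moreover have "filterlim h (at 0) sequentially"
        using h0 hpos by (auto simp: filterlim_at intro!: always_eventually) (metis less_irrefl)
      ultimately show "(\<lambda>n. (w (x + h n *\<^sub>R b) - w x) / h n) \<longlonglongrightarrow> w' x b"
        by (rule filterlim_compose)
    qed
    show "AE x in lborel. norm ((w (x + h n *\<^sub>R b) - w x) / h n) \<le> \<bar>B\<bar> * indicator (cball 0 (r + norm b)) x" for n
    proof (rule AE_I2)
      fix x
      show "norm ((w (x + h n *\<^sub>R b) - w x) / h n) \<le> \<bar>B\<bar> * indicator (cball 0 (r + norm b)) x"
      proof (cases "x \<in> cball 0 (r + norm b)")
        case True
        \<comment> \<open>The mean value inequality along the line through \<open>x\<close> in
          direction \<open>b\<close>, between the parameters \<open>0\<close> and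
          \<open>h n\<close>.\<close>
        have "\<bar>w (x + h n *\<^sub>R b) - w (x + 0 *\<^sub>R b)\<bar> \<le> \<bar>B\<bar> * \<bar>h n - 0\<bar>"
        proof (rule field_differentiable_bound[where S = UNIV and f' = "\<lambda>t. w' (x + t *\<^sub>R b) b", simplified])
          fix t
          have "((\<lambda>t. w (x + t *\<^sub>R b)) has_derivative (\<lambda>s. w' (x + t *\<^sub>R b) (s *\<^sub>R b))) (at t)"
            by (rule has_derivative_compose[where g = w]) (auto intro!: derivative_eq_intros der)
          then show "((\<lambda>t. w (x + t *\<^sub>R b)) has_real_derivative w' (x + t *\<^sub>R b) b) (at t)"
            using linear_scale[OF has_derivative_linear[OF der]]
            by (simp add: has_field_derivative_def mult.commute[of _ "w' _ b"])
        qed (rule B')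
        then show ?thesis
          using True hpos[of n] by (simp add: abs_mult field_simps)
      next
        case False
        have "x \<notin> K"
          using False r[of x] norm_ge_zero[of b] by auto
        moreover have "x + h n *\<^sub>R b \<notin> K"
        proof
          assume "x + h n *\<^sub>R b \<in> K"
          then have "norm (x + h n *\<^sub>R b) \<le> r" by (rule r)
          moreover have "norm x \<le> norm (x + h n *\<^sub>R b) + norm (h n *\<^sub>R b)"
            by (metis add_diff_cancel_right' norm_triangle_ineq4)
          moreover have "norm (h n *\<^sub>R b) \<le> norm b"
            using hpos[of n] by (simp add: mult_left_le_one_le)
          ultimately show False using False by auto
        qed
        ultimately show ?thesis
          using K(2) by simp
      qed
    qed
  qed
  then show ?thesis
    unfolding int0 LIMSEQ_const_iff by simp
qed

subsection \<open>Continuously differentiable functions\<close>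

lemma frechet_derivative_cong_open:
  assumes "open U" "x \<in> U" "\<And>y. y \<in> U \<Longrightarrow> F y = f y" "F differentiable (at x)"
  shows "f differentiable (at x)" "frechet_derivative f (at x) = frechet_derivative F (at x)"
proof -
  have "(F has_derivative frechet_derivative F (at x)) (at x)"
    using assms(4) frechet_derivative_works by blast
  then have d: "(f has_derivative frechet_derivative F (at x)) (at x)"
    by (rule has_derivative_transform_within_open[OF _ assms(1-3)])
  then show "f differentiable (at x)"
    by (rule differentiableI)
  show "frechet_derivative f (at x) = frechet_derivative F (at x)"
    using frechet_derivative_at[OF d] by simp
qed

lemma Ck_on_cong_open:
  assumes "open U" "\<And>y. y \<in> U \<Longrightarrow> F y = f y" "Ck_on k U F"
  shows "Ck_on k U f"
  using assms(2,3)
proof (induction k arbitrary: F f)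
  case 0
  then show ?case by (simp cong: continuous_on_cong)
next
  case (Suc k)
  have "frechet_derivative F (at x) b = frechet_derivative f (at x) b" if "x \<in> U" for x b
    using Suc.prems that frechet_derivative_cong_open(2)[OF assms(1) that, of F f] by simp
  then have "Ck_on k U (\<lambda>x. frechet_derivative f (at x) b)" if "b \<in> Basis" for b
    using Suc.IH[of "\<lambda>x. frechet_derivative F (at x) b"] Suc.prems that by simp
  then show ?case
    using Suc.prems frechet_derivative_cong_open(1)[OF assms(1), of _ F f] by simp
qed

lemma Ck_on_locally:
  assumes "\<And>x. x \<in> S \<Longrightarrow> \<exists>U. open U \<and> x \<in> U \<and> Ck_on k U f"
  shows "Ck_on k S f"
  using assms
proof (induction k arbitrary: f)
  case 0
  show ?case
    unfolding Ck_on.simps continuous_on_eq_continuous_within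
  proof
    fix x assume "x \<in> S"
    then obtain U where "open U" "x \<in> U" "continuous_on U f"
      using 0 by auto
    then show "continuous (at x within S) f"
      by (metis continuous_at_imp_continuous_within continuous_on_eq_continuous_at)
  qed
next
  case (Suc k)
  then have "Ck_on k S (\<lambda>x. frechet_derivative f (at x) b)" if "b \<in> Basis" for b
    using that by (intro Suc.IH) fastforce
  then show ?case
    using Suc.prems by fastforce
qed

lemma smooth_on_open_Ck:
  assumes "open S" "smooth_on S f"
  shows "Ck_on k S f"
proof (rule Ck_on_locally)
  fix x assume "x \<in> S"
  then obtain U F where U: "open U" "x \<in> U" "\<And>k. Ck_on k U F" "\<And>y. y \<in> U \<inter> S \<Longrightarrow> F y = f y"
    using assms(2) unfolding smooth_on_def by metis
  have sub: "Ck_on k (U \<inter> S) F" if "Ck_on k U F" for k and F :: "'a \<Rightarrow> 'b"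
    using that by (induction k arbitrary: F) (auto intro: continuous_on_subset)
  have "Ck_on k (U \<inter> S) f"
    by (rule Ck_on_cong_open[OF open_Int[OF U(1) assms(1)] U(4) sub[OF U(3)]])
  then show "\<exists>U. open U \<and> x \<in> U \<and> Ck_on k U f"
    using U assms(1) \<open>x \<in> S\<close> by (intro exI[of _ "U \<inter> S"]) auto
qed

lemma smooth_on_imp_continuous_on:
  assumes "smooth_on S f"
  shows "continuous_on S f"
  unfolding continuous_on_eq_continuous_within
proof
  fix x assume x: "x \<in> S"
  then obtain U F where U: "open U" "x \<in> U" "\<And>k. Ck_on k U F" "\<And>y. y \<in> U \<inter> S \<Longrightarrow> F y = f y"
    using assms unfolding smooth_on_def by metis
  have "isCont F x"
    using U(1,2) U(3)[of 0] by (simp add: continuous_on_eq_continuous_at)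
  then have "(F \<longlongrightarrow> F x) (at x within S)"
    using continuous_at_imp_continuous_within continuous_within by blast
  moreover have "\<forall>\<^sub>F y in at x within S. F y = f y"
    using U eventually_at_topological by blast
  ultimately show "continuous (at x within S) f"
    using U(4)[of x] x U(2) by (auto simp: continuous_within intro: Lim_transform_eventually)
qed

section \<open>C1 functions in coordinates\<close>

definition pd :: "'n \<Rightarrow> (real^'n \<Rightarrow> real) \<Rightarrow> real^'n \<Rightarrow> real" where
  "pd i f x = frechet_derivative f (at x) (axis i 1)"

text \<open>One continuous derivative is all that integration by parts asks of a test function. The
  explicit bumps used below lie in this class, whereas their second derivatives jump at the edge of
  the support.\<close>

definition C1_on :: "(real^'n) set \<Rightarrow> (real^'n \<Rightarrow> real) \<Rightarrow> bool" where
  "C1_on S f \<longleftrightarrow> (\<forall>x\<in>S. f differentiable (at x)) \<and> (\<forall>i. continuous_on S (pd i f))"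

lemma C1_onI:
  assumes "\<And>x. x \<in> S \<Longrightarrow> (f has_derivative f' x) (at x)"
    and "\<And>i. continuous_on S (\<lambda>x. f' x (axis i 1))"
  shows "C1_on S f"
proof -
  have "frechet_derivative f (at x) = f' x" if "x \<in> S" for x
    using frechet_derivative_at[OF assms(1)[OF that]] by simp
  then have "continuous_on S (pd i f)" for i
    using assms(2)[of i] by (simp add: pd_def cong: continuous_on_cong)
  then show ?thesis
    using assms(1) by (auto simp: C1_on_def differentiable_def)
qed

lemma pd_eqI: "(f has_derivative f') (at x) \<Longrightarrow> pd i f x = f' (axis i 1)"
  using frechet_derivative_at[of f f' x] by (simp add: pd_def)

lemma C1_on_has_derivative:
  "C1_on S f \<Longrightarrow> x \<in> S \<Longrightarrow> (f has_derivative frechet_derivative f (at x)) (at x)"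
  by (simp add: C1_on_def frechet_derivative_works[symmetric])

lemma C1_on_continuous_pd: "C1_on S f \<Longrightarrow> continuous_on S (pd i f)"
  by (simp add: C1_on_def)

lemma C1_on_imp_continuous_on: "C1_on S f \<Longrightarrow> continuous_on S f"
  by (meson C1_on_def continuous_at_imp_continuous_on differentiable_imp_continuous_within)

lemma pd_cong_open:
  assumes "open U" "x \<in> U" "\<And>y. y \<in> U \<Longrightarrow> F y = f y"
  shows "pd i F x = pd i f x"
proof -
  have "frechet_derivative F (at x) = frechet_derivative f (at x)"
    unfolding frechet_derivative_def
    using has_derivative_transform_within_open[OF _ assms(1,2)] assms(3) by metis
  then show ?thesis by (simp add: pd_def)
qed

lemma C1_on_cong:
  assumes "open U" "\<And>y. y \<in> U \<Longrightarrow> F y = f y" "C1_on U F"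
  shows "C1_on U f"
proof -
  have "continuous_on U (pd i f)" for i
    using C1_on_continuous_pd[OF assms(3), of i] pd_cong_open[OF assms(1) _ assms(2), where i = i]
    by (simp cong: continuous_on_cong)
  then show ?thesis
    using assms frechet_derivative_cong_open(1)[OF assms(1), of _ F f] by (auto simp: C1_on_def)
qed

lemma C1_on_Union:
  assumes "\<And>U. U \<in> \<U> \<Longrightarrow> open U" "\<And>U. U \<in> \<U> \<Longrightarrow> C1_on U f"
  shows "C1_on (\<Union>\<U>) f"
  using assms by (auto simp: C1_on_def intro!: continuous_on_open_Union)

lemma C1_on_const [intro]: "C1_on S (\<lambda>x. c)"
  by (rule C1_onI[where f' = "\<lambda>_ _. 0"]) auto

lemma
  assumes "C1_on S f" "C1_on S g"
  shows C1_on_add: "C1_on S (\<lambda>x. f x + g x)"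
    and C1_on_mult: "C1_on S (\<lambda>x. f x * g x)"
    and C1_on_divide: "(\<And>x. x \<in> S \<Longrightarrow> g x \<noteq> 0) \<Longrightarrow> C1_on S (\<lambda>x. f x / g x)"
    and pd_mult: "x \<in> S \<Longrightarrow> pd i (\<lambda>x. f x * g x) x = pd i f x * g x + f x * pd i g x"
proof -
  note d = assms[THEN C1_on_has_derivative]
  note c = assms[THEN C1_on_imp_continuous_on] assms[THEN C1_on_continuous_pd, unfolded pd_def[abs_def]]
  show "C1_on S (\<lambda>x. f x + g x)"
    by (rule C1_onI, rule has_derivative_add[OF d]) (auto intro!: continuous_intros c)
  show "C1_on S (\<lambda>x. f x * g x)"
    by (rule C1_onI, rule has_derivative_mult[OF d]) (auto intro!: continuous_intros c)
  show "C1_on S (\<lambda>x. f x / g x)" if "\<And>x. x \<in> S \<Longrightarrow> g x \<noteq> 0"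
    by (rule C1_onI, rule has_derivative_divide[OF d]) (auto intro!: continuous_intros c that)
  show "pd i (\<lambda>x. f x * g x) x = pd i f x * g x + f x * pd i g x" if "x \<in> S"
    by (subst pd_eqI[OF has_derivative_mult[OF d(1)[OF that] d(2)[OF that]]]) (simp add: pd_def)
qed

lemma C1_on_sqrt:
  assumes "C1_on S f" "\<And>x. x \<in> S \<Longrightarrow> 0 < f x"
  shows "C1_on S (\<lambda>x. sqrt (f x))"
proof (rule C1_onI)
  fix x assume "x \<in> S"
  show "((\<lambda>x. sqrt (f x)) has_derivative
      (\<lambda>y. frechet_derivative f (at x) y / (2 * sqrt (f x)))) (at x)"
    using assms(2)[OF \<open>x \<in> S\<close>] C1_on_has_derivative[OF assms(1) \<open>x \<in> S\<close>]
    by (auto intro!: derivative_eq_intros simp: field_simps)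
next
  show "continuous_on S (\<lambda>x. frechet_derivative f (at x) (axis i 1) / (2 * sqrt (f x)))" for i
    using C1_on_continuous_pd[OF assms(1), of i] C1_on_imp_continuous_on[OF assms(1)] assms(2)
    by (auto simp: pd_def[abs_def] intro!: continuous_intros)
      (metis less_irrefl)
qed

lemma C1_on_sum:
  assumes "\<And>k. k \<in> I \<Longrightarrow> C1_on S (f k)"
  shows "C1_on S (\<lambda>x. \<Sum>k\<in>I. f k x)"
  using assms by (induction I rule: infinite_finite_induct) (auto intro: C1_on_add)

lemma pd_sum:
  assumes "\<And>k. k \<in> I \<Longrightarrow> C1_on S (f k)" "x \<in> S"
  shows "pd i (\<lambda>x. \<Sum>k\<in>I. f k x) x = (\<Sum>k\<in>I. pd i (f k) x)"
proof -
  have "((\<lambda>x. \<Sum>k\<in>I. f k x) has_derivative (\<lambda>y. \<Sum>k\<in>I. frechet_derivative (f k) (at x) y)) (at x)"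
    using assms by (intro has_derivative_sum C1_on_has_derivative) auto
  from pd_eqI[OF this] show ?thesis
    by (simp add: pd_def)
qed

lemma C1_on_prod:
  assumes "\<And>k. k \<in> I \<Longrightarrow> C1_on S (f k)"
  shows "C1_on S (\<lambda>x. \<Prod>k\<in>I. f k x)"
  using assms by (induction I rule: infinite_finite_induct) (auto intro: C1_on_mult)

lemma C1_on_det:
  fixes f :: "real^'m \<Rightarrow> real^'n^'n"
  assumes "\<And>i j. C1_on S (\<lambda>x. f x $ i $ j)"
  shows "C1_on S (\<lambda>x. det (f x))"
  unfolding det_def by (intro C1_on_sum C1_on_mult C1_on_const C1_on_prod assms)

lemma C1_on_matrix_inv:
  fixes f :: "real^'m \<Rightarrow> real^'n^'n"
  assumes "open S" "\<And>i j. C1_on S (\<lambda>x. f x $ i $ j)" "\<And>x. x \<in> S \<Longrightarrow> det (f x) \<noteq> 0"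
  shows "C1_on S (\<lambda>x. matrix_inv (f x) $ i $ j)"
proof (rule C1_on_cong[OF assms(1)])
  fix x assume "x \<in> S"
  then show "det (\<chi> k l. if l = i then mat 1 $ k $ j else f x $ k $ l) / det (f x) =
      matrix_inv (f x) $ i $ j"
    using assms(3) by (simp add: matrix_inv_component)
next
  have "C1_on S (\<lambda>x. (\<chi> k l. if l = i then mat 1 $ k $ j else f x $ k $ l) $ a $ b)" for a b
    by (cases "b = i") (auto intro: assms)
  then show "C1_on S (\<lambda>x. det (\<chi> k l. if l = i then mat 1 $ k $ j else f x $ k $ l) / det (f x))"
    by (intro C1_on_divide C1_on_det assms)
qed

lemma linear_eq_sum_axis:
  assumes "linear (L :: real^'n \<Rightarrow> 'b::real_vector)"
  shows "L v = (\<Sum>i\<in>UNIV. v $ i *\<^sub>R L (axis i 1))"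
proof -
  have "v = (\<Sum>i\<in>UNIV. v $ i *\<^sub>R axis i 1)"
    by (simp add: vec_eq_iff axis_def if_distrib sum.delta cong: if_cong)
  then have "L v = L (\<Sum>i\<in>UNIV. v $ i *\<^sub>R axis i 1)" by simp
  also have "\<dots> = (\<Sum>i\<in>UNIV. v $ i *\<^sub>R L (axis i 1))"
    by (simp add: linear_sum[OF assms] linear_scale[OF assms])
  finally show ?thesis .
qed

lemma
  fixes \<tau> :: "real^'m \<Rightarrow> real^'n"
  assumes f: "f differentiable (at (\<tau> x))" and t: "\<tau> differentiable (at x)"
  shows pd_chain: "pd a (f \<circ> \<tau>) x =
      (\<Sum>i\<in>UNIV. frechet_derivative \<tau> (at x) (axis a 1) $ i * pd i f (\<tau> x))"
    and differentiable_chain: "(f \<circ> \<tau>) differentiable (at x)"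
proof -
  have d: "(f \<circ> \<tau> has_derivative frechet_derivative f (at (\<tau> x)) \<circ> frechet_derivative \<tau> (at x)) (at x)"
    by (rule diff_chain_at) (use f t frechet_derivative_works in blast)+
  then show "(f \<circ> \<tau>) differentiable (at x)" by (rule differentiableI)
  have "linear (frechet_derivative f (at (\<tau> x)))"
    using f by (rule linear_frechet_derivative)
  from linear_eq_sum_axis[OF this, of "frechet_derivative \<tau> (at x) (axis a 1)"]
  show "pd a (f \<circ> \<tau>) x = (\<Sum>i\<in>UNIV. frechet_derivative \<tau> (at x) (axis a 1) $ i * pd i f (\<tau> x))"
    unfolding pd_eqI[OF d] by (simp only: pd_def o_apply real_scaleR_def)
qed

lemma C1_on_compose:
  fixes \<tau> :: "real^'m \<Rightarrow> real^'n"
  assumes f: "C1_on V f" and t: "Ck_on 1 U \<tau>" and sub: "\<tau> ` U \<subseteq> V"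
  shows "C1_on U (f \<circ> \<tau>)"
proof -
  have td: "\<tau> differentiable (at x)" if "x \<in> U" for x
    using t that by simp
  have fd: "f differentiable (at (\<tau> x))" if "x \<in> U" for x
    using f that sub by (auto simp: C1_on_def)
  have ct: "continuous_on U \<tau>"
    using td by (meson continuous_at_imp_continuous_on differentiable_imp_continuous_within)
  have "continuous_on U (\<lambda>x. \<Sum>i\<in>UNIV. frechet_derivative \<tau> (at x) (axis a 1) $ i * pd i f (\<tau> x))" for a
    using t sub C1_on_continuous_pd[OF f]
    by (intro continuous_intros continuous_on_compose2[OF _ ct]) (auto simp: axis_in_Basis_iff)
  then have "continuous_on U (pd a (f \<circ> \<tau>))" for a
    using pd_chain[OF fd td] by (simp cong: continuous_on_cong)
  then show ?thesis
    using differentiable_chain[OF fd td] by (simp add: C1_on_def)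
qed

lemma smooth_on_imp_C1_on:
  fixes f :: "real^'n \<Rightarrow> real"
  assumes "open S" "smooth_on S f"
  shows "C1_on S f" "C1_on S (pd i f)"
  using smooth_on_open_Ck[OF assms, of "Suc 0"] smooth_on_open_Ck[OF assms, of "Suc (Suc 0)"]
  by (auto simp: C1_on_def pd_def[abs_def] axis_in_Basis_iff)

lemma smooth_on_matrix_imp_C1_on:
  fixes f :: "real^'n \<Rightarrow> real^'m^'k"
  assumes "open S" "smooth_on S f"
  shows "C1_on S (\<lambda>x. f x $ i $ j)"
proof (rule C1_onI)
  note C1 = smooth_on_open_Ck[OF assms, of "Suc 0"]
  show "((\<lambda>x. f x $ i $ j) has_derivative (\<lambda>y. frechet_derivative f (at x) y $ i $ j)) (at x)"
    if "x \<in> S" for x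
    using C1 that
    by (intro bounded_linear.has_derivative[OF bounded_linear_vec_nth])
       (auto simp: frechet_derivative_works[symmetric])
  show "continuous_on S (\<lambda>x. frechet_derivative f (at x) (axis k 1) $ i $ j)" for k
    using C1 by (intro continuous_intros) (auto simp: axis_in_Basis_iff)
qed

subsection \<open>Charts and tensor transformation\<close>

lemmas LINT_cong = Bochner_Integration.integral_cong

text \<open>The point supplied by \<open>nonempty\<close> serves as a default value when the inverse
  of a chart is extended to all of \<open>real^'n\<close>. An eigenfunction, being nonzero
  somewhere, guarantees it.\<close>

locale closed_mfd =
  fixes M :: "'m::t2_space set" and A :: "('m, 'n::finite) chart set"
  assumes mfd: "closed_manifold M A" and nonempty: "M \<noteq> {}"
begin

lemma compact_M: "compact M"
  using mfd by (simp add: closed_manifold_def)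

lemma atlas: "smooth_atlas M A"
  using mfd by (simp add: closed_manifold_def)

lemma closed_M: "closed M"
  using compact_M by (rule compact_imp_closed)

lemma chart:
  assumes "c \<in> A"
  shows "openin (top_of_set M) (cdom c)" "open (cimg c)"
    "homeomorphism (cdom c) (cimg c) (cmap c) (cinv c)" "cdom c \<subseteq> M"
proof -
  have "chart_on M c"
    using atlas assms by (auto simp: smooth_atlas_def)
  then show "openin (top_of_set M) (cdom c)" "open (cimg c)"
    "homeomorphism (cdom c) (cimg c) (cmap c) (cinv c)"
    by (auto simp: chart_on_def)
  then show "cdom c \<subseteq> M"
    using openin_imp_subset by blast
qed

lemma chart_cover: "p \<in> M \<Longrightarrow> \<exists>c\<in>A. p \<in> cdom c"
  using atlas by (auto simp: smooth_atlas_def)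

lemma chart_at: "p \<in> M \<Longrightarrow> chart_at A p \<in> A \<and> p \<in> cdom (chart_at A p)"
  unfolding chart_at_def using chart_cover someI_ex[of "\<lambda>c. c \<in> A \<and> p \<in> cdom c"] by blast

lemma cinv_cmap [simp]: "c \<in> A \<Longrightarrow> p \<in> cdom c \<Longrightarrow> cinv c (cmap c p) = p"
  using chart(3) by (auto simp: homeomorphism_def)

lemma cmap_cinv [simp]: "c \<in> A \<Longrightarrow> x \<in> cimg c \<Longrightarrow> cmap c (cinv c x) = x"
  using chart(3) by (auto simp: homeomorphism_def)

lemma cinv_in [simp]: "c \<in> A \<Longrightarrow> x \<in> cimg c \<Longrightarrow> cinv c x \<in> cdom c"
  using chart(3)[of c] by (auto simp: homeomorphism_def)

lemma cmap_in [simp]: "p \<in> cdom c \<Longrightarrow> cmap c p \<in> cimg c"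
  by (auto simp: cimg_def)

lemma continuous_on_cinv: "c \<in> A \<Longrightarrow> continuous_on (cimg c) (cinv c)"
  using chart(3) by (auto simp: homeomorphism_def)

lemma continuous_on_cmap: "c \<in> A \<Longrightarrow> continuous_on (cdom c) (cmap c)"
  using chart(3) by (auto simp: homeomorphism_def)

lemma cmap_image:
  assumes "c \<in> A" "E \<subseteq> cdom c"
  shows "cmap c ` E = {x \<in> cimg c. cinv c x \<in> E}"
proof (intro set_eqI iffI)
  fix x assume "x \<in> {x \<in> cimg c. cinv c x \<in> E}"
  then have "x = cmap c (cinv c x)" "cinv c x \<in> E"
    using assms(1) by simp_all
  then show "x \<in> cmap c ` E" by (rule image_eqI)
qed (use assms in \<open>auto simp: subset_iff\<close>)

lemma inj_on_cmap: "c \<in> A \<Longrightarrow> E \<subseteq> cdom c \<Longrightarrow> inj_on (cmap c) E"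
  by (intro inj_on_inverseI[where g = "cinv c"] cinv_cmap) auto

lemma cdom_open: "c \<in> A \<Longrightarrow> \<exists>W. open W \<and> cdom c = M \<inter> W"
  using chart(1) by (auto simp: openin_open)

lemma open_cmap_image:
  assumes "c \<in> A" "open W"
  shows "open (cmap c ` (cdom c \<inter> W))"
proof -
  have "cmap c ` (cdom c \<inter> W) = cimg c \<inter> cinv c -` W"
    using assms cmap_image[of c "cdom c \<inter> W"] by auto
  then show ?thesis
    using continuous_on_open_vimage[OF chart(2)[OF assms(1)], of "cinv c"] assms continuous_on_cinv
    by (metis inf_commute)
qed

lemma open_overlap:
  assumes "c \<in> A" "d \<in> A"
  shows "open (cmap c ` (cdom c \<inter> cdom d))"
proof -
  obtain W where "open W" "cdom d = M \<inter> W"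
    using cdom_open[OF assms(2)] by blast
  then show ?thesis
    using open_cmap_image[OF assms(1) \<open>open W\<close>] chart(4)[OF assms(1)]
    by (metis inf.absorb_iff1 inf.assoc)
qed

lemma transition_Ck:
  assumes "c \<in> A" "d \<in> A"
  shows "Ck_on k (cmap c ` (cdom c \<inter> cdom d)) (cmap d \<circ> cinv c)"
  using open_overlap[OF assms] atlas assms
  by (intro smooth_on_open_Ck) (auto simp: smooth_atlas_def)

lemma transition_differentiable:
  assumes "c \<in> A" "d \<in> A" "p \<in> cdom c" "p \<in> cdom d"
  shows "(cmap d \<circ> cinv c) differentiable (at (cmap c p))"
  using transition_Ck[OF assms(1,2), of 1] assms by auto

lemma partial_pd: "partial c i u p = pd i (\<lambda>x. u (cinv c x)) (cmap c p)"
  by (simp add: partial_def pd_def o_def)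

definition C1_fun :: "('m \<Rightarrow> real) \<Rightarrow> bool" where
  "C1_fun u \<longleftrightarrow> (\<forall>c\<in>A. C1_on (cimg c) (\<lambda>x. u (cinv c x)))"

definition dvec :: "('m \<Rightarrow> real) \<Rightarrow> ('m, 'n) chart \<Rightarrow> 'm \<Rightarrow> real^'n" where
  "dvec u c p = (\<chi> i. partial c i u p)"

lemma smooth_fun_imp_C1_fun: "smooth_fun A u \<Longrightarrow> C1_fun u"
  using chart(2) smooth_on_imp_C1_on(1) unfolding smooth_fun_def C1_fun_def o_def by blast

text \<open>The chain rule for the transition map \<open>cmap c \<circ> cinv d\<close>: near
  \<open>cmap d p\<close> the expression of \<open>u\<close> in \<open>d\<close> is its expression
  in \<open>c\<close> after this map, so the covector \<open>du\<close> is pulled back by the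
  transposed Jacobian.\<close>

lemma dvec_transform:
  assumes u: "C1_fun u" and "c \<in> A" "d \<in> A" and p: "p \<in> cdom c" "p \<in> cdom d"
  shows "dvec u d p = transpose (transition_jacobian c d p) *v dvec u c p"
proof -
  let ?U = "cmap d ` (cdom d \<inter> cdom c)"
  have U: "open ?U" "cmap d p \<in> ?U"
    using open_overlap[OF assms(3,2)] p by auto
  have td: "(cmap c \<circ> cinv d) differentiable (at (cmap d p))"
    using transition_differentiable[OF assms(3,2)] p by simp
  have ud: "(\<lambda>x. u (cinv c x)) differentiable (at ((cmap c \<circ> cinv d) (cmap d p)))"
    using u assms(2,3) p by (auto simp: C1_fun_def C1_on_def)
  have "partial d a u p = pd a ((\<lambda>x. u (cinv c x)) \<circ> (cmap c \<circ> cinv d)) (cmap d p)" for a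
    unfolding partial_pd
    by (rule pd_cong_open[OF U]) (use assms(2,3) in auto)
  also have "\<dots> a = (\<Sum>i\<in>UNIV. frechet_derivative (cmap c \<circ> cinv d) (at (cmap d p)) (axis a 1) $ i *
      partial c i u p)" for a
    using pd_chain[OF ud td] assms(3) p(2) by (simp add: partial_pd)
  finally show ?thesis
    by (simp add: dvec_def vec_eq_iff matrix_vector_mult_def transpose_def transition_jacobian_def
        matrix_def)
qed

end

locale riem_mfd = closed_mfd M A for M :: "'m::t2_space set" and A :: "('m, 'n::finite) chart set" +
  fixes g :: "('m, 'n) tensor02"
  assumes metric: "riemannian_metric A g"
begin

lemma metric_pos: "c \<in> A \<Longrightarrow> p \<in> cdom c \<Longrightarrow> v \<noteq> 0 \<Longrightarrow> 0 < v \<bullet> (g c p *v v)"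
  using metric by (auto simp: riemannian_metric_def)

lemma det_metric_pos: "c \<in> A \<Longrightarrow> p \<in> cdom c \<Longrightarrow> 0 < det (g c p)"
  using metric_pos det_pos_if_positive_definite by blast

lemma det_metric_nz: "c \<in> A \<Longrightarrow> p \<in> cdom c \<Longrightarrow> det (g c p) \<noteq> 0"
  using det_metric_pos by (metis less_irrefl)

lemma metric_transpose: "c \<in> A \<Longrightarrow> p \<in> cdom c \<Longrightarrow> transpose (g c p) = g c p"
  using metric unfolding riemannian_metric_def symmetric_tensor02_def by blast

lemma metric_transform:
  "c \<in> A \<Longrightarrow> d \<in> A \<Longrightarrow> p \<in> cdom c \<Longrightarrow> p \<in> cdom d \<Longrightarrow>
     g d p = transpose (transition_jacobian c d p) ** g c p ** transition_jacobian c d p"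
  using metric unfolding riemannian_metric_def symmetric_tensor02_def by blast

text \<open>The metric in the chart \<open>d\<close> is \<open>J^T G J\<close> and has nonzero
  determinant, so \<open>J\<close> does too; no inverse of the transition map has to be
  differentiated.\<close>

lemma transition_jacobian_nz:
  assumes "c \<in> A" "d \<in> A" "p \<in> cdom c" "p \<in> cdom d"
  shows "det (transition_jacobian c d p) \<noteq> 0"
  using det_metric_nz[OF assms(2,4)] metric_transform[OF assms] by (auto simp: det_mul)

lemma vol_density_transform:
  assumes "c \<in> A" "d \<in> A" "p \<in> cdom c" "p \<in> cdom d"
  shows "vol_density g d p = \<bar>det (transition_jacobian c d p)\<bar> * vol_density g c p"
  unfolding vol_density_def metric_transform[OF assms]
  by (simp add: det_mul det_transpose real_sqrt_mult mult.commute)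

lemma vol_density_pos: "c \<in> A \<Longrightarrow> p \<in> cdom c \<Longrightarrow> 0 < vol_density g c p"
  using det_metric_pos by (simp add: vol_density_def)

lemma metric_C1: "c \<in> A \<Longrightarrow> C1_on (cimg c) (\<lambda>x. g c (cinv c x) $ i $ j)"
  using metric chart(2)
  by (intro smooth_on_matrix_imp_C1_on) (auto simp: riemannian_metric_def smooth_tensor02_def)

lemma metric_inv_C1: "c \<in> A \<Longrightarrow> C1_on (cimg c) (\<lambda>x. matrix_inv (g c (cinv c x)) $ i $ j)"
  using chart(2) by (intro C1_on_matrix_inv metric_C1 det_metric_nz) auto

lemma vol_density_C1: "c \<in> A \<Longrightarrow> C1_on (cimg c) (\<lambda>x. vol_density g c (cinv c x))"
  unfolding vol_density_def by (intro C1_on_sqrt C1_on_det metric_C1 det_metric_pos) auto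

subsection \<open>The Riemannian volume measure\<close>

abbreviation vol :: "'m measure" where
  "vol \<equiv> riemannian_volume M A g"

text \<open>The volume of the chart domain transported to coordinates. The indicator is there
  because \<open>cinv c\<close> takes unspecified values off \<open>cimg c\<close>.\<close>

definition chart_vol :: "('m, 'n) chart \<Rightarrow> (real^'n) measure" where
  "chart_vol c = density lborel (\<lambda>x. ennreal (indicator (cimg c) x * vol_density g c (cinv c x)))"

lemma indicator_cimg_measurable:
  fixes f :: "real^'n \<Rightarrow> real"
  assumes "c \<in> A" "continuous_on (cimg c) f"
  shows "(\<lambda>x. indicator (cimg c) x * f x) \<in> borel_measurable borel"
  using borel_measurable_continuous_on_indicator[of "cimg c" f] assms chart(2)[OF assms(1)] by simp

lemma density_measurable [measurable]:
  "c \<in> A \<Longrightarrow> (\<lambda>x. indicator (cimg c) x * vol_density g c (cinv c x)) \<in> borel_measurable borel"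
  by (intro indicator_cimg_measurable C1_on_imp_continuous_on[OF vol_density_C1])

lemma sets_chart_vol [simp]: "sets (chart_vol c) = sets borel"
  by (simp add: chart_vol_def)

lemma sets_M_iff: "E \<in> sets (restrict_space borel M) \<longleftrightarrow> E \<subseteq> M \<and> E \<in> sets borel"
  using closed_M by (subst sets_restrict_space_iff) auto

lemma cdom_sets: "c \<in> A \<Longrightarrow> cdom c \<in> sets borel"
  using cdom_open[of c] closed_M by (metis borel_closed borel_open sets.Int)

lemma cmap_image_sets:
  assumes "c \<in> A" "E \<in> sets borel" "E \<subseteq> cdom c"
  shows "cmap c ` E \<in> sets borel"
proof -
  have "cinv c \<in> borel_measurable (restrict_space borel (cimg c))"
    using continuous_on_cinv[OF assms(1)] by (rule borel_measurable_continuous_on_restrict)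
  from measurable_sets[OF this assms(2)]
  have "cinv c -` E \<inter> cimg c \<in> sets (restrict_space borel (cimg c))"
    by (simp add: space_restrict_space)
  then have "cinv c -` E \<inter> cimg c \<in> sets borel"
    using chart(2)[OF assms(1)] by (auto simp: sets_restrict_space_iff)
  moreover have "cmap c ` E = cinv c -` E \<inter> cimg c"
    using cmap_image[OF assms(1,3)] by auto
  ultimately show ?thesis by simp
qed

lemma emeasure_chart_vol:
  assumes "c \<in> A" "B \<in> sets borel" "B \<subseteq> cimg c"
  shows "emeasure (chart_vol c) B = (\<integral>\<^sup>+ x \<in> B. ennreal (vol_density g c (cinv c x)) \<partial>lborel)"
  unfolding chart_vol_def using assms density_measurable[OF assms(1)]
  by (subst emeasure_density) (auto intro!: nn_integral_cong split: split_indicator)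

text \<open>Change of variables under the transition map produces the factor
  \<open>\<bar>det J\<bar>\<close>, exactly the one by which the two densities differ. This
  compatibility is what makes the volume on \<open>M\<close> well defined.\<close>

lemma chart_vol_transition:
  assumes c: "c \<in> A" and d: "d \<in> A" and E: "E \<in> sets borel" "E \<subseteq> cdom c" "E \<subseteq> cdom d"
  shows "emeasure (chart_vol c) (cmap c ` E) = emeasure (chart_vol d) (cmap d ` E)"
proof -
  let ?\<tau> = "cmap c \<circ> cinv d" and ?S = "cmap d ` E" and ?f = "\<lambda>x. vol_density g c (cinv c x)"
  let ?J = "\<lambda>x. frechet_derivative ?\<tau> (at x)"
  have S: "?S \<in> sets borel"
    using cmap_image_sets[OF d E(1,3)] .
  have im: "?\<tau> ` ?S = cmap c ` E"
    using d E by (force simp: image_iff)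
  have sub: "cmap c ` E \<subseteq> cimg c" "?S \<subseteq> cimg d"
    using E by auto
  have eq: "\<bar>det (matrix (?J x))\<bar> * ?f (?\<tau> x) = vol_density g d (cinv d x)" if x: "x \<in> ?S" for x
  proof -
    obtain p where p: "p \<in> E" "x = cmap d p" using x by blast
    then show ?thesis
      using vol_density_transform[OF c d, of p] E c d by (auto simp: transition_jacobian_def subset_iff)
  qed
  have "emeasure (chart_vol c) (cmap c ` E) = (\<integral>\<^sup>+ x \<in> ?\<tau> ` ?S. ennreal (?f x) \<partial>lborel)"
    unfolding im by (rule emeasure_chart_vol[OF c cmap_image_sets[OF c E(1,2)] sub(1)])
  also have "\<dots> = (\<integral>\<^sup>+ x \<in> ?S. ennreal (\<bar>det (matrix (?J x))\<bar> * ?f (?\<tau> x)) \<partial>lborel)"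
  proof (rule nn_integral_change_of_variables[OF S])
    show "(?\<tau> has_derivative ?J x) (at x within ?S)" if x: "x \<in> ?S" for x
    proof -
      obtain p where "p \<in> E" "x = cmap d p" using x by blast
      then have "?\<tau> differentiable (at x)"
        using transition_differentiable[OF d c, of p] E by blast
      then show ?thesis
        using has_derivative_at_withinI frechet_derivative_works by blast
    qed
    show "inj_on ?\<tau> ?S"
    proof (rule inj_onI)
      fix x y assume "x \<in> ?S" "y \<in> ?S" and eq: "?\<tau> x = ?\<tau> y"
      then obtain p q where pq: "p \<in> E" "x = cmap d p" "q \<in> E" "y = cmap d q" by blast
      then have "cmap c p = cmap c q"
        using eq d E(3) by (simp add: subset_iff)
      then show "x = y"
        using inj_onD[OF inj_on_cmap[OF c E(2)]] pq by blast
    qed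
    show "0 \<le> ?f x" if "x \<in> ?\<tau> ` ?S" for x
      using that im sub vol_density_pos[OF c] c by (metis cinv_in less_imp_le subsetD)
    \<comment> \<open>The extra factor \<open>indicator (cimg c)\<close>, equal to 1 on the set of
      integration, brings in the density cut off to its chart, whose measurability is known.\<close>
    have "(\<lambda>x. indicator (cmap c ` E) x * (indicator (cimg c) x * ?f x)) \<in> borel_measurable borel"
      using density_measurable[OF c] cmap_image_sets[OF c E(1,2)] by measurable
    also have "(\<lambda>x. indicator (cmap c ` E) x * (indicator (cimg c) x * ?f x)) =
        (\<lambda>x. indicator (?\<tau> ` ?S) x * ?f x)"
      unfolding im using sub(1) by (auto simp: fun_eq_iff indicator_def)
    finally show "(\<lambda>x. indicator (?\<tau> ` ?S) x * ?f x) \<in> borel_measurable borel" .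
    have "(\<lambda>x. indicator ?S x * (indicator (cimg d) x * vol_density g d (cinv d x))) \<in> borel_measurable borel"
      using density_measurable[OF d] S by measurable
    also have "(\<lambda>x. indicator ?S x * (indicator (cimg d) x * vol_density g d (cinv d x))) =
        (\<lambda>x. indicator ?S x * (\<bar>det (matrix (?J x))\<bar> * ?f (?\<tau> x)))"
      using sub(2) eq by (auto simp: fun_eq_iff indicator_def)
    finally show "(\<lambda>x. indicator ?S x * (\<bar>det (matrix (?J x))\<bar> * ?f (?\<tau> x))) \<in> borel_measurable borel" .
  qed
  also have "\<dots> = (\<integral>\<^sup>+ x \<in> ?S. ennreal (vol_density g d (cinv d x)) \<partial>lborel)"
    using eq by (intro nn_integral_cong) (auto split: split_indicator)
  also have "\<dots> = emeasure (chart_vol d) ?S"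
    using emeasure_chart_vol[OF d S sub(2)] by simp
  finally show ?thesis .
qed

text \<open>The predicate under the definite description in \<open>riemannian_volume\<close>, with
  the chart integral read as a value of \<open>chart_vol c\<close>; \<open>is_volume_iff\<close>
  identifies the two forms.\<close>

definition is_volume :: "'m measure \<Rightarrow> bool" where
  "is_volume \<mu> \<longleftrightarrow> sets \<mu> = sets (restrict_space borel M) \<and>
    (\<forall>c\<in>A. \<forall>E\<in>sets \<mu>. E \<subseteq> cdom c \<longrightarrow> emeasure \<mu> E = emeasure (chart_vol c) (cmap c ` E))"

text \<open>Compactness leaves finitely many chart domains, and removing the earlier ones from each
  makes them disjoint. Borel pieces suffice for constructing a measure; smooth cutoffs are
  introduced only for integration by parts.\<close>

lemma finite_chart_partition:
  "\<exists>(N::nat) cs D. (\<forall>k<N. cs k \<in> A \<and> D k \<subseteq> cdom (cs k) \<and> D k \<in> sets borel) \<and>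
     M = (\<Union>k<N. D k) \<and> disjoint_family_on D {..<N}"
proof -
  have "\<exists>F\<subseteq>A. finite F \<and> M \<subseteq> (\<Union>c\<in>F. cdom c)"
  proof -
    obtain W where W: "\<And>c. c \<in> A \<Longrightarrow> open (W c) \<and> cdom c = M \<inter> W c"
      using cdom_open by metis
    have "M \<subseteq> (\<Union>c\<in>A. W c)"
      using W chart_cover by blast
    moreover have "open (W c)" if "c \<in> A" for c
      using W that by blast
    ultimately obtain F where "F \<subseteq> A" "finite F" "M \<subseteq> (\<Union>c\<in>F. W c)"
      using compactE_image[OF compact_M, of A W] by blast
    moreover have "M \<inter> W c = cdom c" if "c \<in> F" for c
      using W \<open>F \<subseteq> A\<close> that by (metis subsetD)
    ultimately show ?thesis
      by (intro exI[of _ F]) blast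
  qed
  then obtain F where F: "F \<subseteq> A" "finite F" "M \<subseteq> (\<Union>c\<in>F. cdom c)" by blast
  obtain cs where cs: "bij_betw cs {..<card F} F"
    using F(2) ex_bij_betw_nat_finite by (metis atLeast0LessThan)
  have csA: "cs k \<in> A" if "k < card F" for k
    using cs F(1) that by (auto simp: bij_betw_def)
  define D where "D k = cdom (cs k) - (\<Union>j<k. cdom (cs j))" for k
  show ?thesis
  proof (intro exI[of _ "card F"] exI[of _ cs] exI[of _ D] conjI allI impI)
    show "D k \<in> sets borel" if "k < card F" for k
      using that csA cdom_sets unfolding D_def by (intro sets.Diff sets.finite_UN) auto
    have "D k \<subseteq> M" if "k < card F" for k
      using chart(4)[OF csA[OF that]] by (auto simp: D_def)
    moreover have "\<exists>k<card F. p \<in> D k" if p: "p \<in> M" for p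
    proof -
      have "\<exists>k. k < card F \<and> p \<in> cdom (cs k)"
      proof -
        obtain c where "c \<in> F" "p \<in> cdom c" using p F(3) by blast
        then show ?thesis
          using bij_betw_imp_surj_on[OF cs] by (metis imageE lessThan_iff)
      qed
      then obtain k where k: "k < card F \<and> p \<in> cdom (cs k)"
        "\<And>j. j < k \<Longrightarrow> \<not> (j < card F \<and> p \<in> cdom (cs j))"
        using exists_least_iff[of "\<lambda>k. k < card F \<and> p \<in> cdom (cs k)"] by blast
      then show ?thesis
        by (intro exI[of _ k]) (auto simp: D_def)
    qed
    ultimately show "M = (\<Union>k<card F. D k)" by blast
    show "disjoint_family_on D {..<card F}"
      unfolding disjoint_family_on_def
    proof (intro ballI impI)
      fix i j :: nat assume "i \<noteq> j"
      then consider "i < j" | "j < i" by linarith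
      then show "D i \<inter> D j = {}"
        by cases (auto simp: D_def)
    qed
  qed (auto simp: D_def csA)
qed

text \<open>Additivity over the disjoint pieces expresses any candidate through chart measures that
  do not mention it. Uniqueness of the volume follows from this, and the right-hand side is also the
  recipe for existence.\<close>

lemma emeasure_chart_partition:
  fixes N :: nat
  assumes \<mu>: "is_volume \<mu>" and "E \<in> sets \<mu>"
    and cs: "\<forall>k<N. cs k \<in> A \<and> D k \<subseteq> cdom (cs k) \<and> D k \<in> sets borel"
    and D: "M = (\<Union>k<N. D k)" "disjoint_family_on D {..<N}"
  shows "emeasure \<mu> E = (\<Sum>k<N. emeasure (chart_vol (cs k)) (cmap (cs k) ` (E \<inter> D k)))"
proof -
  have E: "E \<subseteq> M" "E \<in> sets borel"
    using assms(2) \<mu> by (auto simp: is_volume_def sets_M_iff)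
  have ED: "E \<inter> D k \<in> sets \<mu>" if "k < N" for k
    using that E cs \<mu> by (auto simp: is_volume_def sets_M_iff)
  have "E = (\<Union>k\<in>{..<N}. E \<inter> D k)"
    using E(1) D(1) by blast
  then have "emeasure \<mu> E = emeasure \<mu> (\<Union>k\<in>{..<N}. E \<inter> D k)" by simp
  also have "\<dots> = (\<Sum>k<N. emeasure \<mu> (E \<inter> D k))"
    using ED D(2) by (intro sum_emeasure[symmetric] finite_lessThan) (auto simp: disjoint_family_on_def)
  also have "\<dots> = (\<Sum>k<N. emeasure (chart_vol (cs k)) (cmap (cs k) ` (E \<inter> D k)))"
  proof (intro sum.cong refl)
    fix k assume "k \<in> {..<N}"
    then show "emeasure \<mu> (E \<inter> D k) = emeasure (chart_vol (cs k)) (cmap (cs k) ` (E \<inter> D k))"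
      using ED cs \<mu> unfolding is_volume_def by (metis inf.coboundedI2 lessThan_iff)
  qed
  finally show ?thesis .
qed

text \<open>Chart measures are glued along a finite Borel partition. Countable additivity is
  inherited piece by piece, since charts are injective and carry disjoint sets to disjoint sets.
  Validity in a chart outside the partition comes from \<open>chart_vol_transition\<close>.\<close>

lemma ex_volume: "\<exists>\<mu>. is_volume \<mu>"
proof -
  obtain N :: nat and cs D where cs: "\<forall>k<N. cs k \<in> A \<and> D k \<subseteq> cdom (cs k) \<and> D k \<in> sets borel"
    and cov: "M = (\<Union>k<N. D k)" and disj: "disjoint_family_on D {..<N}"
    using finite_chart_partition by blast
  have csA: "cs k \<in> A" and D: "D k \<subseteq> cdom (cs k)" "D k \<in> sets borel" if "k < N" for k
    using cs that by auto
  let ?S = "sets (restrict_space borel M)"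
  define v where "v E = (\<Sum>k<N. emeasure (chart_vol (cs k)) (cmap (cs k) ` (E \<inter> D k)))" for E
  define \<mu> where "\<mu> = measure_of M ?S v"
  have spM: "space (restrict_space borel M) = M"
    by (simp add: space_restrict_space)
  have sets: "sets \<mu> = ?S"
    unfolding \<mu>_def using sets.sets_measure_of_eq[of "restrict_space borel M"] spM by metis
  have img: "cmap (cs k) ` (E \<inter> D k) \<in> sets borel" if "k < N" "E \<in> ?S" for k E
    using that csA D by (intro cmap_image_sets) (auto simp: sets_M_iff)
  have inj: "inj_on (cmap (cs k)) (D k)" if "k < N" for k
    using csA[OF that] D(1)[OF that] by (rule inj_on_cmap)
  have v: "emeasure \<mu> E = v E" if "E \<in> ?S" for E
  proof (rule emeasure_measure_of[OF \<mu>_def])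
    show "?S \<subseteq> Pow M"
      using sets.space_closed[of "restrict_space borel M"] spM by simp
    show "positive (sets \<mu>) v"
      by (simp add: positive_def v_def)
    show "countably_additive (sets \<mu>) v"
      unfolding countably_additive_def sets
    proof (intro allI impI)
      fix E :: "nat \<Rightarrow> 'm set"
      assume E: "range E \<subseteq> ?S" "disjoint_family E" "\<Union>(range E) \<in> ?S"
      have "(\<Sum>i. emeasure (chart_vol (cs k)) (cmap (cs k) ` (E i \<inter> D k))) =
          emeasure (chart_vol (cs k)) (cmap (cs k) ` (\<Union>(range E) \<inter> D k))" if k: "k < N" for k
      proof -
        have "(\<Sum>i. emeasure (chart_vol (cs k)) (cmap (cs k) ` (E i \<inter> D k))) =
          emeasure (chart_vol (cs k)) (\<Union>i. cmap (cs k) ` (E i \<inter> D k))"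
        proof (rule suminf_emeasure)
          show "range (\<lambda>i. cmap (cs k) ` (E i \<inter> D k)) \<subseteq> sets (chart_vol (cs k))"
            using img[OF k] E(1) by auto
          show "disjoint_family (\<lambda>i. cmap (cs k) ` (E i \<inter> D k))"
            unfolding disjoint_family_on_def
          proof (intro ballI impI)
            fix i j :: nat assume "i \<noteq> j"
            then have "(E i \<inter> D k) \<inter> (E j \<inter> D k) = {}"
              using E(2) by (auto simp: disjoint_family_on_def)
            then show "cmap (cs k) ` (E i \<inter> D k) \<inter> cmap (cs k) ` (E j \<inter> D k) = {}"
              using inj_on_image_Int[OF inj[OF k], of "E i \<inter> D k" "E j \<inter> D k"] by auto
          qed
        qed
        also have "(\<Union>i. cmap (cs k) ` (E i \<inter> D k)) = cmap (cs k) ` (\<Union>(range E) \<inter> D k)"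
          by blast
        finally show ?thesis .
      qed
      then show "(\<Sum>i. v (E i)) = v (\<Union>(range E))"
        unfolding v_def by (subst suminf_sum) auto
    qed
    show "E \<in> sets \<mu>" using that sets by simp
  qed
  have "emeasure \<mu> E = emeasure (chart_vol c) (cmap c ` E)"
    if c: "c \<in> A" and E: "E \<in> sets \<mu>" "E \<subseteq> cdom c" for c E
  proof -
    have EM: "E \<subseteq> M" "E \<in> sets borel"
      using E sets by (auto simp: sets_M_iff)
    have ED: "E \<inter> D k \<in> sets borel" if "k < N" for k
      using EM D(2)[OF that] by auto
    have "emeasure \<mu> E = (\<Sum>k<N. emeasure (chart_vol (cs k)) (cmap (cs k) ` (E \<inter> D k)))"
      using v[of E] E sets by (simp add: v_def)
    \<comment> \<open>Each piece was measured in its own chart \<open>cs k\<close>. It lies in the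
      domains of both \<open>cs k\<close> and \<open>c\<close>, so it may be measured in
      \<open>c\<close> instead; there the pieces add up again.\<close>
    also have "\<dots> = (\<Sum>k<N. emeasure (chart_vol c) (cmap c ` (E \<inter> D k)))"
    proof (intro sum.cong refl)
      fix k assume "k \<in> {..<N}"
      then have k: "k < N" by simp
      have "E \<inter> D k \<subseteq> cdom (cs k)" "E \<inter> D k \<subseteq> cdom c"
        using D(1)[OF k] E(2) by blast+
      then show "emeasure (chart_vol (cs k)) (cmap (cs k) ` (E \<inter> D k)) =
          emeasure (chart_vol c) (cmap c ` (E \<inter> D k))"
        by (rule chart_vol_transition[OF csA[OF k] c ED[OF k]])
    qed
    also have "\<dots> = emeasure (chart_vol c) (\<Union>k\<in>{..<N}. cmap c ` (E \<inter> D k))"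
    proof (rule sum_emeasure)
      show "(\<lambda>k. cmap c ` (E \<inter> D k)) ` {..<N} \<subseteq> sets (chart_vol c)"
        using cmap_image_sets[OF c] ED E(2) by auto
      have "inj_on (cmap c) E"
        using c E(2) by (rule inj_on_cmap)
      then have "cmap c ` (E \<inter> D i) \<inter> cmap c ` (E \<inter> D j) = cmap c ` (E \<inter> D i \<inter> (E \<inter> D j))" for i j
        by (subst inj_on_image_Int[where C = E]) auto
      moreover have "E \<inter> D i \<inter> (E \<inter> D j) = {}" if "i < N" "j < N" "i \<noteq> j" for i j
        using disj that by (auto simp: disjoint_family_on_def)
      ultimately show "disjoint_family_on (\<lambda>k. cmap c ` (E \<inter> D k)) {..<N}"
        by (simp add: disjoint_family_on_def)
    qed simp
    also have "(\<Union>k\<in>{..<N}. cmap c ` (E \<inter> D k)) = cmap c ` E"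
      using EM(1) cov by blast
    finally show ?thesis .
  qed
  then have "is_volume \<mu>"
    using sets by (simp add: is_volume_def)
  then show ?thesis ..
qed

lemma volume_unique:
  assumes "is_volume \<mu>" "is_volume \<nu>"
  shows "\<mu> = \<nu>"
proof (rule measure_eqI)
  show "sets \<mu> = sets \<nu>"
    using assms by (simp add: is_volume_def)
  obtain N :: nat and cs D where P: "\<forall>k<N. cs k \<in> A \<and> D k \<subseteq> cdom (cs k) \<and> D k \<in> sets borel"
    "M = (\<Union>k<N. D k)" "disjoint_family_on D {..<N}"
    using finite_chart_partition by blast
  show "emeasure \<mu> E = emeasure \<nu> E" if "E \<in> sets \<mu>" for E
    using emeasure_chart_partition[OF assms(1) that P]
      emeasure_chart_partition[OF assms(2) _ P, of E] that \<open>sets \<mu> = sets \<nu>\<close> by simp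
qed

lemma is_volume_iff:
  "is_volume \<mu> \<longleftrightarrow> sets \<mu> = sets (restrict_space borel M) \<and>
     (\<forall>c\<in>A. \<forall>E\<in>sets \<mu>. E \<subseteq> cdom c \<longrightarrow>
        emeasure \<mu> E = (\<integral>\<^sup>+ x \<in> cmap c ` E. ennreal (vol_density g c (cinv c x)) \<partial>lborel))"
proof -
  have *: "emeasure (chart_vol c) (cmap c ` E) =
      (\<integral>\<^sup>+ x \<in> cmap c ` E. ennreal (vol_density g c (cinv c x)) \<partial>lborel)"
    if "c \<in> A" "E \<in> sets (restrict_space borel M)" "E \<subseteq> cdom c" for c E
    using that by (intro emeasure_chart_vol cmap_image_sets) (auto simp: sets_M_iff)
  show ?thesis
    unfolding is_volume_def
    by (intro conj_cong refl ball_cong imp_cong) (simp_all only: *)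
qed

lemma is_volume_vol: "is_volume vol"
proof -
  have "\<exists>!\<mu>. is_volume \<mu>"
    using ex_volume volume_unique by blast
  from theI'[OF this] show ?thesis
    unfolding riemannian_volume_def is_volume_iff[abs_def] .
qed

lemma sets_vol: "sets vol = sets (restrict_space borel M)"
  using is_volume_vol unfolding is_volume_def by blast

lemma space_vol: "space vol = M"
  using sets_eq_imp_space_eq[OF sets_vol] by (simp add: space_restrict_space)

lemma emeasure_vol_chart:
  "c \<in> A \<Longrightarrow> E \<in> sets vol \<Longrightarrow> E \<subseteq> cdom c \<Longrightarrow> emeasure vol E = emeasure (chart_vol c) (cmap c ` E)"
  using is_volume_vol unfolding is_volume_def by blast

text \<open>Restricted to the chart domain, \<open>vol\<close> is the image of
  \<open>chart_vol c\<close> under the inverse chart. The condition on the zeros of \<open>f\<close>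
  makes this restriction harmless, and the rules for densities and image measures give the
  coordinate integral.\<close>

lemma
  fixes f :: "'m \<Rightarrow> real"
  assumes c: "c \<in> A" and f: "f \<in> borel_measurable vol" and supp: "\<And>p. p \<in> M \<Longrightarrow> p \<notin> cdom c \<Longrightarrow> f p = 0"
  shows integrable_chart: "integrable vol f \<longleftrightarrow>
      integrable lborel (\<lambda>x. indicator (cimg c) x * vol_density g c (cinv c x) * f (cinv c x))"
    and integral_chart: "integral\<^sup>L vol f =
      integral\<^sup>L lborel (\<lambda>x. indicator (cimg c) x * vol_density g c (cinv c x) * f (cinv c x))"
proof -
  obtain p0 where p0: "p0 \<in> M" using nonempty by auto
  \<comment> \<open>A total map into \<open>M\<close> that extends \<open>cinv c\<close>; the
    default \<open>p0\<close> is taken only where the density of \<open>chart_vol c\<close>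
    vanishes.\<close>
  define r where "r x = (if x \<in> cimg c then cinv c x else p0)" for x
  have cdv: "cdom c \<in> sets vol"
    using cdom_sets[OF c] chart(4)[OF c] by (simp add: sets_vol sets_M_iff)
  have [measurable]: "r \<in> lborel \<rightarrow>\<^sub>M vol"
  proof (rule measurableI)
    show "r x \<in> space vol" for x
      using p0 c chart(4)[OF c] cinv_in[OF c, of x] by (auto simp: r_def space_vol)
    fix E assume E: "E \<in> sets vol"
    have "r -` E = cmap c ` (E \<inter> cdom c) \<union> (if p0 \<in> E then - cimg c else {})"
      using cmap_image[OF c, of "E \<inter> cdom c"] c by (auto simp: r_def split: if_splits)
    moreover have "cmap c ` (E \<inter> cdom c) \<in> sets borel"
      using E cdom_sets[OF c] by (intro cmap_image_sets[OF c]) (auto simp: sets_vol sets_M_iff)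
    ultimately show "r -` E \<inter> space lborel \<in> sets lborel"
      using chart(2)[OF c] by auto
  qed
  then have rV [measurable]: "r \<in> chart_vol c \<rightarrow>\<^sub>M vol"
    by (simp add: chart_vol_def)
  have eq: "density vol (\<lambda>p. ennreal (indicator (cdom c) p)) = distr (chart_vol c) vol r"
  proof (rule measure_eqI)
    fix E assume "E \<in> sets (density vol (\<lambda>p. ennreal (indicator (cdom c) p)))"
    then have E: "E \<in> sets vol" by simp
    have "emeasure (density vol (\<lambda>p. ennreal (indicator (cdom c) p))) E =
        (\<integral>\<^sup>+ p. indicator (E \<inter> cdom c) p \<partial>vol)"
      using cdv E by (subst emeasure_density)
        (auto intro!: nn_integral_cong simp del: nn_integral_indicator split: split_indicator)
    also have "\<dots> = emeasure vol (E \<inter> cdom c)"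
      using cdv E by simp
    also have "\<dots> = emeasure (chart_vol c) (cmap c ` (E \<inter> cdom c))"
      using emeasure_vol_chart[OF c, of "E \<inter> cdom c"] cdv E by auto
    also have "\<dots> = emeasure (chart_vol c) (r -` E)"
    proof -
      have 1: "cmap c ` (E \<inter> cdom c) = r -` E \<inter> cimg c"
        using cmap_image[OF c, of "E \<inter> cdom c"] c by (auto simp: r_def)
      have 2: "r -` E \<in> sets borel"
        using measurable_sets[OF \<open>r \<in> lborel \<rightarrow>\<^sub>M vol\<close> E] by simp
      show ?thesis
        unfolding 1 chart_vol_def using 2 chart(2)[OF c] density_measurable[OF c]
        by (subst (1 2) emeasure_density) (auto intro!: nn_integral_cong split: split_indicator)
    qed
    also have "\<dots> = emeasure (distr (chart_vol c) vol r) E"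
      using E by (subst emeasure_distr) (auto simp: chart_vol_def)
    finally show "emeasure (density vol (\<lambda>p. ennreal (indicator (cdom c) p))) E =
        emeasure (distr (chart_vol c) vol r) E" .
  qed simp
  have ae: "AE x in lborel. 0 \<le> indicator (cimg c) x * vol_density g c (cinv c x)"
    using c vol_density_pos[OF c] by (intro AE_I2) (auto simp: indicator_def less_imp_le)
  have fr: "(\<lambda>x. f (r x)) \<in> borel_measurable lborel"
    using f by measurable
  have same: "indicator (cdom c) p *\<^sub>R f p = f p" if "p \<in> space vol" for p
    using supp that by (auto simp: space_vol indicator_def)
  have same'': "integrable vol f \<longleftrightarrow> integrable vol (\<lambda>p. indicator (cdom c) p *\<^sub>R f p)"
    by (intro Bochner_Integration.integrable_cong refl same[symmetric])
  have same''': "integral\<^sup>L vol f = integral\<^sup>L vol (\<lambda>p. indicator (cdom c) p *\<^sub>R f p)"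
    by (intro LINT_cong refl same[symmetric])
  have same': "(indicator (cimg c) x * vol_density g c (cinv c x)) *\<^sub>R f (r x) =
      indicator (cimg c) x * vol_density g c (cinv c x) * f (cinv c x)" for x
    by (auto simp: indicator_def r_def)
  have "integrable vol f \<longleftrightarrow> integrable (density vol (\<lambda>p. ennreal (indicator (cdom c) p))) f"
    using f cdv same'' by (subst integrable_density) auto
  also have "\<dots> \<longleftrightarrow> integrable (chart_vol c) (\<lambda>x. f (r x))"
    unfolding eq using f by (subst integrable_distr_eq) auto
  also have "\<dots> \<longleftrightarrow> integrable lborel (\<lambda>x. indicator (cimg c) x * vol_density g c (cinv c x) * f (cinv c x))"
    unfolding chart_vol_def same'[symmetric]
    using density_measurable[OF c] fr ae by (subst integrable_density) auto
  finally show "integrable vol f \<longleftrightarrow>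
      integrable lborel (\<lambda>x. indicator (cimg c) x * vol_density g c (cinv c x) * f (cinv c x))" .
  have "integral\<^sup>L vol f = integral\<^sup>L (density vol (\<lambda>p. ennreal (indicator (cdom c) p))) f"
    using f cdv same''' by (subst integral_density) auto
  also have "\<dots> = integral\<^sup>L (chart_vol c) (\<lambda>x. f (r x))"
    unfolding eq using f by (subst integral_distr) auto
  also have "\<dots> = integral\<^sup>L lborel (\<lambda>x. indicator (cimg c) x * vol_density g c (cinv c x) * f (cinv c x))"
    unfolding chart_vol_def same'[symmetric]
    using density_measurable[OF c] fr ae by (subst integral_density) auto
  finally show "integral\<^sup>L vol f =
      integral\<^sup>L lborel (\<lambda>x. indicator (cimg c) x * vol_density g c (cinv c x) * f (cinv c x))" .
qed

end

subsection \<open>Compactly supported functions in a chart\<close>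

lemma integrable_compact_support:
  fixes F :: "'a::euclidean_space \<Rightarrow> real"
  assumes "compact K" "K \<subseteq> V" "continuous_on V F" "\<And>x. x \<in> V \<Longrightarrow> x \<notin> K \<Longrightarrow> F x = 0"
  shows "integrable lborel (\<lambda>x. indicator V x * F x)"
proof -
  have "integrable lborel (\<lambda>x. indicator K x *\<^sub>R F x)"
    using borel_integrable_compact[OF assms(1) continuous_on_subset[OF assms(3,2)]] by simp
  also have "(\<lambda>x. indicator K x *\<^sub>R F x) = (\<lambda>x. indicator V x * F x)"
    using assms(2,4) by (auto simp: fun_eq_iff indicator_def)
  finally show ?thesis .
qed

lemma pd_const: "pd i (\<lambda>_. c) x = 0"
  by (rule pd_eqI[OF has_derivative_const])

lemma pd_eq_0_outside:
  assumes "open V" "compact K" "\<And>x. x \<in> V \<Longrightarrow> x \<notin> K \<Longrightarrow> f x = 0" "x \<in> V" "x \<notin> K"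
  shows "pd i f x = 0"
proof -
  have "open (V - K)"
    using assms by (simp add: open_Diff compact_imp_closed)
  then have "pd i f x = pd i (\<lambda>_. 0) x"
    using assms by (intro pd_cong_open[of "V - K"]) auto
  then show ?thesis
    by (simp add: pd_const)
qed

text \<open>The product \<open>f * Q\<close>, extended by zero, is C1 on the whole space, because it
  is C1 on each of the open sets \<open>V\<close> and \<open>- K\<close> and these cover. The
  integral of its partial derivative vanishes, and the product rule splits it into the two
  terms.\<close>

lemma integration_by_parts_compact_support:
  fixes f Q :: "real^'n \<Rightarrow> real"
  assumes V: "open V" and K: "compact K" "K \<subseteq> V" and f: "C1_on V f" and Q: "C1_on V Q"
    and supp0: "\<forall>x\<in>V - K. f x = 0"
  shows "integrable lborel (\<lambda>x. indicator V x * (pd i f x * Q x))"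
    and "integrable lborel (\<lambda>x. indicator V x * (f x * pd i Q x))"
    and "integral\<^sup>L lborel (\<lambda>x. indicator V x * (f x * pd i Q x)) =
      - integral\<^sup>L lborel (\<lambda>x. indicator V x * (pd i f x * Q x))"
proof -
  have supp: "f x = 0" if "x \<in> V" "x \<notin> K" for x
    using supp0 that by blast
  have pd0: "pd i f x = 0" if "x \<in> V" "x \<notin> K" for x
    using pd_eq_0_outside[OF V K(1) supp that] .
  note c = C1_on_imp_continuous_on[OF f] C1_on_imp_continuous_on[OF Q]
    C1_on_continuous_pd[OF f] C1_on_continuous_pd[OF Q]
  show i1: "integrable lborel (\<lambda>x. indicator V x * (pd i f x * Q x))"
    using pd0 by (intro integrable_compact_support[OF K] continuous_intros c) auto
  show i2: "integrable lborel (\<lambda>x. indicator V x * (f x * pd i Q x))"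
    using supp by (intro integrable_compact_support[OF K] continuous_intros c) auto
  define w where "w x = (if x \<in> V then f x * Q x else 0)" for x
  have wV: "C1_on V w"
    by (rule C1_on_cong[OF V _ C1_on_mult[OF f Q]]) (simp add: w_def)
  have opK: "open (- K)"
    using K by (simp add: compact_imp_closed open_Compl)
  have w0: "w x = 0" if "x \<notin> K" for x
    using that supp by (auto simp: w_def)
  have wK: "C1_on (- K) w"
    by (rule C1_on_cong[OF opK, of "\<lambda>_. 0"]) (auto simp: w0)
  have "C1_on (\<Union>{V, - K}) w"
    using V opK wV wK by (intro C1_on_Union) auto
  moreover have "\<Union>{V, - K} = UNIV"
    using K by auto
  ultimately have w: "C1_on UNIV w" by simp
  have eq: "pd i w x = indicator V x * (pd i f x * Q x) + indicator V x * (f x * pd i Q x)" for x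
  proof (cases "x \<in> V")
    case True
    have "pd i w x = pd i (\<lambda>x. f x * Q x) x"
      by (rule pd_cong_open[OF V True]) (simp add: w_def)
    then show ?thesis
      using True pd_mult[OF f Q True] by simp
  next
    case False
    then have "x \<notin> K" using K by auto
    then show ?thesis
      using pd_eq_0_outside[OF open_UNIV K(1), of w x i] w0 False by auto
  qed
  have "integral\<^sup>L lborel (\<lambda>x. frechet_derivative w (at x) (axis i 1)) = 0"
    using C1_on_continuous_pd[OF w, of i, unfolded pd_def[abs_def]]
    by (rule integral_directional_derivative_eq_0[OF C1_on_has_derivative[OF w UNIV_I] _ K(1) w0])
  then have "integral\<^sup>L lborel (\<lambda>x. indicator V x * (pd i f x * Q x) + indicator V x * (f x * pd i Q x)) = 0"
    unfolding eq[symmetric] unfolding pd_def .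
  then show "integral\<^sup>L lborel (\<lambda>x. indicator V x * (f x * pd i Q x)) =
      - integral\<^sup>L lborel (\<lambda>x. indicator V x * (pd i f x * Q x))"
    using i1 i2 by simp
qed

text \<open>Squaring the positive part makes the function C1 across the sphere of radius
  \<open>r\<close>, while it stays positive exactly on the open ball when
  \<open>r > 0\<close>.\<close>

definition bump :: "real^'n \<Rightarrow> real \<Rightarrow> real^'n \<Rightarrow> real" where
  "bump x0 r x = (max 0 (r\<^sup>2 - (x - x0) \<bullet> (x - x0)))\<^sup>2"

text \<open>Only \<open>t = 0\<close> is delicate: there the difference quotient at \<open>y\<close>
  is bounded by \<open>\<bar>y\<bar>\<close> and tends to 0.\<close>

lemma has_derivative_max0_square:
  "((\<lambda>t::real. (max 0 t)\<^sup>2) has_real_derivative 2 * max 0 t) (at t)"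
proof -
  consider "t > 0" | "t < 0" | "t = 0" by linarith
  then show ?thesis
  proof cases
    case 1
    then have "((\<lambda>t::real. t\<^sup>2) has_real_derivative 2 * max 0 t) (at t)"
      by (auto intro!: derivative_eq_intros)
    then show ?thesis
      by (rule has_field_derivative_transform_within_open[where S = "{0<..}"]) (use 1 in auto)
  next
    case 2
    then have "((\<lambda>t::real. 0) has_real_derivative 2 * max 0 t) (at t)"
      by (auto intro!: derivative_eq_intros)
    then show ?thesis
      by (rule has_field_derivative_transform_within_open[where S = "{..<0}"]) (use 2 in auto)
  next
    case 3
    have "((\<lambda>y::real. (max 0 y)\<^sup>2 / y) \<longlongrightarrow> 0) (at 0)"
    proof (rule Lim_null_comparison)
      have "norm ((max 0 y)\<^sup>2 / y) \<le> \<bar>y\<bar>" for y :: real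
        by (simp add: max_def power2_eq_square)
      then show "\<forall>\<^sub>F y in at 0. norm ((max 0 y)\<^sup>2 / y) \<le> \<bar>y\<bar>"
        by (intro always_eventually) blast
      show "((\<lambda>y::real. \<bar>y\<bar>) \<longlongrightarrow> 0) (at 0)"
        by (intro tendsto_eq_intros) auto
    qed
    then show ?thesis
      using 3 by (simp add: has_field_derivative_iff)
  qed
qed

lemma C1_on_bump:
  fixes x0 :: "real^'n"
  shows "C1_on S (bump x0 r)"
proof (rule C1_onI)
  fix x :: "real^'n"
  have "((\<lambda>x. r\<^sup>2 - (x - x0) \<bullet> (x - x0)) has_derivative (\<lambda>y. - (2 * ((x - x0) \<bullet> y)))) (at x)"
    by (auto intro!: derivative_eq_intros simp: inner_commute)
  from has_derivative_compose[OF this has_derivative_max0_square[unfolded has_field_derivative_def]]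
  show "(bump x0 r has_derivative
      (\<lambda>y. 2 * max 0 (r\<^sup>2 - (x - x0) \<bullet> (x - x0)) * - (2 * ((x - x0) \<bullet> y)))) (at x)"
    by (simp add: bump_def[abs_def])
qed (intro continuous_intros)

lemma bump_nonneg: "0 \<le> bump x0 r x"
  by (simp add: bump_def)

lemma bump_pos_iff:
  assumes "0 < r"
  shows "0 < bump x0 r x \<longleftrightarrow> x \<in> ball x0 r"
proof -
  have "(x - x0) \<bullet> (x - x0) = (dist x0 x)\<^sup>2"
    by (simp add: dist_norm power2_norm_eq_inner[symmetric] norm_minus_commute)
  moreover have "(dist x0 x)\<^sup>2 < r\<^sup>2 \<longleftrightarrow> dist x0 x < r"
    using assms power_strict_mono[of _ r 2] power2_less_imp_less[of _ r] by auto
  ultimately show ?thesis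
    by (auto simp: bump_def max_def)
qed

section \<open>Passage of functions between charts and the manifold\<close>

context closed_mfd
begin

text \<open>Extension by zero from a chart to \<open>M\<close>. It preserves regularity when
  \<open>F\<close> vanishes off a compact subset of \<open>cimg c\<close>, the situation in which it
  is applied.\<close>

definition chart_fun :: "('m, 'n) chart \<Rightarrow> (real^'n \<Rightarrow> real) \<Rightarrow> 'm \<Rightarrow> real" where
  "chart_fun c F p = (if p \<in> cdom c then F (cmap c p) else 0)"

lemma cinv_image:
  assumes "c \<in> A" "U \<subseteq> cimg c"
  shows "cinv c ` U = {p \<in> cdom c. cmap c p \<in> U}"
proof (intro set_eqI iffI)
  fix p assume "p \<in> {p \<in> cdom c. cmap c p \<in> U}"
  then have "p = cinv c (cmap c p)" "cmap c p \<in> U"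
    using assms(1) by simp_all
  then show "p \<in> cinv c ` U" by (rule image_eqI)
qed (use assms in \<open>auto simp: subset_iff\<close>)

lemma compact_cinv_image:
  assumes "c \<in> A" "compact K" "K \<subseteq> cimg c"
  shows "compact (cinv c ` K)"
  using assms continuous_on_subset[OF continuous_on_cinv] by (intro compact_continuous_image) auto

lemma cinv_image_open:
  assumes "c \<in> A" "open U" "U \<subseteq> cimg c"
  shows "\<exists>W. open W \<and> cinv c ` U = M \<inter> W"
proof -
  have "openin (top_of_set (cdom c)) (cdom c \<inter> cmap c -` U)"
    using continuous_openin_preimage_gen[OF continuous_on_cmap[OF assms(1)] assms(2)] .
  moreover have "cdom c \<inter> cmap c -` U = cinv c ` U"
    using cinv_image[OF assms(1,3)] by auto
  ultimately have "openin (top_of_set M) (cinv c ` U)"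
    using chart(1)[OF assms(1)] openin_trans by metis
  then show ?thesis
    by (auto simp: openin_open)
qed

lemma vanishes_outside_chart_image:
  assumes "c \<in> A" "K \<subseteq> cimg c" "\<And>p. p \<in> M \<Longrightarrow> p \<notin> cinv c ` K \<Longrightarrow> f p = 0"
    and "x \<in> cimg c" "x \<notin> K"
  shows "f (cinv c x) = 0"
  using assms(4,5) chart(4)[OF assms(1)] cinv_image[OF assms(1,2)] assms(1)
  by (intro assms(3)) auto

lemma open_outside:
  assumes "d \<in> A" "closed L"
  shows "open {x \<in> cimg d. cinv d x \<notin> L}"
proof -
  have "{x \<in> cimg d. cinv d x \<notin> L} = cinv d -` (- L) \<inter> cimg d" by auto
  then show ?thesis
    using continuous_on_open_vimage[OF chart(2)[OF assms(1)], of "cinv d"] continuous_on_cinv[OF assms(1)]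
      assms(2) by (metis open_Compl)
qed

lemma continuous_on_M_locally:
  assumes "\<And>c. c \<in> A \<Longrightarrow> continuous_on (cimg c) (\<lambda>x. f (cinv c x))"
  shows "continuous_on M (f :: 'm \<Rightarrow> real)"
  unfolding continuous_on_eq_continuous_within
proof
  fix p assume "p \<in> M"
  then obtain c where c: "c \<in> A" "p \<in> cdom c"
    using chart_cover by blast
  obtain W where W: "open W" "cdom c = M \<inter> W"
    using cdom_open[OF c(1)] by blast
  have "continuous_on (cdom c) (\<lambda>q. f (cinv c (cmap c q)))"
    by (rule continuous_on_compose2[OF assms[OF c(1)] continuous_on_cmap[OF c(1)]]) auto
  then have "continuous_on (cdom c) f"
    using c(1) by (simp cong: continuous_on_cong)
  then have "continuous (at p within cdom c) f"
    using c by (simp add: continuous_on_eq_continuous_within)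
  moreover have "at p within cdom c = at p within M"
    using W c by (intro at_within_nhd[of p W]) auto
  ultimately show "continuous (at p within M) f" by simp
qed

lemma C1_fun_continuous: "C1_fun u \<Longrightarrow> continuous_on M u"
  using C1_on_imp_continuous_on unfolding C1_fun_def
  by (intro continuous_on_M_locally) (auto simp: o_def)

text \<open>A function supported in \<open>c\<close> is seen from another chart \<open>d\<close>
  through two open sets: the overlap, where it is \<open>F\<close> after the transition map, and the
  complement of the support, where it is zero. The second set is open because a compact set in a
  Hausdorff space is closed.\<close>

lemma chart_fun_overlap:
  assumes c: "c \<in> A" and d: "d \<in> A" and K: "compact K" "K \<subseteq> cimg c"
    and supp: "\<forall>x\<in>cimg c - K. F x = 0"
  defines "U1 \<equiv> cmap d ` (cdom d \<inter> cdom c)" and "U2 \<equiv> {x \<in> cimg d. cinv d x \<notin> cinv c ` K}"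
  shows "open U1" "open U2" "cimg d = U1 \<union> U2"
    "\<And>x. x \<in> U1 \<Longrightarrow> chart_fun c F (cinv d x) = F (cmap c (cinv d x))"
    "\<And>x. x \<in> U2 \<Longrightarrow> chart_fun c F (cinv d x) = 0"
    "(cmap c \<circ> cinv d) ` U1 \<subseteq> cimg c"
proof -
  show "open U1"
    unfolding U1_def by (rule open_overlap[OF d c])
  show "open U2"
    unfolding U2_def by (rule open_outside[OF d compact_imp_closed[OF compact_cinv_image[OF c K]]])
  have U1: "U1 = {x \<in> cimg d. cinv d x \<in> cdom d \<inter> cdom c}"
    unfolding U1_def by (rule cmap_image[OF d]) auto
  have "cinv c ` K \<subseteq> cdom c"
    using c K(2) by auto
  then show "cimg d = U1 \<union> U2"
    unfolding U1 U2_def using cinv_in[OF d] by blast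
  show "chart_fun c F (cinv d x) = F (cmap c (cinv d x))" if "x \<in> U1" for x
    using that U1 by (auto simp: chart_fun_def)
  show "chart_fun c F (cinv d x) = 0" if "x \<in> U2" for x
  proof (cases "cinv d x \<in> cdom c")
    case True
    then have "cmap c (cinv d x) \<notin> K"
      using that cinv_image[OF c K(2)] by (auto simp: U2_def)
    then show ?thesis
      using supp True by (simp add: chart_fun_def)
  qed (simp add: chart_fun_def)
  show "(cmap c \<circ> cinv d) ` U1 \<subseteq> cimg c"
    using U1 by auto
qed

lemma C1_fun_chart_fun:
  assumes c: "c \<in> A" and K: "compact K" "K \<subseteq> cimg c"
    and supp: "\<forall>x\<in>cimg c - K. F x = 0" and F: "C1_on (cimg c) F"
  shows "C1_fun (chart_fun c F)"
  unfolding C1_fun_def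
proof
  fix d assume d: "d \<in> A"
  note U = chart_fun_overlap[where F = F, OF c d K supp]
  let ?U1 = "cmap d ` (cdom d \<inter> cdom c)" and ?U2 = "{x \<in> cimg d. cinv d x \<notin> cinv c ` K}"
  have "C1_on ?U1 (\<lambda>x. chart_fun c F (cinv d x))"
    by (rule C1_on_cong[OF U(1) _ C1_on_compose[OF F transition_Ck[OF d c] U(6)]])
       (subst U(4), assumption, simp)
  moreover have "C1_on ?U2 (\<lambda>x. chart_fun c F (cinv d x))"
    by (rule C1_on_cong[OF U(2) U(5)[symmetric] C1_on_const])
  ultimately have "C1_on (\<Union>{?U1, ?U2}) (\<lambda>x. chart_fun c F (cinv d x))"
    using U(1,2) by (intro C1_on_Union) auto
  then show "C1_on (cimg d) (\<lambda>x. chart_fun c F (cinv d x))"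
    using U(3) by simp
qed

lemma continuous_on_chart_fun:
  assumes c: "c \<in> A" and K: "compact K" "K \<subseteq> cimg c"
    and supp: "\<forall>x\<in>cimg c - K. F x = 0" and F: "continuous_on (cimg c) F"
  shows "continuous_on M (chart_fun c F)"
proof (rule continuous_on_M_locally)
  fix d assume d: "d \<in> A"
  note U = chart_fun_overlap[where F = F, OF c d K supp]
  let ?U1 = "cmap d ` (cdom d \<inter> cdom c)" and ?U2 = "{x \<in> cimg d. cinv d x \<notin> cinv c ` K}"
  have "continuous_on ?U1 (\<lambda>x. F (cmap c (cinv d x)))"
    using transition_Ck[OF d c, of 0] U(6) by (intro continuous_on_compose2[OF F]) (auto simp: o_def)
  then have "continuous_on ?U1 (\<lambda>x. chart_fun c F (cinv d x))"
    by (rule continuous_on_eq) (rule U(4)[symmetric])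
  moreover have "continuous_on ?U2 (\<lambda>x. chart_fun c F (cinv d x))"
    by (rule continuous_on_eq[OF continuous_on_const U(5)[symmetric]])
  ultimately show "continuous_on (cimg d) (\<lambda>x. chart_fun c F (cinv d x))"
    by (subst U(3)) (rule continuous_on_open_Un[OF U(1,2)])
qed

lemma dvec_cong:
  assumes "c \<in> A" "p \<in> cdom c" "\<And>q. q \<in> M \<Longrightarrow> u q = v q"
  shows "dvec u c p = dvec v c p"
proof -
  have "pd i (\<lambda>x. u (cinv c x)) (cmap c p) = pd i (\<lambda>x. v (cinv c x)) (cmap c p)" for i
    using assms chart(2,4)[OF assms(1)]
    by (intro pd_cong_open[of "cimg c"]) (auto simp: subset_iff)
  then show ?thesis
    by (simp add: dvec_def partial_pd)
qed

lemma dvec_eq_0_outside: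
  assumes "d \<in> A" "p \<in> cdom d" "closed L" "p \<notin> L" "\<And>q. q \<in> M \<Longrightarrow> q \<notin> L \<Longrightarrow> u q = 0"
  shows "dvec u d p = 0"
proof -
  have "pd i (\<lambda>x. u (cinv d x)) (cmap d p) = pd i (\<lambda>_. 0) (cmap d p)" for i
  proof (rule pd_cong_open[OF open_outside[OF assms(1,3)]])
    show "cmap d p \<in> {x \<in> cimg d. cinv d x \<notin> L}"
      using assms by simp
    show "u (cinv d x) = 0" if "x \<in> {x \<in> cimg d. cinv d x \<notin> L}" for x
      using that assms(5)[of "cinv d x"] cinv_in[OF assms(1), of x] chart(4)[OF assms(1)] by auto
  qed
  then show ?thesis
    by (simp add: dvec_def partial_pd vec_eq_iff pd_const)
qed

lemma dvec_sum:
  assumes "\<And>k. k \<in> I \<Longrightarrow> C1_fun (u k)" "c \<in> A" "p \<in> cdom c"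
  shows "dvec (\<lambda>q. \<Sum>k\<in>I. u k q) c p = (\<Sum>k\<in>I. dvec (u k) c p)"
proof -
  have "pd i (\<lambda>x. \<Sum>k\<in>I. u k (cinv c x)) (cmap c p) = (\<Sum>k\<in>I. pd i (\<lambda>x. u k (cinv c x)) (cmap c p))" for i
    using assms by (intro pd_sum[of _ "cimg c"]) (auto simp: C1_fun_def)
  then show ?thesis
    by (simp add: dvec_def partial_pd vec_eq_iff o_def)
qed

lemma continuous_on_dvec:
  assumes "C1_fun u" "c \<in> A"
  shows "continuous_on (cimg c) (\<lambda>x. dvec u c (cinv c x) $ i)"
proof -
  have "continuous_on (cimg c) (pd i (\<lambda>x. u (cinv c x)))"
    using assms by (auto simp: C1_fun_def intro: C1_on_continuous_pd)
  then show ?thesis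
    using assms(2) by (simp add: dvec_def partial_pd cong: continuous_on_cong)
qed

lemma C1_fun_mult: "C1_fun u \<Longrightarrow> C1_fun v \<Longrightarrow> C1_fun (\<lambda>p. u p * v p)"
  unfolding C1_fun_def by (auto intro!: C1_on_mult)

lemma C1_fun_sum: "(\<And>k. k \<in> I \<Longrightarrow> C1_fun (u k)) \<Longrightarrow> C1_fun (\<lambda>p. \<Sum>k\<in>I. u k p)"
  by (auto simp: C1_fun_def o_def intro!: C1_on_sum)

lemma C1_fun_divide:
  assumes "C1_fun u" "C1_fun v" "\<And>p. p \<in> M \<Longrightarrow> v p \<noteq> 0"
  shows "C1_fun (\<lambda>p. u p / v p)"
proof -
  have "C1_on (cimg c) (\<lambda>x. u (cinv c x) / v (cinv c x))" if c: "c \<in> A" for c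
  proof (rule C1_on_divide)
    show "v (cinv c x) \<noteq> 0" if "x \<in> cimg c" for x
      using assms(3)[of "cinv c x"] cinv_in[OF c that] chart(4)[OF c] by auto
  qed (use assms c in \<open>auto simp: C1_fun_def\<close>)
  then show ?thesis
    by (simp add: C1_fun_def o_def)
qed

section \<open>Partition of unity\<close>

lemma finite_ball_cover:
  "\<exists>(N::nat) cs x r. (\<forall>k<N. cs k \<in> A \<and> 0 < r k \<and> cball (x k) (r k) \<subseteq> cimg (cs k)) \<and>
     M = (\<Union>k<N. cinv (cs k) ` ball (x k) (r k))"
proof -
  \<comment> \<open>Triples of a chart, a centre and a radius. The open balls provide the cover; the
    closed balls, still inside the chart images, will be the compact supports.\<close>
  let ?P = "\<lambda>(c, x, r). c \<in> A \<and> 0 < r \<and> cball x r \<subseteq> cimg c"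
  let ?B = "\<lambda>(c, x, r). cinv c ` ball x r"
  have "\<forall>t\<in>Collect ?P. \<exists>W. open W \<and> ?B t = M \<inter> W"
  proof
    fix t assume "t \<in> Collect ?P"
    then obtain c x r where "t = (c, x, r)" "c \<in> A" "cball x r \<subseteq> cimg c"
      by (cases t) auto
    then show "\<exists>W. open W \<and> ?B t = M \<inter> W"
      using cinv_image_open[of c "ball x r"] subset_trans[OF ball_subset_cball, of x r "cimg c"] by simp
  qed
  from bchoice[OF this] obtain W where W: "\<forall>t\<in>Collect ?P. open (W t) \<and> ?B t = M \<inter> W t"
    by (rule exE)
  have cov: "M \<subseteq> (\<Union>t\<in>Collect ?P. W t)"
  proof
    fix p assume "p \<in> M"
    then obtain c where c: "c \<in> A" "p \<in> cdom c" using chart_cover by blast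
    then obtain r where r: "0 < r" "cball (cmap c p) r \<subseteq> cimg c"
      using chart(2)[OF c(1)] cmap_in open_contains_cball by metis
    have "p \<in> ?B (c, cmap c p, r)"
      using c r by (auto intro!: image_eqI[of _ _ "cmap c p"])
    moreover have "(c, cmap c p, r) \<in> Collect ?P"
      using c r by simp
    ultimately show "p \<in> (\<Union>t\<in>Collect ?P. W t)"
      using W by blast
  qed
  have opn: "open (W t)" if "t \<in> Collect ?P" for t
    using W that by blast
  obtain T where T: "T \<subseteq> Collect ?P" "finite T" "M \<subseteq> (\<Union>t\<in>T. W t)"
    by (rule compactE_image[OF compact_M opn cov])
  obtain e where e: "bij_betw e {..<card T} T"
    using T(2) ex_bij_betw_nat_finite by (metis atLeast0LessThan)
  have eT: "e ` {..<card T} = T"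
    using e by (rule bij_betw_imp_surj_on)
  have P: "?P (e k)" if "k < card T" for k
  proof -
    have "e k \<in> T" using eT that by blast
    then show ?thesis by (rule CollectD[OF subsetD[OF T(1)]])
  qed
  have "M = (\<Union>k<card T. ?B (e k))"
  proof -
    have "(\<Union>k<card T. ?B (e k)) = (\<Union>t\<in>e ` {..<card T}. ?B t)"
      by (simp only: image_image)
    also have "\<dots> = (\<Union>t\<in>T. ?B t)"
      by (simp only: eT)
    also have "\<dots> = (\<Union>t\<in>T. M \<inter> W t)"
      by (intro SUP_cong refl conjunct2[OF bspec[OF W subsetD[OF T(1)]]])
    also have "\<dots> = M"
      using T(3) by blast
    finally show ?thesis by simp
  qed
  then show ?thesis
    using P
    by (intro exI[of _ "card T"] exI[of _ "fst \<circ> e"] exI[of _ "fst \<circ> snd \<circ> e"] exI[of _ "snd \<circ> snd \<circ> e"])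
       (simp add: case_prod_beta)
qed

text \<open>Each member carries a chart and a compact coordinate set containing its support: the
  data needed to turn integrals over \<open>M\<close> into Lebesgue integrals over chart images. No
  metric enters.\<close>

definition partition :: "nat \<Rightarrow> (nat \<Rightarrow> ('m, 'n) chart) \<Rightarrow> (nat \<Rightarrow> (real^'n) set) \<Rightarrow> (nat \<Rightarrow> 'm \<Rightarrow> real) \<Rightarrow> bool"
  where "partition N cs K \<rho> \<longleftrightarrow>
    (\<forall>k<N. cs k \<in> A \<and> compact (K k) \<and> K k \<subseteq> cimg (cs k) \<and> C1_fun (\<rho> k) \<and>
       (\<forall>p\<in>M. p \<notin> cinv (cs k) ` K k \<longrightarrow> \<rho> k p = 0)) \<and>
     (\<forall>p\<in>M. (\<Sum>k<N. \<rho> k p) = 1)"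

text \<open>Bumps on the covering balls are divided by their sum, which is positive on
  \<open>M\<close> because every point lies in one of the open balls.\<close>

lemma partition_of_unity: "\<exists>N cs K \<rho>. partition N cs K \<rho>"
proof -
  obtain N :: nat and cs x r where
    *: "\<forall>k<N. cs k \<in> A \<and> 0 < r k \<and> cball (x k) (r k) \<subseteq> cimg (cs k)" and
    M: "M = (\<Union>k<N. cinv (cs k) ` ball (x k) (r k))"
    using finite_ball_cover by blast
  define b where "b k = chart_fun (cs k) (bump (x k) (r k))" for k
  have zero: "bump (x k) (r k) y = 0" if "k < N" "y \<notin> cball (x k) (r k)" for k y
    using * that bump_pos_iff[of "r k" "x k" y] bump_nonneg[of "x k" "r k" y] by force
  have bC1: "C1_fun (b k)" if "k < N" for k
    unfolding b_def using * that zero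
    by (intro C1_fun_chart_fun[where K = "cball (x k) (r k)"] C1_on_bump) auto
  have nn: "0 \<le> b k p" for k p
    by (simp add: b_def chart_fun_def bump_nonneg)
  have pos: "0 < (\<Sum>k<N. b k p)" if p: "p \<in> M" for p
  proof -
    obtain k where k: "k < N" "p \<in> cinv (cs k) ` ball (x k) (r k)"
      using p M by blast
    have "ball (x k) (r k) \<subseteq> cimg (cs k)"
      using * k(1) ball_subset_cball by (metis subset_trans)
    then have "p \<in> cdom (cs k)" "cmap (cs k) p \<in> ball (x k) (r k)"
      using k cinv_image[of "cs k" "ball (x k) (r k)"] * by auto
    then have "0 < b k p"
      using * k(1) bump_pos_iff[of "r k" "x k" "cmap (cs k) p"] by (simp add: b_def chart_fun_def)
    then show ?thesis
      using k(1) nn by (intro sum_pos2[of _ k]) auto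
  qed
  define \<rho> where "\<rho> k p = b k p / (\<Sum>j<N. b j p)" for k p
  have C1: "C1_fun (\<rho> k)" if "k < N" for k
    unfolding \<rho>_def using bC1 that pos
    by (intro C1_fun_divide C1_fun_sum) (auto simp: less_imp_neq[symmetric])
  have supp: "\<rho> k p = 0" if k: "k < N" and p: "p \<notin> cinv (cs k) ` cball (x k) (r k)" for k p
  proof -
    have "cmap (cs k) p \<notin> cball (x k) (r k)" if "p \<in> cdom (cs k)"
      using * k p that cinv_image[of "cs k" "cball (x k) (r k)"] by auto
    then show ?thesis
      using zero[OF k] by (simp add: \<rho>_def b_def chart_fun_def)
  qed
  have "(\<Sum>k<N. \<rho> k p) = 1" if "p \<in> M" for p
    using pos[OF that] by (simp add: \<rho>_def sum_divide_distrib[symmetric])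
  then show ?thesis
    unfolding partition_def using * C1 supp
    by (intro exI[of _ N] exI[of _ cs] exI[of _ "\<lambda>k. cball (x k) (r k)"] exI[of _ \<rho>]) auto
qed

end

subsection \<open>Chart independence of scalars\<close>

text \<open>Applying \<open>J^T G\<close> to the left side gives \<open>J^T w\<close>, by the
  definition of the inverse of \<open>J^T G J\<close>; then \<open>J^T\<close> and \<open>G\<close>
  are cancelled. With \<open>G\<close> the metric and \<open>w\<close> a differential, this is the
  transformation law of gradients.\<close>

lemma matrix_congruence_inverse:
  fixes G J :: "real^'n^'n"
  assumes "det G \<noteq> 0" "det J \<noteq> 0"
  shows "J *v (matrix_inv (transpose J ** G ** J) *v (transpose J *v w)) = matrix_inv G *v w"
proof -
  let ?G = "transpose J ** G ** J"
  let ?X = "matrix_inv ?G *v (transpose J *v w)"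
  have nz: "det ?G \<noteq> 0" "det (transpose J) \<noteq> 0"
    using assms by (auto simp: det_mul)
  have "transpose J *v (G *v (J *v ?X)) = ?G *v ?X"
    by (simp only: matrix_vector_mul_assoc matrix_mul_assoc)
  also have "\<dots> = transpose J *v w"
    using matrix_inv_mult(1)[OF nz(1)] by (simp add: matrix_vector_mul_assoc matrix_mul_assoc)
  finally have "matrix_inv (transpose J) *v (transpose J *v (G *v (J *v ?X))) =
      matrix_inv (transpose J) *v (transpose J *v w)" by (rule arg_cong)
  then have "G *v (J *v ?X) = w"
    unfolding matrix_vector_mul_assoc matrix_mul_assoc matrix_inv_mult(2)[OF nz(2)] matrix_mul_lid
    by simp
  then have "matrix_inv G *v (G *v (J *v ?X)) = matrix_inv G *v w" by (rule arg_cong)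
  then show ?thesis
    unfolding matrix_vector_mul_assoc[of "matrix_inv G"] matrix_inv_mult(2)[OF assms(1)] by simp
qed

lemma inner_transpose_mult: "x \<bullet> (transpose A *v y) = (A *v x) \<bullet> y" for A :: "real^'n^'m"
  by (metis dot_lmul_matrix inner_commute transpose_matrix_vector)

lemma matrix_inv_congruence:
  fixes G J :: "real^'n^'n"
  assumes "det G \<noteq> 0" "det J \<noteq> 0"
  shows "matrix_inv (transpose J ** G ** J) = matrix_inv J ** matrix_inv G ** matrix_inv (transpose J)"
proof (rule matrix_inv_unique)
  have nz: "det (transpose J) \<noteq> 0" using assms by simp
  have "transpose J ** G ** J ** (matrix_inv J ** matrix_inv G ** matrix_inv (transpose J)) =
      transpose J ** (G ** (J ** matrix_inv J) ** matrix_inv G) ** matrix_inv (transpose J)"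
    by (simp add: matrix_mul_assoc)
  then show "transpose J ** G ** J ** (matrix_inv J ** matrix_inv G ** matrix_inv (transpose J)) = mat 1"
    by (simp only: matrix_inv_mult(1)[OF assms(2)] matrix_inv_mult(1)[OF assms(1)] matrix_mul_rid
        matrix_inv_mult(1)[OF nz])
qed

text \<open>The inverse congruence cancels \<open>J^T\<close> in the middle, and cyclicity of the
  trace brings \<open>J\<close> and its inverse together.\<close>

lemma trace_congruence:
  fixes G J h :: "real^'n^'n"
  assumes "det G \<noteq> 0" "det J \<noteq> 0"
  shows "trace (matrix_inv (transpose J ** G ** J) ** (transpose J ** h ** J)) = trace (matrix_inv G ** h)"
proof -
  have nz: "det (transpose J) \<noteq> 0" using assms by simp
  have "matrix_inv (transpose J ** G ** J) ** (transpose J ** h ** J) =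
      matrix_inv J ** (matrix_inv G ** (matrix_inv (transpose J) ** transpose J) ** h ** J)"
    unfolding matrix_inv_congruence[OF assms] by (simp add: matrix_mul_assoc)
  also have "\<dots> = matrix_inv J ** (matrix_inv G ** h ** J)"
    by (simp only: matrix_inv_mult(2)[OF nz] matrix_mul_rid)
  finally have "trace (matrix_inv (transpose J ** G ** J) ** (transpose J ** h ** J)) =
      trace (matrix_inv G ** h ** J ** matrix_inv J)"
    by (simp add: trace_mul_sym[of "matrix_inv J"])
  also have "matrix_inv G ** h ** J ** matrix_inv J = matrix_inv G ** h ** (J ** matrix_inv J)"
    by (simp add: matrix_mul_assoc)
  finally show ?thesis
    by (simp add: matrix_inv_mult(1)[OF assms(2)])
qed

text \<open>Bilinear forms as one sum over index pairs, the shape required by the finite index set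
  \<open>J\<close> of \<open>tendsto_integral_family_quotient\<close>.\<close>

lemma sum_matrix_inner:
  fixes B :: "real^'n^'n"
  shows "(\<Sum>(i, j)\<in>UNIV \<times> UNIV. B $ i $ j * (a $ j * b $ i)) = (B *v a) \<bullet> b"
  by (subst sum.cartesian_product[symmetric])
     (simp add: inner_vec_def matrix_vector_mult_def sum_distrib_right mult.assoc)

context riem_mfd
begin

lemma grad_dvec: "grad g u c p = matrix_inv (g c p) *v dvec u c p"
  by (simp add: grad_def dvec_def)

lemma grad_transform:
  assumes "C1_fun u" "c \<in> A" "d \<in> A" "p \<in> cdom c" "p \<in> cdom d"
  shows "transition_jacobian c d p *v grad g u d p = grad g u c p"
  unfolding grad_dvec dvec_transform[OF assms] metric_transform[OF assms(2-)]
  using matrix_congruence_inverse[OF det_metric_nz[OF assms(2,4)] transition_jacobian_nz[OF assms(2-)]] .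

text \<open>The function \<open>g(grad u, grad v)\<close>, written as the vector
  \<open>grad u\<close> paired with the covector \<open>dv\<close>. In this form chart independence
  is just the duality of \<open>J\<close> and its transpose.\<close>

definition ip :: "('m \<Rightarrow> real) \<Rightarrow> ('m \<Rightarrow> real) \<Rightarrow> 'm \<Rightarrow> real" where
  "ip u v p = grad g u (chart_at A p) p \<bullet> dvec v (chart_at A p) p"

lemma ip_chart:
  assumes "C1_fun u" "C1_fun v" "c \<in> A" "p \<in> cdom c"
  shows "ip u v p = grad g u c p \<bullet> dvec v c p"
proof -
  let ?d = "chart_at A p"
  have d: "?d \<in> A" "p \<in> cdom ?d"
    using chart_at assms(3,4) chart(4) by blast+
  show ?thesis
    unfolding ip_def dvec_transform[OF assms(2,3) d(1) assms(4) d(2)] inner_transpose_mult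
      grad_transform[OF assms(1,3) d(1) assms(4) d(2)] ..
qed

lemma metric_mult_grad:
  assumes "c \<in> A" "p \<in> cdom c"
  shows "g c p *v grad g u c p = dvec u c p"
  using matrix_inv_mult(1)[OF det_metric_nz[OF assms]]
  by (simp add: grad_dvec matrix_vector_mul_assoc)

lemma matrix_inv_metric_transpose:
  assumes "c \<in> A" "p \<in> cdom c"
  shows "transpose (matrix_inv (g c p)) = matrix_inv (g c p)"
  using matrix_inv_symmetric[OF det_metric_nz[OF assms] metric_transpose[OF assms]] .

lemma ip_commute:
  assumes "p \<in> M"
  shows "ip u v p = ip v u p"
proof -
  let ?c = "chart_at A p"
  have c: "?c \<in> A" "p \<in> cdom ?c" using chart_at[OF assms] by auto
  have "dvec u ?c p \<bullet> grad g v ?c p = dvec u ?c p \<bullet> (transpose (matrix_inv (g ?c p)) *v dvec v ?c p)"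
    unfolding matrix_inv_metric_transpose[OF c] grad_dvec ..
  also have "\<dots> = grad g u ?c p \<bullet> dvec v ?c p"
    unfolding inner_transpose_mult grad_dvec ..
  finally show ?thesis
    by (simp add: ip_def inner_commute)
qed

lemma grad_norm_square:
  assumes "p \<in> M"
  shows "(grad_norm A g u p)\<^sup>2 = ip u u p"
proof -
  let ?c = "chart_at A p" and ?X = "grad g u (chart_at A p) p"
  have c: "?c \<in> A" "p \<in> cdom ?c" using chart_at[OF assms] by auto
  have "0 \<le> ?X \<bullet> (g ?c p *v ?X)"
    using metric_pos[OF c, of ?X] by (cases "?X = 0") auto
  then show ?thesis
    by (simp add: grad_norm_def ip_def Let_def metric_mult_grad[OF c])
qed

text \<open>Symmetry of \<open>h\<close> turns the contraction of the definition into the trace of a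
  matrix product, which is invariant under congruence.\<close>

lemma metric_trace_chart:
  assumes h: "symmetric_tensor02 A h" and "c \<in> A" "p \<in> cdom c"
  shows "metric_trace A g h p = trace (matrix_inv (g c p) ** h c p)"
proof -
  let ?d = "chart_at A p"
  have d: "?d \<in> A" "p \<in> cdom ?d"
    using chart_at assms(2,3) chart(4) by blast+
  have sym: "transpose (h ?d p) = h ?d p"
    using h d unfolding symmetric_tensor02_def by blast
  have "h ?d p $ j $ i = h ?d p $ i $ j" for i j
    using arg_cong[OF sym, of "\<lambda>B. B $ i $ j"] by (simp add: transpose_def)
  then have "metric_trace A g h p = trace (matrix_inv (g ?d p) ** h ?d p)"
    by (simp add: metric_trace_def Let_def trace_def matrix_matrix_mult_def)
  also have "h ?d p = transpose (transition_jacobian c ?d p) ** h c p ** transition_jacobian c ?d p"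
    using h d assms(2,3) unfolding symmetric_tensor02_def by blast
  finally show ?thesis
    unfolding metric_transform[OF assms(2) d(1) assms(3) d(2)]
      trace_congruence[OF det_metric_nz[OF assms(2,3)] transition_jacobian_nz[OF assms(2) d(1) assms(3) d(2)]] .
qed

text \<open>Each raised index meets one factor \<open>du\<close> and makes it a gradient, so the
  pairing is \<open>h(grad u, grad u)\<close>. The transformation laws of \<open>h\<close> and of
  gradients then cancel.\<close>

lemma tensor_pairing_chart:
  assumes h: "symmetric_tensor02 A h" and u: "C1_fun u" and "c \<in> A" "p \<in> cdom c"
  shows "tensor_pairing A g h u p = grad g u c p \<bullet> (h c p *v grad g u c p)"
proof -
  let ?d = "chart_at A p" and ?J = "transition_jacobian c (chart_at A p) p"
  let ?B = "matrix_inv (g ?d p)" and ?w = "dvec u ?d p"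
  have d: "?d \<in> A" "p \<in> cdom ?d"
    using chart_at assms(3,4) chart(4) by blast+
  have sym: "?B $ i $ j = ?B $ j $ i" for i j
    using arg_cong[OF matrix_inv_metric_transpose[OF d], of "\<lambda>B. B $ j $ i"] by (simp add: transpose_def)
  have raise: "raise_indices g h ?d p = ?B ** h ?d p ** ?B"
    unfolding vec_eq_iff
  proof (intro allI)
    fix i j
    have "raise_indices g h ?d p $ i $ j = (\<Sum>l\<in>UNIV. \<Sum>k\<in>UNIV. ?B $ i $ k * ?B $ j $ l * h ?d p $ k $ l)"
      unfolding raise_indices_def by (simp, rule sum.swap)
    then show "raise_indices g h ?d p $ i $ j = (?B ** h ?d p ** ?B) $ i $ j"
      by (simp add: matrix_matrix_mult_def sum_distrib_left sum_distrib_right sym[of _ j] mult_ac)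
  qed
  have "tensor_pairing A g h u p = (\<Sum>i\<in>UNIV. \<Sum>j\<in>UNIV. (?B ** h ?d p ** ?B) $ i $ j * (?w $ j * ?w $ i))"
    unfolding tensor_pairing_def Let_def raise by (simp add: dvec_def mult_ac)
  also have "\<dots> = ((?B ** h ?d p ** ?B) *v ?w) \<bullet> ?w"
    unfolding sum_matrix_inner[symmetric] sum.cartesian_product ..
  also have "\<dots> = (transpose ?B *v (h ?d p *v grad g u ?d p)) \<bullet> ?w"
    unfolding matrix_inv_metric_transpose[OF d] grad_dvec
    by (simp add: matrix_vector_mul_assoc matrix_mul_assoc)
  also have "\<dots> = grad g u ?d p \<bullet> (h ?d p *v grad g u ?d p)"
    by (subst inner_commute) (simp only: inner_transpose_mult grad_dvec)
  also have "h ?d p = transpose ?J ** h c p ** ?J"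
    using h d assms(3,4) unfolding symmetric_tensor02_def by blast
  also have "grad g u ?d p \<bullet> ((transpose ?J ** h c p ** ?J) *v grad g u ?d p) =
      grad g u ?d p \<bullet> (transpose ?J *v (h c p *v (?J *v grad g u ?d p)))"
    by (simp only: matrix_vector_mul_assoc matrix_mul_assoc)
  also have "\<dots> = grad g u c p \<bullet> (h c p *v grad g u c p)"
    unfolding inner_transpose_mult grad_transform[OF u assms(3) d(1) assms(4) d(2)] ..
  finally show ?thesis .
qed

subsection \<open>Green's formula\<close>

lemma continuous_on_chart:
  assumes "continuous_on M (f :: 'm \<Rightarrow> real)" "c \<in> A"
  shows "continuous_on (cimg c) (\<lambda>x. f (cinv c x))"
  using assms(2) chart(4)[OF assms(2)]
  by (intro continuous_on_compose2[OF assms(1) continuous_on_cinv]) auto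

lemma measurable_vol_continuous: "continuous_on M (f :: 'm \<Rightarrow> real) \<Longrightarrow> f \<in> borel_measurable vol"
  using borel_measurable_continuous_on_restrict[of M f] measurable_cong_sets[OF sets_vol refl] by blast

lemma
  fixes f :: "'m \<Rightarrow> real"
  assumes c: "c \<in> A" and K: "compact K" "K \<subseteq> cimg c" and f: "continuous_on M f"
    and supp: "\<And>p. p \<in> M \<Longrightarrow> p \<notin> cinv c ` K \<Longrightarrow> f p = 0"
  shows integrable_chart_supported: "integrable vol f"
    and integrable_chart_supported': "integrable lborel
      (\<lambda>x. indicator (cimg c) x * (vol_density g c (cinv c x) * f (cinv c x)))"
    and integral_chart_supported: "integral\<^sup>L vol f = integral\<^sup>L lborel
      (\<lambda>x. indicator (cimg c) x * (vol_density g c (cinv c x) * f (cinv c x)))"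
proof -
  have sub: "cinv c ` K \<subseteq> cdom c"
    using c K(2) by auto
  have f0: "f p = 0" if "p \<in> M" "p \<notin> cdom c" for p
    using supp that sub by blast
  have "f (cinv c x) = 0" if "x \<in> cimg c" "x \<notin> K" for x
    by (rule vanishes_outside_chart_image[OF c K(2) supp that])
  then show i: "integrable lborel
      (\<lambda>x. indicator (cimg c) x * (vol_density g c (cinv c x) * f (cinv c x)))"
    by (intro integrable_compact_support[OF K] continuous_intros continuous_on_chart[OF f c]
        C1_on_imp_continuous_on[OF vol_density_C1[OF c]]) auto
  then show "integrable vol f"
    using integrable_chart[OF c measurable_vol_continuous[OF f] f0] by (simp add: mult.assoc)
  show "integral\<^sup>L vol f = integral\<^sup>L lborel
      (\<lambda>x. indicator (cimg c) x * (vol_density g c (cinv c x) * f (cinv c x)))"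
    using integral_chart[OF c measurable_vol_continuous[OF f] f0] by (simp add: mult.assoc)
qed

text \<open>A partition of unity splits \<open>f\<close> into finitely many continuous pieces, each
  with compact support in one chart.\<close>

lemma integrable_continuous:
  assumes f: "continuous_on M (f :: 'm \<Rightarrow> real)"
  shows "integrable vol f"
proof -
  obtain N cs K \<rho> where P: "partition N cs K \<rho>"
    using partition_of_unity by blast
  note * = conjunct1[OF P[unfolded partition_def]] and one = conjunct2[OF P[unfolded partition_def]]
  have "integrable vol (\<lambda>p. \<rho> k p * f p)" if "k < N" for k
    using * that C1_fun_continuous
    by (intro integrable_chart_supported[of "cs k" "K k"] continuous_intros f) auto
  then have "integrable vol (\<lambda>p. \<Sum>k<N. \<rho> k p * f p)"
    by (intro Bochner_Integration.integrable_sum) auto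
  moreover have "(\<Sum>k<N. \<rho> k p * f p) = f p" if "p \<in> space vol" for p
    using one that by (simp add: sum_distrib_right[symmetric] space_vol)
  ultimately show ?thesis
    by (simp cong: Bochner_Integration.integrable_cong)
qed

text \<open>The form in which integrals are differentiated in time: \<open>N\<close>,
  \<open>cs\<close>, \<open>K\<close> and \<open>\<rho>\<close> do not depend on \<open>g\<close>,
  so the changing measure becomes a changing density against a fixed one.\<close>

lemma integral_partition:
  fixes f :: "'m \<Rightarrow> real"
  assumes P: "partition N cs K \<rho>" and f: "continuous_on M f"
  shows "integral\<^sup>L vol f = (\<Sum>k<N. integral\<^sup>L lborel (\<lambda>x. indicator (cimg (cs k)) x *
      (\<rho> k (cinv (cs k) x) * (vol_density g (cs k) (cinv (cs k) x) * f (cinv (cs k) x)))))"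
proof -
  note * = conjunct1[OF P[unfolded partition_def]] and one = conjunct2[OF P[unfolded partition_def]]
  have cont: "continuous_on M (\<lambda>p. \<rho> k p * f p)" if "k < N" for k
    using * that by (intro continuous_intros C1_fun_continuous f) auto
  have "integral\<^sup>L vol f = integral\<^sup>L vol (\<lambda>p. \<Sum>k<N. \<rho> k p * f p)"
    using one by (intro LINT_cong) (auto simp: space_vol sum_distrib_right[symmetric])
  also have "\<dots> = (\<Sum>k<N. integral\<^sup>L vol (\<lambda>p. \<rho> k p * f p))"
    using cont by (intro Bochner_Integration.integral_sum integrable_continuous) auto
  also have "\<dots> = (\<Sum>k<N. integral\<^sup>L lborel (\<lambda>x. indicator (cimg (cs k)) x *
      (\<rho> k (cinv (cs k) x) * (vol_density g (cs k) (cinv (cs k) x) * f (cinv (cs k) x)))))"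
  proof (intro sum.cong refl)
    fix k assume "k \<in> {..<N}"
    then have k: "k < N" by simp
    have "integral\<^sup>L vol (\<lambda>p. \<rho> k p * f p) = integral\<^sup>L lborel (\<lambda>x. indicator (cimg (cs k)) x *
      (vol_density g (cs k) (cinv (cs k) x) * (\<rho> k (cinv (cs k) x) * f (cinv (cs k) x))))"
      using * k by (intro integral_chart_supported[of "cs k" "K k"] cont) auto
    then show "integral\<^sup>L vol (\<lambda>p. \<rho> k p * f p) = integral\<^sup>L lborel (\<lambda>x. indicator (cimg (cs k)) x *
      (\<rho> k (cinv (cs k) x) * (vol_density g (cs k) (cinv (cs k) x) * f (cinv (cs k) x))))"
      by (simp add: mult.left_commute)
  qed
  finally show ?thesis .
qed

lemma C1_on_grad:
  assumes "smooth_fun A u" "c \<in> A"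
  shows "C1_on (cimg c) (\<lambda>x. grad g u c (cinv c x) $ i)"
proof -
  have sm: "smooth_on (cimg c) (\<lambda>x. u (cinv c x))"
    using assms by (auto simp: smooth_fun_def o_def)
  have "C1_on (cimg c) (\<lambda>x. dvec u c (cinv c x) $ j)" for j
    by (rule C1_on_cong[OF chart(2)[OF assms(2)] _ smooth_on_imp_C1_on(2)[OF chart(2)[OF assms(2)] sm, of j]])
       (simp add: dvec_def partial_pd assms(2))
  then show ?thesis
    unfolding grad_dvec matrix_vector_mult_def
    by (simp, intro C1_on_sum C1_on_mult metric_inv_C1[OF assms(2)])
qed

lemma continuous_on_grad:
  assumes "C1_fun u" "c \<in> A"
  shows "continuous_on (cimg c) (\<lambda>x. grad g u c (cinv c x) $ i)"
  unfolding grad_dvec matrix_vector_mult_def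
  by (simp, intro continuous_intros continuous_on_dvec[OF assms]
      C1_on_imp_continuous_on[OF metric_inv_C1[OF assms(2)]])

lemma continuous_on_ip:
  assumes "C1_fun u" "C1_fun v"
  shows "continuous_on M (ip u v)"
proof (rule continuous_on_M_locally)
  fix c assume c: "c \<in> A"
  have "continuous_on (cimg c) (\<lambda>x. \<Sum>i\<in>UNIV. grad g u c (cinv c x) $ i * dvec v c (cinv c x) $ i)"
    by (intro continuous_intros continuous_on_grad continuous_on_dvec assms c)
  moreover have "ip u v (cinv c x) = (\<Sum>i\<in>UNIV. grad g u c (cinv c x) $ i * dvec v c (cinv c x) $ i)"
    if "x \<in> cimg c" for x
    using ip_chart[OF assms c cinv_in[OF c that]] by (simp add: inner_vec_def)
  ultimately show "continuous_on (cimg c) (\<lambda>x. ip u v (cinv c x))"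
    by (simp cong: continuous_on_cong)
qed

lemma continuous_on_metric_trace:
  assumes h: "symmetric_tensor02 A h" and hc: "\<And>c. c \<in> A \<Longrightarrow> continuous_on (cimg c) (\<lambda>x. h c (cinv c x))"
  shows "continuous_on M (metric_trace A g h)"
proof (rule continuous_on_M_locally)
  fix c assume c: "c \<in> A"
  have "continuous_on (cimg c) (\<lambda>x. trace (matrix_inv (g c (cinv c x)) ** h c (cinv c x)))"
    unfolding trace_def matrix_matrix_mult_def
    by (simp, intro continuous_intros hc c C1_on_imp_continuous_on[OF metric_inv_C1])
  then show "continuous_on (cimg c) (\<lambda>x. metric_trace A g h (cinv c x))"
    using metric_trace_chart[OF h c cinv_in[OF c]] by (simp cong: continuous_on_cong)
qed

lemma continuous_on_tensor_pairing:
  assumes h: "symmetric_tensor02 A h" and hc: "\<And>c. c \<in> A \<Longrightarrow> continuous_on (cimg c) (\<lambda>x. h c (cinv c x))"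
    and u: "C1_fun u"
  shows "continuous_on M (tensor_pairing A g h u)"
proof (rule continuous_on_M_locally)
  fix c assume c: "c \<in> A"
  have "continuous_on (cimg c) (\<lambda>x. grad g u c (cinv c x) \<bullet> (h c (cinv c x) *v grad g u c (cinv c x)))"
    unfolding matrix_vector_mult_def inner_vec_def
    by (simp, intro continuous_intros hc c continuous_on_grad u)
  then show "continuous_on (cimg c) (\<lambda>x. tensor_pairing A g h u (cinv c x))"
    using tensor_pairing_chart[OF h u c cinv_in[OF c]] by (simp cong: continuous_on_cong)
qed

text \<open>The Laplacian computed in a prescribed chart. The chart used by \<open>laplacian\<close>
  may jump from point to point, so continuity and integration by parts are accessible only for this
  version, until \<open>laplacian_chart\<close> identifies the two.\<close>

definition lap :: "('m \<Rightarrow> real) \<Rightarrow> ('m, 'n) chart \<Rightarrow> 'm \<Rightarrow> real" where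
  "lap u c p = (\<Sum>i\<in>UNIV. partial c i (\<lambda>q. vol_density g c q * grad g u c q $ i) p) / vol_density g c p"

lemma lap_cinv:
  assumes "c \<in> A" "x \<in> cimg c"
  shows "vol_density g c (cinv c x) * lap u c (cinv c x) =
    (\<Sum>i\<in>UNIV. pd i (\<lambda>x. vol_density g c (cinv c x) * grad g u c (cinv c x) $ i) x)"
  using vol_density_pos[OF assms(1) cinv_in[OF assms]] assms
  by (simp add: lap_def partial_pd)

lemma continuous_on_lap:
  assumes "smooth_fun A u" "c \<in> A"
  shows "continuous_on (cimg c) (\<lambda>x. lap u c (cinv c x))"
proof -
  have "continuous_on (cimg c) (\<lambda>x.
      (\<Sum>i\<in>UNIV. pd i (\<lambda>x. vol_density g c (cinv c x) * grad g u c (cinv c x) $ i) x) /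
      vol_density g c (cinv c x))"
    using vol_density_pos[OF assms(2) cinv_in[OF assms(2)]]
    by (intro continuous_intros C1_on_continuous_pd C1_on_mult vol_density_C1 C1_on_grad assms
        C1_on_imp_continuous_on[OF vol_density_C1]) (metis less_irrefl)
  moreover have "lap u c (cinv c x) =
      (\<Sum>i\<in>UNIV. pd i (\<lambda>x. vol_density g c (cinv c x) * grad g u c (cinv c x) $ i) x) /
      vol_density g c (cinv c x)" if "x \<in> cimg c" for x
    using assms that by (simp add: lap_def partial_pd)
  ultimately show ?thesis
    by (simp cong: continuous_on_cong)
qed

text \<open>The volume density cancels the denominator of \<open>lap\<close>, leaving
  \<open>f\<close> times a plain sum of partial derivatives, and integration by parts applies to
  each coordinate. The compact support of \<open>f\<close> removes boundary terms.\<close>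

lemma
  assumes c: "c \<in> A" and K: "compact K" "K \<subseteq> cimg c" and f: "C1_fun f"
    and supp: "\<And>p. p \<in> M \<Longrightarrow> p \<notin> cinv c ` K \<Longrightarrow> f p = 0" and u: "smooth_fun A u"
  shows continuous_on_mult_lap: "continuous_on M (\<lambda>p. f p * lap u c p)"
    and green_chart: "integral\<^sup>L vol (\<lambda>p. f p * lap u c p) = - integral\<^sup>L vol (ip u f)"
proof -
  let ?f = "\<lambda>x. f (cinv c x)"
  let ?Q = "\<lambda>i x. vol_density g c (cinv c x) * grad g u c (cinv c x) $ i"
  let ?I = "indicator (cimg c) :: real^'n \<Rightarrow> real"
  have sub: "cinv c ` K \<subseteq> cdom c"
    using c K(2) by auto
  have f0: "?f x = 0" if "x \<in> cimg c" "x \<notin> K" for x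
    by (rule vanishes_outside_chart_image[OF c K(2) supp that])
  have u1: "C1_fun u"
    using u by (rule smooth_fun_imp_C1_fun)
  have fC: "C1_on (cimg c) ?f"
    using f c by (simp add: C1_fun_def)
  have Q: "C1_on (cimg c) (?Q i)" for i
    by (intro C1_on_mult vol_density_C1 C1_on_grad u c)
  \<comment> \<open>Off \<open>cdom c\<close> the value of \<open>lap u c\<close> is unspecified,
    but \<open>f\<close> vanishes there, so the product is an extension by zero.\<close>
  have "continuous_on M (chart_fun c (\<lambda>x. ?f x * lap u c (cinv c x)))"
    using f0 by (intro continuous_on_chart_fun[OF c K] continuous_intros continuous_on_lap u c
        C1_on_imp_continuous_on[OF fC]) auto
  moreover have "chart_fun c (\<lambda>x. ?f x * lap u c (cinv c x)) p = f p * lap u c p" if "p \<in> M" for p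
    using supp[OF that] sub c by (auto simp: chart_fun_def)
  ultimately show cont: "continuous_on M (\<lambda>p. f p * lap u c p)"
    by (simp cong: continuous_on_cong)
  have "\<forall>x\<in>cimg c - K. ?f x = 0"
    using f0 by blast
  note parts = integration_by_parts_compact_support[OF chart(2)[OF c] K fC Q this]
  have "integral\<^sup>L vol (\<lambda>p. f p * lap u c p) = integral\<^sup>L lborel
      (\<lambda>x. ?I x * (vol_density g c (cinv c x) * (?f x * lap u c (cinv c x))))"
    using supp by (intro integral_chart_supported[OF c K cont]) auto
  also have "\<dots> = integral\<^sup>L lborel (\<lambda>x. \<Sum>i\<in>UNIV. ?I x * (?f x * pd i (?Q i) x))"
  proof (rule LINT_cong[OF refl])
    fix x
    have "vol_density g c (cinv c x) * (?f x * lap u c (cinv c x)) = ?f x * (\<Sum>i\<in>UNIV. pd i (?Q i) x)"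
      if "x \<in> cimg c"
      using lap_cinv[OF c that, of u] by (simp add: mult.left_commute)
    then show "?I x * (vol_density g c (cinv c x) * (?f x * lap u c (cinv c x))) =
        (\<Sum>i\<in>UNIV. ?I x * (?f x * pd i (?Q i) x))"
      by (cases "x \<in> cimg c") (auto simp: sum_distrib_left)
  qed
  also have "\<dots> = (\<Sum>i\<in>UNIV. integral\<^sup>L lborel (\<lambda>x. ?I x * (?f x * pd i (?Q i) x)))"
    by (rule Bochner_Integration.integral_sum) (rule parts(2))
  also have "\<dots> = - (\<Sum>i\<in>UNIV. integral\<^sup>L lborel (\<lambda>x. ?I x * (pd i ?f x * ?Q i x)))"
    unfolding parts(3) by (rule sum_negf)
  also have "(\<Sum>i\<in>UNIV. integral\<^sup>L lborel (\<lambda>x. ?I x * (pd i ?f x * ?Q i x))) =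
      integral\<^sup>L lborel (\<lambda>x. \<Sum>i\<in>UNIV. ?I x * (pd i ?f x * ?Q i x))"
    by (rule Bochner_Integration.integral_sum[symmetric]) (rule parts(1))
  also have "\<dots> = integral\<^sup>L lborel (\<lambda>x. ?I x * (vol_density g c (cinv c x) * ip u f (cinv c x)))"
  proof (rule LINT_cong[OF refl])
    fix x
    show "(\<Sum>i\<in>UNIV. ?I x * (pd i ?f x * ?Q i x)) =
        ?I x * (vol_density g c (cinv c x) * ip u f (cinv c x))"
    proof (cases "x \<in> cimg c")
      case True
      then have "ip u f (cinv c x) = (\<Sum>i\<in>UNIV. grad g u c (cinv c x) $ i * pd i ?f x)"
        using ip_chart[OF u1 f c cinv_in[OF c True]] c
        by (simp add: inner_vec_def dvec_def partial_pd)
      then show ?thesis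
        using True by (simp add: sum_distrib_left mult_ac)
    qed simp
  qed
  \<comment> \<open>Since \<open>f\<close> vanishes off a closed set, so does its differential, and
    \<open>ip u f\<close> inherits the support needed to return to \<open>M\<close>.\<close>
  also have "\<dots> = integral\<^sup>L vol (ip u f)"
  proof (rule integral_chart_supported[OF c K continuous_on_ip[OF u1 f], symmetric])
    fix p assume p: "p \<in> M" "p \<notin> cinv c ` K"
    have "dvec f (chart_at A p) p = 0"
      using chart_at[OF p(1)] p compact_imp_closed[OF compact_cinv_image[OF c K]] supp
      by (intro dvec_eq_0_outside[where L = "cinv c ` K"]) auto
    then show "ip u f p = 0"
      by (simp add: ip_def)
  qed
  finally show "integral\<^sup>L vol (\<lambda>p. f p * lap u c p) = - integral\<^sup>L vol (ip u f)" .
qed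

text \<open>
  The weak formulation determines the Laplacian: test the difference of its two coordinate
  expressions against a bump function supported where that difference is positive.
\<close>

lemma lap_le:
  assumes c: "c \<in> A" and d: "d \<in> A" and p: "p \<in> cdom c" "p \<in> cdom d" and u: "smooth_fun A u"
  shows "lap u c p \<le> lap u d p"
proof (rule ccontr)
  assume neg: "\<not> lap u c p \<le> lap u d p"
  let ?U = "cmap c ` (cdom c \<inter> cdom d)" and ?x = "cmap c p"
  let ?D = "\<lambda>x. lap u c (cinv c x) - lap u d (cinv c x)"
  have U: "open ?U" "?x \<in> ?U"
    using open_overlap[OF c d] p by auto
  have Ueq: "?U = {x \<in> cimg c. cinv c x \<in> cdom c \<inter> cdom d}"
    by (rule cmap_image[OF c]) auto
  have contD: "continuous_on ?U ?D"
  proof (intro continuous_intros)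
    show "continuous_on ?U (\<lambda>x. lap u c (cinv c x))"
      by (rule continuous_on_subset[OF continuous_on_lap[OF u c]]) auto
    have "continuous_on ?U (\<lambda>x. lap u d (cinv d ((cmap d \<circ> cinv c) x)))"
      using transition_Ck[OF c d, of 0] Ueq
      by (intro continuous_on_compose2[OF continuous_on_lap[OF u d]]) auto
    moreover have "lap u d (cinv d ((cmap d \<circ> cinv c) x)) = lap u d (cinv c x)" if "x \<in> ?U" for x
      using that Ueq d by auto
    ultimately show "continuous_on ?U (\<lambda>x. lap u d (cinv c x))"
      by (simp cong: continuous_on_cong)
  qed
  have "open (?U \<inter> ?D -` {0<..})"
    by (rule continuous_open_preimage[OF contD U(1) open_greaterThan])
  moreover have "?x \<in> ?U \<inter> ?D -` {0<..}"
    using U neg c p by simp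
  ultimately obtain r where r: "0 < r" "cball ?x r \<subseteq> ?U \<inter> ?D -` {0<..}"
    unfolding open_contains_cball by blast
  let ?K = "cball ?x r" and ?b = "bump ?x r"
  define f where "f = chart_fun c ?b"
  have Kc: "?K \<subseteq> cimg c"
    using r(2) by auto
  have b0: "?b y = 0" if "y \<notin> ?K" for y
    using that bump_pos_iff[OF r(1), of ?x y] bump_nonneg[of ?x r y] by auto
  have f: "C1_fun f"
    unfolding f_def using b0 by (intro C1_fun_chart_fun[OF c compact_cball Kc] C1_on_bump) auto
  have f0: "f q = 0" if "q \<notin> cinv c ` ?K" for q
    using that b0 cinv_image[OF c Kc] by (auto simp: f_def chart_fun_def)
  \<comment> \<open>The support of \<open>f\<close> read in the chart \<open>d\<close>, so that
    Green's formula holds for the same \<open>f\<close> in both charts.\<close>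
  define L where "L = cmap d ` cinv c ` ?K"
  have sub: "cinv c ` ?K \<subseteq> cdom d"
    using r(2) Ueq by auto
  have L: "compact L" "L \<subseteq> cimg d"
    unfolding L_def using sub compact_cinv_image[OF c compact_cball Kc]
    by (auto intro!: compact_continuous_image continuous_on_subset[OF continuous_on_cmap[OF d]])
  have "cinv d ` L = cinv c ` ?K"
  proof -
    have "(\<lambda>q. cinv d (cmap d q)) ` cinv c ` ?K = (\<lambda>q. q) ` cinv c ` ?K"
      by (intro image_cong refl cinv_cmap[OF d] subsetD[OF sub])
    then show ?thesis
      by (simp add: L_def image_image)
  qed
  then have f0': "f q = 0" if "q \<notin> cinv d ` L" for q
    using f0 that by simp
  have cont1: "continuous_on M (\<lambda>p. f p * lap u c p)"
    by (rule continuous_on_mult_lap[OF c compact_cball Kc f f0 u])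
  have cont2: "continuous_on M (\<lambda>p. f p * lap u d p)"
    by (rule continuous_on_mult_lap[OF d L f f0' u])
  \<comment> \<open>The middle term \<open>ip u f\<close> does not refer to either chart; it links
    the two coordinate expressions.\<close>
  have "integral\<^sup>L vol (\<lambda>p. f p * lap u c p) = - integral\<^sup>L vol (ip u f)"
    by (rule green_chart[OF c compact_cball Kc f f0 u])
  also have "\<dots> = integral\<^sup>L vol (\<lambda>p. f p * lap u d p)"
    by (rule green_chart[OF d L f f0' u, symmetric])
  finally have "integral\<^sup>L vol (\<lambda>p. f p * lap u c p - f p * lap u d p) = 0"
    using integrable_continuous[OF cont1] integrable_continuous[OF cont2] by simp
  moreover have cont: "continuous_on M (\<lambda>p. f p * lap u c p - f p * lap u d p)"
    by (intro continuous_intros cont1 cont2)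
  let ?F = "\<lambda>x. indicator (cimg c) x * (vol_density g c (cinv c x) *
      (f (cinv c x) * lap u c (cinv c x) - f (cinv c x) * lap u d (cinv c x)))"
  have supp: "f q * lap u c q - f q * lap u d q = 0" if "q \<in> M" "q \<notin> cinv c ` ?K" for q
    using f0[OF that(2)] by simp
  ultimately have int0: "integral\<^sup>L lborel ?F = 0"
    using integral_chart_supported[OF c compact_cball Kc cont supp] by simp
  have F: "?F x = indicator (cimg c) x * (vol_density g c (cinv c x) * (?b x * ?D x))" for x
    using c by (auto simp: f_def chart_fun_def indicator_def algebra_simps)
  have nonneg: "0 \<le> ?F x" for x
  proof (cases "x \<in> ?K")
    case True
    then have "x \<in> cimg c" "0 < ?D x"
      using r(2) Kc by auto
    then show ?thesis
      using vol_density_pos[OF c cinv_in[OF c \<open>x \<in> cimg c\<close>]] bump_nonneg[of ?x r x]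
      unfolding F by (intro mult_nonneg_nonneg) auto
  qed (simp add: F b0)
  have pos: "?F x \<noteq> 0" if "x \<in> ball ?x r" for x
  proof -
    have "x \<in> cimg c" "0 < ?D x"
      using r(2) Kc that ball_subset_cball[of ?x r] by blast+
    then show ?thesis
      using vol_density_pos[OF c cinv_in[OF c \<open>x \<in> cimg c\<close>]] bump_pos_iff[OF r(1), of ?x x] that
      unfolding F by simp
  qed
  \<comment> \<open>The integrand is nonnegative with zero integral, hence zero almost everywhere,
    yet it is nonzero on a ball of positive volume.\<close>
  have "AE x in lborel. ?F x = 0"
    using integral_nonneg_eq_0_iff_AE[OF integrable_chart_supported'[OF c compact_cball Kc cont supp]]
      int0 nonneg by simp
  then have "AE x in lborel. x \<notin> ball ?x r"
    by eventually_elim (use pos in blast)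
  then have "emeasure lborel (ball ?x r) = 0"
    using AE_iff_measurable[of "ball ?x r" lborel "\<lambda>x. x \<notin> ball ?x r"] by (simp add: ball_def)
  then have "measure lborel (ball ?x r) = 0"
    by (simp add: measure_def)
  then show False
    using content_ball[of r ?x] r(1) by simp
qed

lemma laplacian_chart:
  assumes "smooth_fun A u" "c \<in> A" "p \<in> cdom c"
  shows "laplacian A g u p = lap u c p"
proof -
  have d: "chart_at A p \<in> A" "p \<in> cdom (chart_at A p)"
    using chart_at assms chart(4) by blast+
  have "lap u (chart_at A p) p = lap u c p"
    using lap_le[OF d(1) assms(2) d(2) assms(3,1)] lap_le[OF assms(2) d(1) assms(3) d(2) assms(1)]
    by (rule antisym)
  then show ?thesis
    by (simp add: laplacian_def divergence_def Let_def lap_def)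
qed

lemma continuous_on_laplacian:
  assumes "smooth_fun A u"
  shows "continuous_on M (laplacian A g u)"
proof (rule continuous_on_M_locally)
  fix c assume c: "c \<in> A"
  show "continuous_on (cimg c) (\<lambda>x. laplacian A g u (cinv c x))"
    using continuous_on_lap[OF assms c] laplacian_chart[OF assms c cinv_in[OF c]]
    by (simp cong: continuous_on_cong)
qed

text \<open>The partition of unity cuts only the test function. Each
  \<open>\<rho> k * \<psi>\<close> lives in one chart, where \<open>laplacian\<close> is
  \<open>lap\<close>; by linearity of the differential the terms \<open>ip u (f k)\<close> recombine
  without derivatives of the cutoffs.\<close>

lemma green:
  assumes \<psi>: "C1_fun \<psi>" and u: "smooth_fun A u"
  shows "integral\<^sup>L vol (\<lambda>p. \<psi> p * laplacian A g u p) = - integral\<^sup>L vol (ip u \<psi>)"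
proof -
  obtain N cs K \<rho> where P: "partition N cs K \<rho>"
    using partition_of_unity by blast
  note * = conjunct1[OF P[unfolded partition_def]] and one = conjunct2[OF P[unfolded partition_def]]
  define f where "f k p = \<rho> k p * \<psi> p" for k p
  have f: "C1_fun (f k)" if "k < N" for k
    unfolding f_def using * that \<psi> by (intro C1_fun_mult) auto
  have u1: "C1_fun u"
    using u by (rule smooth_fun_imp_C1_fun)
  have sum_f: "(\<Sum>k<N. f k p) = \<psi> p" if "p \<in> M" for p
    using one that by (simp add: f_def sum_distrib_right[symmetric])
  have "integral\<^sup>L vol (\<lambda>p. f k p * laplacian A g u p) = - integral\<^sup>L vol (ip u (f k))" if k: "k < N" for k
  proof -
    have c: "cs k \<in> A" and K: "compact (K k)" "K k \<subseteq> cimg (cs k)"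
      using * k by auto
    have supp: "f k p = 0" if "p \<in> M" "p \<notin> cinv (cs k) ` K k" for p
      using * k that by (simp add: f_def)
    have "f k p * laplacian A g u p = f k p * lap u (cs k) p" if "p \<in> space vol" for p
    proof (cases "p \<in> cinv (cs k) ` K k")
      case True
      then have "p \<in> cdom (cs k)" using c K by auto
      then show ?thesis using laplacian_chart[OF u c] by simp
    next
      case False
      then show ?thesis using supp that by (simp add: space_vol)
    qed
    then have "integral\<^sup>L vol (\<lambda>p. f k p * laplacian A g u p) = integral\<^sup>L vol (\<lambda>p. f k p * lap u (cs k) p)"
      by (intro LINT_cong) auto
    also have "\<dots> = - integral\<^sup>L vol (ip u (f k))"
      by (rule green_chart[OF c K f[OF k] supp u])
    finally show ?thesis .
  qed
  moreover have "integral\<^sup>L vol (\<lambda>p. \<psi> p * laplacian A g u p) =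
      (\<Sum>k<N. integral\<^sup>L vol (\<lambda>p. f k p * laplacian A g u p))"
  proof -
    have "integral\<^sup>L vol (\<lambda>p. \<psi> p * laplacian A g u p) =
        integral\<^sup>L vol (\<lambda>p. \<Sum>k<N. f k p * laplacian A g u p)"
      using sum_f by (intro LINT_cong)
        (auto simp: space_vol sum_distrib_right[symmetric])
    also have "\<dots> = (\<Sum>k<N. integral\<^sup>L vol (\<lambda>p. f k p * laplacian A g u p))"
      using f C1_fun_continuous continuous_on_laplacian[OF u]
      by (intro Bochner_Integration.integral_sum integrable_continuous continuous_intros) auto
    finally show ?thesis .
  qed
  moreover have "integral\<^sup>L vol (ip u \<psi>) = (\<Sum>k<N. integral\<^sup>L vol (ip u (f k)))"
  proof -
    have "ip u \<psi> p = (\<Sum>k<N. ip u (f k) p)" if p: "p \<in> M" for p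
    proof -
      let ?c = "chart_at A p"
      have c: "?c \<in> A" "p \<in> cdom ?c" using chart_at[OF p] by auto
      have "dvec \<psi> ?c p = dvec (\<lambda>q. \<Sum>k<N. f k q) ?c p"
        using c sum_f by (intro dvec_cong) auto
      also have "\<dots> = (\<Sum>k<N. dvec (f k) ?c p)"
        using c f by (intro dvec_sum) auto
      finally show ?thesis
        by (simp add: ip_def inner_sum_right)
    qed
    then have "integral\<^sup>L vol (ip u \<psi>) = integral\<^sup>L vol (\<lambda>p. \<Sum>k<N. ip u (f k) p)"
      by (intro LINT_cong) (auto simp: space_vol)
    also have "\<dots> = (\<Sum>k<N. integral\<^sup>L vol (ip u (f k)))"
      using f continuous_on_ip[OF u1]
      by (intro Bochner_Integration.integral_sum integrable_continuous) auto
    finally show ?thesis .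
  qed
  ultimately show ?thesis
    by (simp add: sum_negf)
qed

lemma weak_eigenvalue_equation:
  assumes "laplace_eigenfunction M A g \<nu> u" "C1_fun \<psi>"
  shows "integral\<^sup>L vol (ip u \<psi>) = \<nu> * integral\<^sup>L vol (\<lambda>p. u p * \<psi> p)"
proof -
  have u: "smooth_fun A u" and eq: "\<And>p. p \<in> M \<Longrightarrow> laplacian A g u p = - (\<nu> * u p)"
    using assms(1) by (auto simp: laplace_eigenfunction_def)
  have "integral\<^sup>L vol (ip u \<psi>) = - integral\<^sup>L vol (\<lambda>p. \<psi> p * laplacian A g u p)"
    using green[OF assms(2) u] by simp
  also have "integral\<^sup>L vol (\<lambda>p. \<psi> p * laplacian A g u p) = integral\<^sup>L vol (\<lambda>p. - \<nu> * (u p * \<psi> p))"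
    by (intro LINT_cong) (auto simp: space_vol eq)
  also have "\<dots> = - \<nu> * integral\<^sup>L vol (\<lambda>p. u p * \<psi> p)"
    by (rule integral_mult_right_zero)
  finally show ?thesis by simp
qed

end

subsection \<open>Differentiation in time\<close>

lemma continuous_on_Times_slice:
  assumes "continuous_on (I \<times> V) (\<lambda>(s, x). f s x)"
  shows "s \<in> I \<Longrightarrow> continuous_on V (f s)" and "x \<in> V \<Longrightarrow> continuous_on I (\<lambda>s. f s x)"
proof -
  have "continuous_on V (\<lambda>x. (\<lambda>(s, x). f s x) (s, x))" if "s \<in> I"
    using that by (intro continuous_on_compose2[OF assms] continuous_intros) auto
  then show "s \<in> I \<Longrightarrow> continuous_on V (f s)" by simp
  have "continuous_on I (\<lambda>s. (\<lambda>(s, x). f s x) (s, x))" if "x \<in> V"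
    using that by (intro continuous_on_compose2[OF assms] continuous_intros) auto
  then show "x \<in> V \<Longrightarrow> continuous_on I (\<lambda>s. f s x)" by simp
qed

text \<open>Dominated convergence: by the mean value inequality the quotients of \<open>a\<close>
  are bounded on \<open>K\<close> by the maximum of \<open>a'\<close> over the compact set
  \<open>I \<times> K\<close>. The factor \<open>w (s n)\<close> also moves, but it is common to
  both terms of the difference, so only its continuity in time matters.\<close>

lemma tendsto_integral_difference_quotient:
  fixes a a' w :: "real \<Rightarrow> 'a::euclidean_space \<Rightarrow> real" and s :: "nat \<Rightarrow> real"
  assumes K: "compact K" "K \<subseteq> V" and \<rho>: "continuous_on V \<rho>" "\<forall>x\<in>V - K. \<rho> x = 0"
    and I: "compact I" "convex I"
    and der: "\<And>r x. r \<in> I \<Longrightarrow> x \<in> V \<Longrightarrow> ((\<lambda>s. a s x) has_real_derivative a' r x) (at r within I)"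
    and a: "continuous_on (I \<times> V) (\<lambda>(s, x). a s x)" and a': "continuous_on (I \<times> V) (\<lambda>(s, x). a' s x)"
    and w: "continuous_on (I \<times> V) (\<lambda>(s, x). w s x)"
    and t: "t \<in> I" and s: "\<And>n. s n \<in> I" "\<And>n. s n \<noteq> t" "s \<longlonglongrightarrow> t"
  shows "(\<lambda>n. integral\<^sup>L lborel (\<lambda>x. indicator V x * (\<rho> x * ((a (s n) x - a t x) * w (s n) x))) / (s n - t))
    \<longlonglongrightarrow> integral\<^sup>L lborel (\<lambda>x. indicator V x * (\<rho> x * (a' t x * w t x)))"
proof -
  have bnd: "\<exists>B. \<forall>r\<in>I. \<forall>x\<in>K. \<bar>f r x\<bar> \<le> B" if "continuous_on (I \<times> V) (\<lambda>(s, x). f s x)" for f :: "real \<Rightarrow> 'a \<Rightarrow> real"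
  proof -
    have "compact ((\<lambda>(s, x). f s x) ` (I \<times> K))"
      using K I that by (intro compact_continuous_image compact_Times) (auto intro: continuous_on_subset)
    then have "bounded ((\<lambda>(s, x). f s x) ` (I \<times> K))"
      by (rule compact_imp_bounded)
    then show ?thesis
      by (auto simp: bounded_iff)
  qed
  obtain B1 where B1: "\<forall>r\<in>I. \<forall>x\<in>K. \<bar>a' r x\<bar> \<le> B1" using bnd[OF a'] by blast
  obtain B2 where B2: "\<forall>r\<in>I. \<forall>x\<in>K. \<bar>w r x\<bar> \<le> B2" using bnd[OF w] by blast
  obtain B3 where B3: "\<forall>r\<in>I. \<forall>x\<in>K. \<bar>\<rho> x\<bar> \<le> B3"
  proof -
    have "continuous_on (I \<times> V) (\<lambda>(s, x). \<rho> x)"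
      unfolding case_prod_beta by (intro continuous_on_compose2[OF \<rho>(1)] continuous_intros) auto
    then show ?thesis
      using bnd[of "\<lambda>_. \<rho>"] that by blast
  qed
  define F where "F n x = indicator K x * (\<rho> x * ((a (s n) x - a t x) / (s n - t) * w (s n) x))" for n x
  have "(\<lambda>n. integral\<^sup>L lborel (F n)) \<longlonglongrightarrow> integral\<^sup>L lborel (\<lambda>x. indicator K x * (\<rho> x * (a' t x * w t x)))"
  proof (rule integral_dominated_convergence[where w = "\<lambda>x. \<bar>B3\<bar> * (\<bar>B1\<bar> * \<bar>B2\<bar>) * indicator K x"])
    have meas: "(\<lambda>x. indicator K x * f x) \<in> borel_measurable lborel" if "continuous_on V f" for f :: "'a \<Rightarrow> real"
      using borel_measurable_continuous_on_indicator[of K f] K continuous_on_subset[OF that K(2)]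
        compact_imp_closed[OF K(1)] by simp
    note slice = continuous_on_Times_slice(1)
    show "(\<lambda>x. indicator K x * (\<rho> x * (a' t x * w t x))) \<in> borel_measurable lborel"
      by (intro meas continuous_intros \<rho>(1) slice[OF a' t] slice[OF w t])
    show "F n \<in> borel_measurable lborel" for n
      unfolding F_def using s(2)
      by (intro meas continuous_intros \<rho>(1) slice[OF a t] slice[OF a s(1)] slice[OF w s(1)]) auto
    show "integrable lborel (\<lambda>x. \<bar>B3\<bar> * (\<bar>B1\<bar> * \<bar>B2\<bar>) * indicator K x)"
      using emeasure_bounded_finite[OF compact_imp_bounded[OF K(1)]] compact_imp_closed[OF K(1)]
      by (intro integrable_mult_right integrable_real_indicator) auto
    show "AE x in lborel. (\<lambda>n. F n x) \<longlonglongrightarrow> indicator K x * (\<rho> x * (a' t x * w t x))"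
    proof (rule AE_I2)
      fix x
      show "(\<lambda>n. F n x) \<longlonglongrightarrow> indicator K x * (\<rho> x * (a' t x * w t x))"
      proof (cases "x \<in> K")
        case True
        then have x: "x \<in> V" using K by auto
        have "filterlim s (at t within I) sequentially"
          using s by (auto simp: filterlim_at)
        then have "(\<lambda>n. (a (s n) x - a t x) / (s n - t)) \<longlonglongrightarrow> a' t x"
          using der[OF t x] unfolding has_field_derivative_iff by (rule filterlim_compose[rotated])
        moreover have "(\<lambda>n. w (s n) x) \<longlonglongrightarrow> w t x"
          using continuous_on_Times_slice(2)[OF w x] s(3) t s(1)
          by (intro continuous_on_tendsto_compose[of I "\<lambda>s. w s x"]) auto
        ultimately show ?thesis
          unfolding F_def by (intro tendsto_intros)
      qed (simp add: F_def)
    qed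
    show "AE x in lborel. norm (F n x) \<le> \<bar>B3\<bar> * (\<bar>B1\<bar> * \<bar>B2\<bar>) * indicator K x" for n
    proof (rule AE_I2)
      fix x
      show "norm (F n x) \<le> \<bar>B3\<bar> * (\<bar>B1\<bar> * \<bar>B2\<bar>) * indicator K x"
      proof (cases "x \<in> K")
        case True
        then have x: "x \<in> V" using K by auto
        have "norm (a (s n) x - a t x) \<le> B1 * norm (s n - t)"
          using B1 True der[OF _ x] t s(1) I(2)
          by (intro field_differentiable_bound[where S = I and f' = "\<lambda>r. a' r x"]) auto
        then have "\<bar>(a (s n) x - a t x) / (s n - t)\<bar> \<le> B1"
          using s(2)[of n] by (simp add: field_simps)
        then have q: "\<bar>(a (s n) x - a t x) / (s n - t)\<bar> \<le> \<bar>B1\<bar>" by linarith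
        have "\<bar>\<rho> x\<bar> \<le> \<bar>B3\<bar>" "\<bar>w (s n) x\<bar> \<le> \<bar>B2\<bar>"
          using B2 B3 True s(1)[of n] by fastforce+
        then have "\<bar>\<rho> x\<bar> * (\<bar>(a (s n) x - a t x) / (s n - t)\<bar> * \<bar>w (s n) x\<bar>) \<le> \<bar>B3\<bar> * (\<bar>B1\<bar> * \<bar>B2\<bar>)"
          using q by (intro mult_mono) auto
        then show ?thesis
          using True by (simp add: F_def abs_mult)
      qed (simp add: F_def)
    qed
  qed
  moreover have "integral\<^sup>L lborel (F n) =
      integral\<^sup>L lborel (\<lambda>x. indicator V x * (\<rho> x * ((a (s n) x - a t x) * w (s n) x))) / (s n - t)" for n
  proof -
    have "F n = (\<lambda>x. indicator V x * (\<rho> x * ((a (s n) x - a t x) * w (s n) x)) / (s n - t))"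
      using \<rho>(2) K(2) by (auto simp: F_def fun_eq_iff indicator_def)
    then show ?thesis by simp
  qed
  moreover have "(\<lambda>x. indicator K x * (\<rho> x * (a' t x * w t x))) = (\<lambda>x. indicator V x * (\<rho> x * (a' t x * w t x)))"
    using \<rho>(2) K(2) by (auto simp: fun_eq_iff indicator_def)
  ultimately show ?thesis by simp
qed

text \<open>A local smooth extension \<open>F\<close> need not agree with \<open>f\<close> at times
  outside \<open>I\<close>, but at each fixed time in \<open>I\<close> it agrees on a full
  neighbourhood in space. Hence its derivative in the direction \<open>(0, axis i 1)\<close> is the
  spatial derivative of \<open>f\<close>, and continuity passes over.\<close>

lemma smooth_family_continuous_pd:
  fixes f :: "real \<Rightarrow> real^'n \<Rightarrow> real"
  assumes V: "open V" and f: "smooth_on (I \<times> V) (\<lambda>(t, x). f t x)"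
  shows "continuous_on (I \<times> V) (\<lambda>(t, x). pd i (f t) x)"
  unfolding continuous_on_eq_continuous_within
proof
  fix z assume z: "z \<in> I \<times> V"
  then obtain U F where U: "open U" "z \<in> U" "\<And>k. Ck_on k U F"
    "\<And>y. y \<in> U \<inter> (I \<times> V) \<Longrightarrow> F y = (\<lambda>(t, x). f t x) y"
    using f unfolding smooth_on_def by metis
  let ?e = "(0, axis i 1) :: real \<times> (real^'n)"
  have C1: "\<And>y. y \<in> U \<Longrightarrow> F differentiable (at y)"
    "continuous_on U (\<lambda>y. frechet_derivative F (at y) ?e)"
    using U(3)[of "Suc 0"] by (auto simp: Basis_prod_def axis_in_Basis_iff)
  have eq: "frechet_derivative F (at y) ?e = (\<lambda>(t, x). pd i (f t) x) y" if y: "y \<in> U \<inter> (I \<times> V)" for y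
  proof -
    obtain t x where tx: "y = (t, x)" by (cases y)
    let ?W = "V \<inter> (\<lambda>x. (t, x)) -` U"
    have W: "open ?W" "x \<in> ?W"
      using y tx V U(1) by (auto intro!: continuous_open_preimage continuous_intros)
    have "((\<lambda>x. (t, x)) has_derivative (\<lambda>v. (0, v))) (at x)"
      by (auto intro!: derivative_eq_intros)
    moreover have "(F has_derivative frechet_derivative F (at (t, x))) (at (t, x))"
      using C1(1)[of y] y tx frechet_derivative_works by blast
    ultimately have "((\<lambda>x. F (t, x)) has_derivative (\<lambda>v. frechet_derivative F (at (t, x)) (0, v))) (at x)"
      by (rule has_derivative_compose)
    then have "pd i (\<lambda>x. F (t, x)) x = frechet_derivative F (at (t, x)) ?e"
      by (rule pd_eqI)
    moreover have "pd i (\<lambda>x. F (t, x)) x = pd i (f t) x"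
      using U(4) y tx by (intro pd_cong_open[OF W]) auto
    ultimately show ?thesis
      using tx by simp
  qed
  have "isCont (\<lambda>y. frechet_derivative F (at y) ?e) z"
    using C1(2) U(1,2) by (simp add: continuous_on_eq_continuous_at)
  then have "((\<lambda>y. frechet_derivative F (at y) ?e) \<longlongrightarrow> frechet_derivative F (at z) ?e) (at z within I \<times> V)"
    using continuous_at_imp_continuous_within continuous_within by blast
  moreover have "\<forall>\<^sub>F y in at z within I \<times> V. frechet_derivative F (at y) ?e = (\<lambda>(t, x). pd i (f t) x) y"
    unfolding eventually_at_topological using U(1,2) eq by blast
  ultimately have "((\<lambda>(t, x). pd i (f t) x) \<longlongrightarrow> frechet_derivative F (at z) ?e) (at z within I \<times> V)"
    by (rule Lim_transform_eventually)
  then show "continuous (at z within I \<times> V) (\<lambda>(t, x). pd i (f t) x)"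
    unfolding continuous_within eq[OF IntI[OF U(2) z]] .
qed

text \<open>Smoothness provides an extension to a neighbourhood of \<open>t\<close>, whose
  derivative restricts to \<open>S\<close>; at an endpoint of an interval this is the one-sided
  derivative.\<close>

lemma smooth_on_interval_has_derivative:
  fixes f :: "real \<Rightarrow> real"
  assumes "smooth_on S f" "t \<in> S"
  shows "\<exists>D. (f has_real_derivative D) (at t within S)"
proof -
  obtain U F where U: "open U" "t \<in> U" "\<And>k. Ck_on k U F" "\<And>y. y \<in> U \<inter> S \<Longrightarrow> F y = f y"
    using assms unfolding smooth_on_def by metis
  have "F differentiable (at t)"
    using U(2) U(3)[of "Suc 0"] by simp
  then obtain D where "(F has_real_derivative D) (at t)"
    by (auto simp: real_differentiable_def)
  then have F: "(F has_real_derivative D) (at t within S)"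
    by (rule has_field_derivative_at_within)
  obtain d where d: "0 < d" "ball t d \<subseteq> U"
    using U(1,2) open_contains_ball by metis
  have "(f has_real_derivative D) (at t within S)"
    by (rule has_field_derivative_transform_within[OF F d(1) assms(2)])
       (use U(4) d(2) in \<open>auto simp: subset_iff dist_commute\<close>)
  then show ?thesis ..
qed

section \<open>The evolving metric and its coefficients\<close>

locale metric_family = closed_mfd M A
  for M :: "'m::t2_space set" and A :: "('m, 'n::finite) chart set" +
  fixes T :: real and g h :: "real \<Rightarrow> ('m, 'n) tensor02"
  assumes metrics: "\<And>t. t \<in> {0..T} \<Longrightarrow> riemannian_metric A (g t)"
    and g_smooth: "smooth_tensor02_family A {0..T} g"
    and h_sym: "\<And>t. t \<in> {0..T} \<Longrightarrow> symmetric_tensor02 A (h t)"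
    and h_smooth: "smooth_tensor02_family A {0..T} h"
    and flow: "\<And>t c p i j. t \<in> {0..T} \<Longrightarrow> c \<in> A \<Longrightarrow> p \<in> cdom c \<Longrightarrow>
           ((\<lambda>s. g s c p $ i $ j) has_real_derivative - 2 * h t c p $ i $ j) (at t within {0..T})"
begin

abbreviation vols :: "real \<Rightarrow> 'm measure" where
  "vols t \<equiv> riemannian_volume M A (g t)"

lemma riem: "t \<in> {0..T} \<Longrightarrow> riem_mfd M A (g t)"
  using metrics closed_mfd_axioms by (simp add: riem_mfd_def riem_mfd_axioms_def)

lemma continuous_on_g: "c \<in> A \<Longrightarrow> continuous_on ({0..T} \<times> cimg c) (\<lambda>(t, x). g t c (cinv c x))"
  using g_smooth smooth_on_imp_continuous_on unfolding smooth_tensor02_family_def by blast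

lemma continuous_on_h: "c \<in> A \<Longrightarrow> continuous_on ({0..T} \<times> cimg c) (\<lambda>(t, x). h t c (cinv c x))"
  using h_smooth smooth_on_imp_continuous_on unfolding smooth_tensor02_family_def by blast

lemma continuous_on_h_component:
  "c \<in> A \<Longrightarrow> continuous_on ({0..T} \<times> cimg c) (\<lambda>(t, x). h t c (cinv c x) $ i $ j)"
  using continuous_on_h[of c] unfolding case_prod_beta by (intro continuous_intros)

lemma det_g_pos: "t \<in> {0..T} \<Longrightarrow> c \<in> A \<Longrightarrow> p \<in> cdom c \<Longrightarrow> 0 < det (g t c p)"
  using riem_mfd.det_metric_pos[OF riem] .

lemma continuous_on_density:
  assumes "c \<in> A"
  shows "continuous_on ({0..T} \<times> cimg c) (\<lambda>(t, x). vol_density (g t) c (cinv c x))"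
  using continuous_on_g[OF assms] unfolding case_prod_beta vol_density_def
  by (intro continuous_intros continuous_on_det)

lemma continuous_on_g_inv:
  assumes c: "c \<in> A"
  shows "continuous_on ({0..T} \<times> cimg c) (\<lambda>(t, x). matrix_inv (g t c (cinv c x)) $ i $ j)"
  using continuous_on_g[OF c] unfolding case_prod_beta
proof (rule continuous_on_matrix_inv_component)
  fix z assume "z \<in> {0..T} \<times> cimg c"
  then show "det (g (fst z) c (cinv c (snd z))) \<noteq> 0"
    using det_g_pos[OF _ c cinv_in[OF c]] by (cases z) (auto simp: less_imp_neq[symmetric])
qed

text \<open>The trace of \<open>h\<close> tied to a fixed chart, in contrast to
  \<open>metric_trace\<close>, so that joint continuity in time and coordinates can be
  stated.\<close>

definition trc :: "real \<Rightarrow> ('m, 'n) chart \<Rightarrow> 'm \<Rightarrow> real" where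
  "trc t c p = trace (matrix_inv (g t c p) ** h t c p)"

definition raised :: "real \<Rightarrow> ('m, 'n) chart \<Rightarrow> 'm \<Rightarrow> real^'n^'n" where
  "raised t c p = matrix_inv (g t c p) ** h t c p ** matrix_inv (g t c p)"

lemma continuous_on_trc:
  assumes "c \<in> A"
  shows "continuous_on ({0..T} \<times> cimg c) (\<lambda>(t, x). trc t c (cinv c x))"
  unfolding case_prod_beta trc_def trace_def matrix_matrix_mult_def
  by (simp, intro continuous_on_sum continuous_on_mult
      continuous_on_g_inv[OF assms, unfolded case_prod_beta]
      continuous_on_h_component[OF assms, unfolded case_prod_beta])

lemma continuous_on_raised:
  assumes "c \<in> A"
  shows "continuous_on ({0..T} \<times> cimg c) (\<lambda>(t, x). raised t c (cinv c x) $ i $ j)"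
  unfolding case_prod_beta raised_def matrix_matrix_mult_def
  by (simp, intro continuous_on_sum continuous_on_mult
      continuous_on_g_inv[OF assms, unfolded case_prod_beta]
      continuous_on_h_component[OF assms, unfolded case_prod_beta])

text \<open>With \<open>- 2 * h\<close> as derivative of the metric, Jacobi's formula gives
  \<open>- 2 * trc\<close> times the determinant, and the square root halves the factor.\<close>

lemma density_has_derivative:
  assumes t: "t \<in> {0..T}" and c: "c \<in> A" and p: "p \<in> cdom c"
  shows "((\<lambda>s. vol_density (g s) c p) has_real_derivative - (vol_density (g t) c p * trc t c p))
    (at t within {0..T})"
proof -
  let ?H = "(-2) *\<^sub>R h t c p"
  have pos: "0 < det (g t c p)"
    by (rule det_g_pos[OF t c p])
  have "((\<lambda>s. g s c p $ i $ j) has_real_derivative ?H $ i $ j) (at t within {0..T})" for i j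
    using flow[OF t c p, of i j] by simp
  from has_derivative_det[OF this] pos
  have "((\<lambda>s. det (g s c p)) has_real_derivative det (g t c p) * trace (matrix_inv (g t c p) ** ?H))
      (at t within {0..T})" by simp
  moreover have "trace (matrix_inv (g t c p) ** ?H) = - 2 * trc t c p"
    by (simp add: trc_def trace_def matrix_matrix_mult_def sum_distrib_left mult.left_commute sum_negf)
  ultimately have "((\<lambda>s. det (g s c p)) has_real_derivative det (g t c p) * (- 2 * trc t c p)) (at t within {0..T})"
    by simp
  from DERIV_chain2[OF DERIV_real_sqrt[OF pos] this]
  have "((\<lambda>s. sqrt (det (g s c p))) has_real_derivative
      inverse (sqrt (det (g t c p))) / 2 * (det (g t c p) * (- 2 * trc t c p))) (at t within {0..T})" .
  moreover have "inverse (sqrt (det (g t c p))) / 2 * (det (g t c p) * (- 2 * trc t c p)) =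
      - (sqrt (det (g t c p)) * trc t c p)"
    using pos real_sqrt_mult_self[of "det (g t c p)"] by (simp add: field_simps)
  ultimately show ?thesis
    unfolding vol_density_def by (rule DERIV_cong)
qed

lemma g_inv_has_derivative:
  assumes t: "t \<in> {0..T}" and c: "c \<in> A" and p: "p \<in> cdom c"
  shows "((\<lambda>s. matrix_inv (g s c p) $ i $ j) has_real_derivative 2 * raised t c p $ i $ j)
    (at t within {0..T})"
proof -
  let ?H = "(-2) *\<^sub>R h t c p"
  have d: "((\<lambda>s. g s c p $ i $ j) has_real_derivative ?H $ i $ j) (at t within {0..T})" for i j
    using flow[OF t c p, of i j] by simp
  have "((\<lambda>s. matrix_inv (g s c p) $ i $ j) has_real_derivative
      - (matrix_inv (g t c p) ** ?H ** matrix_inv (g t c p)) $ i $ j) (at t within {0..T})"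
    using det_g_pos[OF _ c p] by (intro has_derivative_matrix_inv[OF d _ t]) (metis less_irrefl)
  moreover have "- (matrix_inv (g t c p) ** ?H ** matrix_inv (g t c p)) $ i $ j = 2 * raised t c p $ i $ j"
    by (simp add: raised_def matrix_matrix_mult_def sum_distrib_left sum_distrib_right sum_negf mult_ac)
  ultimately show ?thesis by simp
qed

text \<open>Integrand times density is a sum of products \<open>a * w\<close>: the coefficients
  \<open>a\<close> come from the geometry and are differentiated, while \<open>w\<close> holds the
  functions and their differentials. \<open>F n\<close> and \<open>F0 n\<close> share
  \<open>w\<close> at time \<open>s n\<close> and differ in the time of \<open>a\<close>, so the
  limit contains \<open>a'\<close> but no time derivative of \<open>w\<close>.\<close>

lemma tendsto_integral_family_quotient:
  fixes a a' w :: "('m, 'n) chart \<Rightarrow> 'j \<Rightarrow> real \<Rightarrow> real^'n \<Rightarrow> real" and s :: "nat \<Rightarrow> real"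
  assumes J: "finite J"
    and t: "t \<in> {0..T}" and s: "\<And>n. s n \<in> {0..T}" "\<And>n. s n \<noteq> t" "s \<longlonglongrightarrow> t"
    and F: "\<And>n. continuous_on M (F n)" and F0: "\<And>n. continuous_on M (F0 n)" and F': "continuous_on M F'"
    and eqF: "\<And>n c x. c \<in> A \<Longrightarrow> x \<in> cimg c \<Longrightarrow>
      vol_density (g (s n)) c (cinv c x) * F n (cinv c x) = (\<Sum>j\<in>J. a c j (s n) x * w c j (s n) x)"
    and eqF0: "\<And>n c x. c \<in> A \<Longrightarrow> x \<in> cimg c \<Longrightarrow>
      vol_density (g t) c (cinv c x) * F0 n (cinv c x) = (\<Sum>j\<in>J. a c j t x * w c j (s n) x)"
    and eqF': "\<And>c x. c \<in> A \<Longrightarrow> x \<in> cimg c \<Longrightarrow>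
      vol_density (g t) c (cinv c x) * F' (cinv c x) = (\<Sum>j\<in>J. a' c j t x * w c j t x)"
    and der: "\<And>c j r x. c \<in> A \<Longrightarrow> j \<in> J \<Longrightarrow> r \<in> {0..T} \<Longrightarrow> x \<in> cimg c \<Longrightarrow>
      ((\<lambda>s. a c j s x) has_real_derivative a' c j r x) (at r within {0..T})"
    and a: "\<And>c j. c \<in> A \<Longrightarrow> j \<in> J \<Longrightarrow> continuous_on ({0..T} \<times> cimg c) (\<lambda>(s, x). a c j s x)"
    and a': "\<And>c j. c \<in> A \<Longrightarrow> j \<in> J \<Longrightarrow> continuous_on ({0..T} \<times> cimg c) (\<lambda>(s, x). a' c j s x)"
    and w: "\<And>c j. c \<in> A \<Longrightarrow> j \<in> J \<Longrightarrow> continuous_on ({0..T} \<times> cimg c) (\<lambda>(s, x). w c j s x)"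
  shows "(\<lambda>n. (integral\<^sup>L (vols (s n)) (F n) -
      integral\<^sup>L (vols t) (F0 n)) / (s n - t))
    \<longlonglongrightarrow> integral\<^sup>L (vols t) F'"
proof -
  obtain N cs K \<rho> where P: "partition N cs K \<rho>"
    using partition_of_unity by blast
  note * = conjunct1[OF P[unfolded partition_def]]
  define r where "r k x = \<rho> k (cinv (cs k) x)" for k x
  define V where "V k = cimg (cs k)" for k
  have c: "cs k \<in> A" and K: "compact (K k)" "K k \<subseteq> V k" if "k < N" for k
    using * that by (auto simp: V_def)
  have r: "continuous_on (V k) (r k)" "\<forall>x\<in>V k - K k. r k x = 0" if "k < N" for k
    using * that C1_on_imp_continuous_on vanishes_outside_chart_image[of "cs k" "K k" "\<rho> k"]
    unfolding r_def V_def C1_fun_def by blast+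
  let ?L = "\<lambda>k b. integral\<^sup>L lborel (\<lambda>x. indicator (V k) x * (r k x * b x))"
  note slice = continuous_on_Times_slice(1)
  have intg: "integrable lborel (\<lambda>x. indicator (V k) x * (r k x * (b x * v x)))"
    if "k < N" "continuous_on (V k) b" "continuous_on (V k) v" for k b v
    using r[OF that(1)] that by (intro integrable_compact_support[OF K[OF that(1)]] continuous_intros) auto
  have ia: "integrable lborel (\<lambda>x. indicator (V k) x * (r k x * (a (cs k) j q x * w (cs k) j (s n) x)))"
    if "k < N" "j \<in> J" "q \<in> {0..T}" for k j q n
    using that s(1) by (intro intg) (auto simp: V_def intro!: slice[OF a[OF c]] slice[OF w[OF c]])
  \<comment> \<open>One expansion for all three integrals; they differ only in the time of the
    metric and in the times at which coefficients and factors are taken.\<close>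
  have part: "integral\<^sup>L (vols q) f =
      (\<Sum>k<N. \<Sum>j\<in>J. ?L k (\<lambda>x. b (cs k) j x * v (cs k) j x))"
    if q: "q \<in> {0..T}" and f: "continuous_on M f"
      and eq: "\<And>c x. c \<in> A \<Longrightarrow> x \<in> cimg c \<Longrightarrow>
        vol_density (g q) c (cinv c x) * f (cinv c x) = (\<Sum>j\<in>J. b c j x * v c j x)"
      and ib: "\<And>k j. k < N \<Longrightarrow> j \<in> J \<Longrightarrow>
        integrable lborel (\<lambda>x. indicator (V k) x * (r k x * (b (cs k) j x * v (cs k) j x)))"
    for q f and b v :: "('m, 'n) chart \<Rightarrow> 'j \<Rightarrow> real^'n \<Rightarrow> real"
  proof -
    have "integral\<^sup>L (vols q) f = (\<Sum>k<N. ?L k (\<lambda>x. vol_density (g q) (cs k) (cinv (cs k) x) * f (cinv (cs k) x)))"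
      unfolding V_def r_def by (rule riem_mfd.integral_partition[OF riem[OF q] P f])
    also have "\<dots> = (\<Sum>k<N. \<Sum>j\<in>J. ?L k (\<lambda>x. b (cs k) j x * v (cs k) j x))"
    proof (intro sum.cong refl, goal_cases)
      case (1 k)
      then have k: "k < N" by simp
      have "?L k (\<lambda>x. vol_density (g q) (cs k) (cinv (cs k) x) * f (cinv (cs k) x)) =
          integral\<^sup>L lborel (\<lambda>x. \<Sum>j\<in>J. indicator (V k) x * (r k x * (b (cs k) j x * v (cs k) j x)))"
      proof (rule LINT_cong[OF refl])
        fix x
        show "indicator (V k) x *
          (r k x * (vol_density (g q) (cs k) (cinv (cs k) x) * f (cinv (cs k) x))) =
          (\<Sum>j\<in>J. indicator (V k) x * (r k x * (b (cs k) j x * v (cs k) j x)))"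
          using eq[OF c[OF k], of x] by (cases "x \<in> V k") (auto simp: V_def sum_distrib_left)
      qed
      also have "\<dots> = (\<Sum>j\<in>J. ?L k (\<lambda>x. b (cs k) j x * v (cs k) j x))"
        by (rule Bochner_Integration.integral_sum) (rule ib[OF k])
      finally show ?case .
    qed
    finally show ?thesis .
  qed
  have 1: "integral\<^sup>L (vols (s n)) (F n) = (\<Sum>k<N. \<Sum>j\<in>J. ?L k (\<lambda>x. a (cs k) j (s n) x * w (cs k) j (s n) x))" for n
    by (rule part[OF s(1) F eqF ia[OF _ _ s(1)]])
  have 2: "integral\<^sup>L (vols t) (F0 n) = (\<Sum>k<N. \<Sum>j\<in>J. ?L k (\<lambda>x. a (cs k) j t x * w (cs k) j (s n) x))" for n
    by (rule part[OF t F0 eqF0 ia[OF _ _ t]])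
  have 3: "integral\<^sup>L (vols t) F' = (\<Sum>k<N. \<Sum>j\<in>J. ?L k (\<lambda>x. a' (cs k) j t x * w (cs k) j t x))"
  proof (rule part[OF t F' eqF'])
    fix k j assume "k < N" "j \<in> J"
    then show "integrable lborel (\<lambda>x. indicator (V k) x * (r k x * (a' (cs k) j t x * w (cs k) j t x)))"
      using t by (intro intg) (auto simp: V_def intro!: slice[OF a'[OF c]] slice[OF w[OF c]])
  qed
  have quot: "(integral\<^sup>L (vols (s n)) (F n) -
      integral\<^sup>L (vols t) (F0 n)) / (s n - t) =
      (\<Sum>k<N. \<Sum>j\<in>J. ?L k (\<lambda>x. (a (cs k) j (s n) x - a (cs k) j t x) * w (cs k) j (s n) x) / (s n - t))" for n
  proof -
    have "?L k (\<lambda>x. a (cs k) j (s n) x * w (cs k) j (s n) x) -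
        ?L k (\<lambda>x. a (cs k) j t x * w (cs k) j (s n) x) =
        ?L k (\<lambda>x. (a (cs k) j (s n) x - a (cs k) j t x) * w (cs k) j (s n) x)"
      if "k < N" "j \<in> J" for k j
      by (subst Bochner_Integration.integral_diff[OF ia[OF that s(1)] ia[OF that t], symmetric])
         (simp add: algebra_simps)
    then show ?thesis
      unfolding 1 2 by (simp add: sum_subtractf[symmetric] sum_divide_distrib)
  qed
  show ?thesis
    unfolding quot 3
  proof (intro tendsto_sum)
    fix k j assume "k \<in> {..<N}" "j \<in> J"
    then have k: "k < N" "j \<in> J" by auto
    show "(\<lambda>n. ?L k (\<lambda>x. (a (cs k) j (s n) x - a (cs k) j t x) * w (cs k) j (s n) x) / (s n - t))
      \<longlonglongrightarrow> ?L k (\<lambda>x. a' (cs k) j t x * w (cs k) j t x)"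
      using der[OF c[OF k(1)] k(2)] a[OF c[OF k(1)] k(2)] a'[OF c[OF k(1)] k(2)] w[OF c[OF k(1)] k(2)]
      unfolding V_def[symmetric]
      by (intro tendsto_integral_difference_quotient[OF K[OF k(1)] r[OF k(1)] compact_Icc _ _ _ _ _ t s]) auto
  qed
qed

section \<open>The evolution formula at a fixed time\<close>

lemma eigenvalue_has_derivative:
  assumes T: "T > 0" and t: "t \<in> {0..T}"
    and eigen: "\<And>s. s \<in> {0..T} \<Longrightarrow> laplace_eigenfunction M A (g s) (lam s) (\<phi> s)"
    and \<phi>: "smooth_fun_family A {0..T} \<phi>"
    and lam: "(lam has_real_derivative D) (at t within {0..T})"
  shows "D * (LINT p|vols t. (\<phi> t p)\<^sup>2) =
      lam t * (LINT p|vols t. metric_trace A (g t) (h t) p * (\<phi> t p)\<^sup>2)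
      - (LINT p|vols t.
           metric_trace A (g t) (h t) p * (grad_norm A (g t) (\<phi> t) p)\<^sup>2)
      + 2 * (LINT p|vols t. tensor_pairing A (g t) (h t) (\<phi> t) p)"
proof -
  \<comment> \<open>An endpoint of the interval other than \<open>t\<close>. The points
    \<open>s n\<close> are convex combinations of \<open>t\<close> and \<open>e\<close>, so they
    stay in \<open>{0..T}\<close> and never equal \<open>t\<close>, even if \<open>t\<close> is
    itself an endpoint.\<close>
  define e where "e = (if t = T then 0 else T)"
  define s where "s n = t + (e - t) * inverse (real (Suc n))" for n
  have e: "e \<noteq> t" "e \<in> {0..T}"
    using T t by (auto simp: e_def)
  have s1: "s n \<in> {0..T}" for n
  proof -
    have "s n = (1 - inverse (real (Suc n))) *\<^sub>R t + inverse (real (Suc n)) *\<^sub>R e"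
      by (simp add: s_def algebra_simps)
    moreover have "inverse (real (Suc n)) \<le> 1" "0 \<le> inverse (real (Suc n))"
      by (auto simp: field_simps)
    ultimately show ?thesis
      using convexD[OF convex_real_interval(5)[of 0 T] t e(2), of "1 - inverse (real (Suc n))" "inverse (real (Suc n))"]
      by simp
  qed
  have s2: "s n \<noteq> t" for n
    using e by (simp add: s_def)
  have "s \<longlonglongrightarrow> t + (e - t) * 0"
    unfolding s_def by (intro tendsto_intros LIMSEQ_inverse_real_of_nat)
  then have s3: "s \<longlonglongrightarrow> t" by simp
  have C1: "C1_fun (\<phi> r)" if "r \<in> {0..T}" for r
    using eigen[OF that] smooth_fun_imp_C1_fun by (simp add: laplace_eigenfunction_def)
  note contC1 = C1_fun_continuous[OF C1]
  have hc: "continuous_on (cimg c) (\<lambda>x. h t c (cinv c x))" if "c \<in> A" for c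
    using continuous_on_Times_slice(1)[OF continuous_on_h[OF that] t] .
  have sm: "smooth_on ({0..T} \<times> cimg c) (\<lambda>(r, x). \<phi> r (cinv c x))" if "c \<in> A" for c
    using \<phi> that by (simp add: smooth_fun_family_def)
  have c\<phi>: "continuous_on ({0..T} \<times> cimg c) (\<lambda>z. \<phi> (fst z) (cinv c (snd z)))" if "c \<in> A" for c
    using smooth_on_imp_continuous_on[OF sm[OF that]] by (simp add: case_prod_beta)
  have dv: "dvec (\<phi> r) c (cinv c x) $ i = pd i (\<lambda>y. \<phi> r (cinv c y)) x" if "c \<in> A" "x \<in> cimg c" for r c x i
    using that by (simp add: dvec_def partial_pd)
  have cd: "continuous_on ({0..T} \<times> cimg c) (\<lambda>z. dvec (\<phi> (fst z)) c (cinv c (snd z)) $ i)" if c: "c \<in> A" for c i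
    by (rule continuous_on_eq[OF smooth_family_continuous_pd[OF chart(2)[OF c] sm[OF c], of i]])
       (auto simp: dv[OF c])
  have c\<phi>t: "continuous_on ({0..T} \<times> cimg c) (\<lambda>z. \<phi> t (cinv c (snd z)))" if "c \<in> A" for c
    using t by (intro continuous_on_compose2[OF c\<phi>[OF that], of _ "\<lambda>z. (t, snd z)", simplified] continuous_intros) auto
  have cdt: "continuous_on ({0..T} \<times> cimg c) (\<lambda>z. dvec (\<phi> t) c (cinv c (snd z)) $ i)" if "c \<in> A" for c i
    using t by (intro continuous_on_compose2[OF cd[OF that], of _ "\<lambda>z. (t, snd z)", simplified] continuous_intros) auto
  note cdens = continuous_on_density[unfolded case_prod_beta]
  note cinvg = continuous_on_g_inv[unfolded case_prod_beta]
  note ctrc = continuous_on_trc[unfolded case_prod_beta]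
  note crais = continuous_on_raised[unfolded case_prod_beta]
  have cH: "continuous_on M (metric_trace A (g t) (h t))"
    by (rule riem_mfd.continuous_on_metric_trace[OF riem[OF t] h_sym[OF t] hc])
  have cP: "continuous_on M (tensor_pairing A (g t) (h t) (\<phi> t))"
    by (rule riem_mfd.continuous_on_tensor_pairing[OF riem[OF t] h_sym[OF t] hc C1[OF t]])
  have cip: "continuous_on M (riem_mfd.ip A (g r) (\<phi> q) (\<phi> t))" if "r \<in> {0..T}" "q \<in> {0..T}" for r q
    by (rule riem_mfd.continuous_on_ip[OF riem[OF that(1)] C1[OF that(2)] C1[OF t]])
  have tr: "metric_trace A (g t) (h t) (cinv c x) = trc t c (cinv c x)" if "c \<in> A" "x \<in> cimg c" for c x
    unfolding trc_def using that by (intro riem_mfd.metric_trace_chart[OF riem[OF t] h_sym[OF t]]) auto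
  let ?H = "metric_trace A (g t) (h t)" and ?P = "tensor_pairing A (g t) (h t) (\<phi> t)"
  let ?ip = "riem_mfd.ip A" and ?v = "\<lambda>r c x. vol_density (g r) c (cinv c x)"
  let ?B = "\<lambda>r c x. matrix_inv (g r c (cinv c x))"
  note dens = density_has_derivative[OF _ _ cinv_in]
  \<comment> \<open>The factor \<open>s n - t\<close> turns a plain limit into a difference quotient.\<close>
  have L0: "(\<lambda>n. (integral\<^sup>L (vols (s n)) (\<lambda>p. (s n - t) * (\<phi> (s n) p * \<phi> t p)) -
      integral\<^sup>L (vols t) (\<lambda>p. 0)) / (s n - t)) \<longlonglongrightarrow> integral\<^sup>L (vols t) (\<lambda>p. \<phi> t p * \<phi> t p)"
  proof (rule tendsto_integral_family_quotient[where J = "{()}" and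
        a = "\<lambda>c _ r x. (r - t) * ?v r c x" and
        a' = "\<lambda>c _ r x. ?v r c x - (r - t) * (?v r c x * trc r c (cinv c x))" and
        w = "\<lambda>c _ r x. \<phi> r (cinv c x) * \<phi> t (cinv c x)", OF _ t s1 s2 s3])
    show "((\<lambda>r. (r - t) * ?v r c x) has_real_derivative
        ?v r c x - (r - t) * (?v r c x * trc r c (cinv c x)))
        (at r within {0..T})" if "c \<in> A" "r \<in> {0..T}" "x \<in> cimg c" for c r x
      by (rule DERIV_cong[OF DERIV_mult[OF DERIV_diff[OF DERIV_ident DERIV_const] dens[OF that(2,1,1,3)]]]) simp
  qed (auto simp: case_prod_beta intro!: continuous_intros contC1 s1 t cdens ctrc c\<phi> c\<phi>t)

  \<comment> \<open>Both integrals contain the same product \<open>\<phi> (s n) * \<phi> t\<close>,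
    so only the density is differentiated; a one-element index set is enough.\<close>
  have L2: "(\<lambda>n. (integral\<^sup>L (vols (s n)) (\<lambda>p. \<phi> (s n) p * \<phi> t p) -
      integral\<^sup>L (vols t) (\<lambda>p. \<phi> (s n) p * \<phi> t p)) / (s n - t))
      \<longlonglongrightarrow> integral\<^sup>L (vols t) (\<lambda>p. - (?H p * (\<phi> t p)\<^sup>2))"
  proof (rule tendsto_integral_family_quotient[where J = "{()}" and
        a = "\<lambda>c _ r x. ?v r c x" and
        a' = "\<lambda>c _ r x. - (?v r c x * trc r c (cinv c x))" and
        w = "\<lambda>c _ r x. \<phi> r (cinv c x) * \<phi> t (cinv c x)", OF _ t s1 s2 s3])
    show "((\<lambda>r. ?v r c x) has_real_derivative
        - (?v r c x * trc r c (cinv c x)))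
        (at r within {0..T})" if "c \<in> A" "r \<in> {0..T}" "x \<in> cimg c" for c r x
      by (rule dens[OF that(2,1,1,3)])
  qed (auto simp: case_prod_beta tr power2_eq_square
      intro!: continuous_intros contC1 s1 t cdens ctrc c\<phi> c\<phi>t cH)

  have ipc: "?v r c x * ?ip (g r) (\<phi> q) (\<phi> t) (cinv c x) =
      (\<Sum>z\<in>UNIV. ?v r c x * ?B r c x $ fst z $ snd z *
        (dvec (\<phi> q) c (cinv c x) $ snd z * dvec (\<phi> t) c (cinv c x) $ fst z))"
    if r: "r \<in> {0..T}" and q: "q \<in> {0..T}" and c: "c \<in> A" and x: "x \<in> cimg c" for r q c x
  proof -
    have "?ip (g r) (\<phi> q) (\<phi> t) (cinv c x) =
        (matrix_inv (g r c (cinv c x)) *v dvec (\<phi> q) c (cinv c x)) \<bullet> dvec (\<phi> t) c (cinv c x)"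
      using riem_mfd.ip_chart[OF riem[OF r] C1[OF q] C1[OF t] c cinv_in[OF c x]]
      by (simp add: riem_mfd.grad_dvec[OF riem[OF r]])
    then show ?thesis
      unfolding sum_matrix_inner[symmetric] by (simp add: sum_distrib_left case_prod_beta mult.assoc)
  qed
  \<comment> \<open>The bracket on the right is the derivative of density times inverse metric by
    the product rule. Contracted twice with \<open>d\<phi>\<close> it gives the density times
    \<open>2 h(grad, grad) - H g(grad, grad)\<close>.\<close>
  have raised: "?v t c x * (2 * ?P (cinv c x) -
        ?H (cinv c x) * ?ip (g t) (\<phi> t) (\<phi> t) (cinv c x)) =
      (\<Sum>z\<in>UNIV. (?v t c x * (2 * raised t c (cinv c x) $ fst z $ snd z) +
          - (?v t c x * trc t c (cinv c x)) * ?B t c x $ fst z $ snd z) *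
        (dvec (\<phi> t) c (cinv c x) $ snd z * dvec (\<phi> t) c (cinv c x) $ fst z))"
    if c: "c \<in> A" and x: "x \<in> cimg c" for c x
  proof -
    let ?p = "cinv c x" and ?vt = "?v t c x"
    let ?Bt = "matrix_inv (g t c (cinv c x))" and ?w = "dvec (\<phi> t) c (cinv c x)"
    note R = riem[OF t] and p = cinv_in[OF c x]
    have "?P ?p = (?Bt *v ?w) \<bullet> (h t c ?p *v (?Bt *v ?w))"
      using riem_mfd.tensor_pairing_chart[OF R h_sym[OF t] C1[OF t] c p]
      by (simp only: riem_mfd.grad_dvec[OF R])
    also have "\<dots> = (transpose ?Bt *v (h t c ?p *v (?Bt *v ?w))) \<bullet> ?w"
      by (subst (1 2) inner_commute) (simp only: inner_transpose_mult inner_commute)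
    also have "\<dots> = (raised t c ?p *v ?w) \<bullet> ?w"
      unfolding riem_mfd.matrix_inv_metric_transpose[OF R c p] raised_def
      by (simp only: matrix_vector_mul_assoc matrix_mul_assoc)
    also have "\<dots> = (\<Sum>z\<in>UNIV. raised t c ?p $ fst z $ snd z * (?w $ snd z * ?w $ fst z))"
      unfolding sum_matrix_inner[symmetric] by (simp add: case_prod_beta)
    finally have 1: "?P ?p = \<dots>" .
    have "?vt * (2 * ?P ?p - trc t c ?p * ?ip (g t) (\<phi> t) (\<phi> t) ?p) =
        2 * ?vt * ?P ?p -
        trc t c ?p * (?vt * ?ip (g t) (\<phi> t) (\<phi> t) ?p)"
      by (simp add: algebra_simps)
    then show ?thesis
      unfolding tr[OF c x] 1 ipc[OF t t c x]
      by (simp add: sum_distrib_left sum_subtractf[symmetric] algebra_simps)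
  qed
  \<comment> \<open>Here the coefficients are indexed by pairs \<open>(i, j)\<close>. In
    \<open>w\<close> one differential is that of \<open>\<phi> r\<close>, the other that of the
    fixed \<open>\<phi> t\<close>, and neither is differentiated in time.\<close>
  have L1: "(\<lambda>n. (integral\<^sup>L (vols (s n)) (?ip (g (s n)) (\<phi> (s n)) (\<phi> t)) -
      integral\<^sup>L (vols t) (?ip (g t) (\<phi> (s n)) (\<phi> t))) / (s n - t))
      \<longlonglongrightarrow> integral\<^sup>L (vols t) (\<lambda>p. 2 * ?P p -
        ?H p * ?ip (g t) (\<phi> t) (\<phi> t) p)"
  proof (rule tendsto_integral_family_quotient[where J = "UNIV :: ('n \<times> 'n) set" and
        a = "\<lambda>c z r x. ?v r c x * ?B r c x $ fst z $ snd z" and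
        a' = "\<lambda>c z r x. ?v r c x * (2 * raised r c (cinv c x) $ fst z $ snd z) +
          - (?v r c x * trc r c (cinv c x)) * ?B r c x $ fst z $ snd z" and
        w = "\<lambda>c z r x. dvec (\<phi> r) c (cinv c x) $ snd z * dvec (\<phi> t) c (cinv c x) $ fst z",
        OF _ t s1 s2 s3])
    show "((\<lambda>r. ?v r c x * ?B r c x $ fst z $ snd z) has_real_derivative
        ?v r c x * (2 * raised r c (cinv c x) $ fst z $ snd z) +
          - (?v r c x * trc r c (cinv c x)) * ?B r c x $ fst z $ snd z)
        (at r within {0..T})" if "c \<in> A" "r \<in> {0..T}" "x \<in> cimg c" for c z r x
      using DERIV_mult'[OF dens[OF that(2,1,1,3)] g_inv_has_derivative[OF that(2,1) cinv_in[OF that(1,3)]]] .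
    show "continuous_on M (\<lambda>p. 2 * ?P p -
        ?H p * ?ip (g t) (\<phi> t) (\<phi> t) p)"
      by (intro continuous_intros cP cH cip t)
    show "continuous_on ({0..T} \<times> cimg c) (\<lambda>(r, x). ?v r c x *
        ?B r c x $ fst z $ snd z)" if "c \<in> A" for c z
      unfolding case_prod_beta by (intro continuous_on_mult cdens cinvg that)
    show "continuous_on ({0..T} \<times> cimg c) (\<lambda>(r, x).
        ?v r c x * (2 * raised r c (cinv c x) $ fst z $ snd z) +
        - (?v r c x * trc r c (cinv c x)) * ?B r c x $ fst z $ snd z)"
      if "c \<in> A" for c z
      unfolding case_prod_beta
      by (intro continuous_on_add continuous_on_mult continuous_on_minus continuous_on_const
          cdens cinvg ctrc crais that)
    show "continuous_on ({0..T} \<times> cimg c) (\<lambda>(r, x). dvec (\<phi> r) c (cinv c x) $ snd z *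
        dvec (\<phi> t) c (cinv c x) $ fst z)" if "c \<in> A" for c z
      unfolding case_prod_beta by (intro continuous_on_mult cd cdt that)
  qed (rule finite_class.finite_UNIV cip[OF s1 s1] cip[OF t s1] | erule (1) raised ipc[OF s1 s1] ipc[OF t s1])+

  have weak: "integral\<^sup>L (vols (s n)) (?ip (g (s n)) (\<phi> (s n)) (\<phi> t)) =
      lam (s n) * integral\<^sup>L (vols (s n)) (\<lambda>p. \<phi> (s n) p * \<phi> t p)" for n
    by (rule riem_mfd.weak_eigenvalue_equation[OF riem[OF s1] eigen[OF s1] C1[OF t]])
  \<comment> \<open>The equation at time \<open>t\<close> has \<open>\<phi> t\<close> as solution
    and \<open>\<phi> (s n)\<close> as test function; symmetry of the Dirichlet form restores the
    order of arguments used at time \<open>s n\<close>.\<close>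
  have weak0: "integral\<^sup>L (vols t) (?ip (g t) (\<phi> (s n)) (\<phi> t)) =
      lam t * integral\<^sup>L (vols t) (\<lambda>p. \<phi> (s n) p * \<phi> t p)" for n
  proof -
    have "integral\<^sup>L (vols t) (?ip (g t) (\<phi> (s n)) (\<phi> t)) =
        integral\<^sup>L (vols t) (?ip (g t) (\<phi> t) (\<phi> (s n)))"
      using riem_mfd.ip_commute[OF riem[OF t]] riem_mfd.space_vol[OF riem[OF t]]
      by (intro LINT_cong) auto
    also have "\<dots> = lam t * integral\<^sup>L (vols t) (\<lambda>p. \<phi> t p * \<phi> (s n) p)"
      by (rule riem_mfd.weak_eigenvalue_equation[OF riem[OF t] eigen[OF t] C1[OF s1]])
    finally show ?thesis
      by (simp add: mult.commute)
  qed
  let ?m = "\<lambda>n. integral\<^sup>L (vols (s n)) (\<lambda>p. \<phi> (s n) p * \<phi> t p)"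
  let ?mt = "\<lambda>n. integral\<^sup>L (vols t) (\<lambda>p. \<phi> (s n) p * \<phi> t p)"
  \<comment> \<open>In \<open>L0\<close> the factor \<open>s n - t\<close> comes out of the integral
    and cancels the denominator, leaving the convergence of the pairings although measure and
    function both vary.\<close>
  have m: "?m \<longlonglongrightarrow> integral\<^sup>L (vols t) (\<lambda>p. \<phi> t p * \<phi> t p)"
    using L0 s2 by simp
  have "filterlim s (at t within {0..T}) sequentially"
    using s1 s2 s3 by (auto simp: filterlim_at)
  then have q: "(\<lambda>n. (lam (s n) - lam t) / (s n - t)) \<longlonglongrightarrow> D"
    using lam unfolding has_field_derivative_iff by (rule filterlim_compose[rotated])
  \<comment> \<open>The term \<open>lam t * ?m n\<close> is added and subtracted. The quotient of
    \<open>lam\<close> then multiplies the convergent \<open>?m n\<close>, and the remaining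
    quotient is that of \<open>L2\<close>.\<close>
  have "(integral\<^sup>L (vols (s n)) (?ip (g (s n)) (\<phi> (s n)) (\<phi> t)) -
      integral\<^sup>L (vols t) (?ip (g t) (\<phi> (s n)) (\<phi> t))) / (s n - t) =
      (lam (s n) - lam t) / (s n - t) * ?m n + lam t * ((?m n - ?mt n) / (s n - t))" for n
    unfolding weak weak0 by (simp add: add_divide_distrib[symmetric] algebra_simps)
  with L1 have "(\<lambda>n. (lam (s n) - lam t) / (s n - t) * ?m n + lam t * ((?m n - ?mt n) / (s n - t)))
      \<longlonglongrightarrow> integral\<^sup>L (vols t) (\<lambda>p. 2 * ?P p -
        ?H p * ?ip (g t) (\<phi> t) (\<phi> t) p)"
    by simp
  moreover have "(\<lambda>n. (lam (s n) - lam t) / (s n - t) * ?m n + lam t * ((?m n - ?mt n) / (s n - t)))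
      \<longlonglongrightarrow> D * integral\<^sup>L (vols t) (\<lambda>p. \<phi> t p * \<phi> t p) +
        lam t * integral\<^sup>L (vols t) (\<lambda>p. - (?H p * (\<phi> t p)\<^sup>2))"
    by (intro tendsto_intros q m L2)
  ultimately have "integral\<^sup>L (vols t) (\<lambda>p. 2 * ?P p -
        ?H p * ?ip (g t) (\<phi> t) (\<phi> t) p) =
      D * integral\<^sup>L (vols t) (\<lambda>p. \<phi> t p * \<phi> t p) +
        lam t * integral\<^sup>L (vols t) (\<lambda>p. - (?H p * (\<phi> t p)\<^sup>2))"
    by (rule LIMSEQ_unique)
  moreover have "integral\<^sup>L (vols t) (\<lambda>p. 2 * ?P p -
        ?H p * ?ip (g t) (\<phi> t) (\<phi> t) p) =
      2 * integral\<^sup>L (vols t) (?P) -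
      integral\<^sup>L (vols t) (\<lambda>p. ?H p * ?ip (g t) (\<phi> t) (\<phi> t) p)"
    by (subst Bochner_Integration.integral_diff)
       (intro riem_mfd.integrable_continuous[OF riem[OF t]] continuous_intros cP cH cip t | simp)+
  moreover have "integral\<^sup>L (vols t) (\<lambda>p. ?H p * ?ip (g t) (\<phi> t) (\<phi> t) p) =
      integral\<^sup>L (vols t) (\<lambda>p. ?H p * (grad_norm A (g t) (\<phi> t) p)\<^sup>2)"
    using riem_mfd.grad_norm_square[OF riem[OF t]] riem_mfd.space_vol[OF riem[OF t]]
    by (intro LINT_cong) auto
  ultimately show ?thesis
    by (simp add: power2_eq_square)
qed

end

theorem theorem2p6:
  fixes M :: "'m::t2_space set"
    and A :: "('m, 'n::finite) chart set"
    and g h :: "real \<Rightarrow> ('m, 'n) tensor02"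
    and T :: real
    and lam :: "real \<Rightarrow> real"
    and \<phi> :: "real \<Rightarrow> 'm \<Rightarrow> real"
  assumes "closed_manifold M A"
    and "CARD('n) > 1"
    and "T > 0"
    and "\<And>t. t \<in> {0..T} \<Longrightarrow> riemannian_metric A (g t)"
    and "smooth_tensor02_family A {0..T} g"
    and "\<And>t. t \<in> {0..T} \<Longrightarrow> symmetric_tensor02 A (h t)"
    and "smooth_tensor02_family A {0..T} h"
    and "\<And>t c p i j. t \<in> {0..T} \<Longrightarrow> c \<in> A \<Longrightarrow> p \<in> cdom c \<Longrightarrow>
           ((\<lambda>s. g s c p $ i $ j) has_real_derivative - 2 * h t c p $ i $ j) (at t within {0..T})"
    and "\<And>t. t \<in> {0..T} \<Longrightarrow> first_nonzero_eigenvalue M A (g t) (lam t)"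
    and "\<And>t. t \<in> {0..T} \<Longrightarrow> laplace_eigenfunction M A (g t) (lam t) (\<phi> t)"
    and "smooth_on {0..T} lam"
    and "smooth_fun_family A {0..T} \<phi>"
  shows "\<forall>t\<in>{0..T}. \<exists>lam'. (lam has_real_derivative lam') (at t within {0..T}) \<and>
    lam' * (LINT p|riemannian_volume M A (g t). (\<phi> t p)\<^sup>2) =
      lam t * (LINT p|riemannian_volume M A (g t). metric_trace A (g t) (h t) p * (\<phi> t p)\<^sup>2)
      - (LINT p|riemannian_volume M A (g t).
           metric_trace A (g t) (h t) p * (grad_norm A (g t) (\<phi> t) p)\<^sup>2)
      + 2 * (LINT p|riemannian_volume M A (g t). tensor_pairing A (g t) (h t) (\<phi> t) p)"
proof (rule ballI, goal_cases)
  case t: (1 t)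
  have "M \<noteq> {}"
    using assms(10)[OF t] by (auto simp: laplace_eigenfunction_def)
  then interpret metric_family M A T g h
    using assms(1,4-8) by unfold_locales
  obtain D where D: "(lam has_real_derivative D) (at t within {0..T})"
    using smooth_on_interval_has_derivative[OF assms(11) t] by blast
  then show ?case
    using eigenvalue_has_derivative[OF assms(3) t assms(10,12) D] by blast
qed

end
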